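(* For each $n\ge1$ let $\widetilde{\mathbb{P}}_n$ be the law, on the space $Y$ of Verblunsky coefficient sequences, of the sequence of Verblunsky coefficients of the spectral measure of $(U,e_1)$, where $U$ is a Haar-distributed random $n\times n$ unitary matrix and $e_1$ is the first standard basis vector of $\mathbb{C}^n$. Then $\{\widetilde{\mathbb{P}}_n\}_{n\ge1}$ obeys a large deviation principle on $Y$ with speed $n$ and good rate function $$\widetilde{I}(\alpha) = -\sum_{j=0}^{\infty}\log(1-|\alpha_j|^2).$$
   Context: $\mathbb{D}$ is the open unit disc in $\mathbb{C}$ and $\partial\mathbb{D}$ the unit circle. The spectral measure of $(U,e_1)$ is the probability measure $\mu$ on $\partial\mathbb{D}$ with $\int z^k\,d\mu(z)=\langle e_1,U^ke_1\rangle$ for all $k\in\mathbb{Z}$; almost surely it is supported on exactly $n$ points. Verblunsky coefficients: for a probability measure $\mu$ on $\partial\mathbb{D}$, the monic orthogonal polynomials $\Phi_k$ in $L^2(\mu)$ satisfy $\Phi_{k+1}(z)=z\Phi_k(z)-\overline{\alpha}_k\Phi_k^*(z)$, $\Phi_0\equiv1$, $\Phi_k^*(z)=z^k\overline{\Phi_k(1/\bar z)}$, which defines $\alpha_k$. If $\mu$ has infinite support, one gets $\{\alpha_k\}_{k=0}^\infty$ with all $\alpha_k\in\mathbb{D}$. If $\mu$ is supported on exactly $N$ points $\lambda_1,\dots,\lambda_N$, then $\Phi_N(z)=\prod_j(z-\lambda_j)$ and one gets $\alpha_0,\dots,\alpha_{N-2}\in\mathbb{D}$, $\alpha_{N-1}\in\partial\mathbb{D}$.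 The space $Y$ of Verblunsky coefficient sequences consists of all sequences $\alpha=\{\alpha_k\}_{k=0}^{N(\alpha)-1}$ with $1\le N(\alpha)\le\infty$ such that: if $N(\alpha)=\infty$ all $\alpha_k\in\mathbb{D}$; if $N(\alpha)<\infty$ then $\alpha_{N(\alpha)-1}\in\partial\mathbb{D}$ and the other entries are in $\mathbb{D}$. Its (compact, metrizable) topology is given by: $\alpha^{(j)}\to\alpha^{(\infty)}$ iff, when $N(\alpha^{(\infty)})=\infty$, $N(\alpha^{(j)})\to\infty$ and $\alpha^{(j)}_k\to\alpha^{(\infty)}_k$ for each fixed $k$; and, when $N(\alpha^{(\infty)})=N_0<\infty$, $\alpha^{(j)}_k\to\alpha^{(\infty)}_k$ for $k=0,\dots,N_0-1$ (so in particular these entries exist for all large $j$). Convention: $-\log 0=+\infty$, and for a finite sequence the sum is over the existing indices $0\le j\le N(\alpha)-1$; hence $\widetilde I(\alpha)=\infty$ if $N(\alpha)<\infty$. Large deviation principle (LDP): a sequence $\{\mathbb{P}_n\}$ of probability measures on a Polish space $X$ obeys an LDP with rate function $I:X\to[0,\infty]$ and speed $a_n$ (positive numbers with $a_n\to\infty$) if (1) $I$ is non-negative and lower semicontinuous; (2) for every open $O\subset X$, $\liminf_{n\to\infty}\frac1{a_n}\log\mathbb{P}_n(O)\ge-\inf_{x\in O}I(x)$; (3) for every closed $K\subset X$, $\limsup_{n\to\infty}\frac1{a_n}\log\mathbb{P}_n(K)\le-\inf_{x\in K}I(x)$. The rate function is good if $\{x: I(x)\le\alpha\}$ is compact for every $\alpha>0$.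 *)

theory Defs
  imports
    "HOL-Probability.Probability"
    "HOL-Computational_Algebra.Polynomial"
    "Jordan_Normal_Form.Schur_Decomposition"
begin

text \<open>Haar measure on the unitary group\<close>

definition unitary_group :: "nat \<Rightarrow> complex mat set" where
  "unitary_group n = {U \<in> carrier_mat n n. mat_adjoint U * U = 1\<^sub>m n}"

text \<open>The Borel sigma-algebra of \<open>U(n)\<close>, as a subspace of the space of \<open>n \<times> n\<close> matrices: it is
  pulled back along the entries from the product sigma-algebra, which is the Borel sigma-algebra
  of the (finite) product.\<close>

definition unitary_borel :: "nat \<Rightarrow> complex mat measure" where
  "unitary_borel n = vimage_algebra (unitary_group n)
     (\<lambda>U. \<lambda>ij\<in>{..<n} \<times> {..<n}. U $$ ij) (\<Pi>\<^sub>M ij\<in>{..<n} \<times> {..<n}. borel)"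

definition haar_unitary :: "nat \<Rightarrow> complex mat measure \<Rightarrow> bool" where
  "haar_unitary n H \<longleftrightarrow>
     prob_space H \<and> sets H = sets (unitary_borel n) \<and>
     (\<forall>V\<in>unitary_group n. distr H H (\<lambda>U. V * U) = H)"


text \<open>Spectral measures\<close>

definition circle_borel :: "complex measure" where
  "circle_borel = restrict_space borel (sphere 0 1)"

text \<open>Negative powers are meant for unitary \<open>U\<close> only, whose inverse is the adjoint.\<close>

definition unitary_power :: "complex mat \<Rightarrow> int \<Rightarrow> complex mat" where
  "unitary_power U k = (if 0 \<le> k then U ^\<^sub>m nat k else mat_adjoint U ^\<^sub>m nat (- k))"

text \<open>In \<open>v \<bullet>c w\<close> the second argument is conjugated, so the right-hand side of the moment
  condition is \<open>\<langle>e\<^sub>1, U\<^sup>k e\<^sub>1\<rangle>\<close> for the inner product that is antilinear in its first argument.\<close>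

definition is_spectral_measure :: "complex mat \<Rightarrow> complex measure \<Rightarrow> bool" where
  "is_spectral_measure U \<mu> \<longleftrightarrow>
     prob_space \<mu> \<and> sets \<mu> = sets circle_borel \<and>
     (\<forall>k::int. (LINT z|\<mu>. z powi k) =
        (unitary_power U k *\<^sub>v unit_vec (dim_row U) 0) \<bullet>c unit_vec (dim_row U) 0)"

definition spectral_measure :: "complex mat \<Rightarrow> complex measure" where
  "spectral_measure U = (THE \<mu>. is_spectral_measure U \<mu>)"


text \<open>Verblunsky coefficients of a probability measure on the unit circle\<close>

definition circle_support :: "complex measure \<Rightarrow> complex set" where
  "circle_support \<mu> = {z \<in> sphere 0 1. \<forall>\<epsilon>>0. measure \<mu> (ball z \<epsilon> \<inter> sphere 0 1) > 0}"

definition support_size :: "complex measure \<Rightarrow> enat" where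
  "support_size \<mu> =
     (if finite (circle_support \<mu>) then enat (card (circle_support \<mu>)) else \<infinity>)"

text \<open>The defining property has exactly one solution for each \<open>k \<le> support_size \<mu>\<close>. If the
  support consists of exactly \<open>N\<close> points, then for \<open>k = N\<close> this solution is the product of the
  \<open>z - \<lambda>\<close> over the points \<open>\<lambda>\<close> of the support, because the polynomials of degree less than \<open>N\<close>
  already exhaust \<open>L\<^sup>2(\<mu>)\<close>.\<close>

definition monic_OP :: "complex measure \<Rightarrow> nat \<Rightarrow> complex poly" where
  "monic_OP \<mu> k = (THE p. degree p = k \<and> lead_coeff p = 1 \<and>
     (\<forall>q. degree q < k \<longrightarrow> (LINT z|\<mu>. cnj (poly q z) * poly p z) = 0))"

definition reversed_poly :: "complex poly \<Rightarrow> complex poly" where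
  "reversed_poly p = reflect_poly (map_poly cnj p)"

lemma poly_reversed_poly:
  assumes "z \<noteq> 0"
  shows "poly (reversed_poly p) z = z ^ degree p * cnj (poly p (1 / cnj z))"
proof -
  have "degree (map_poly cnj p) = degree p"
    by (rule degree_map_poly) simp
  moreover have "poly (map_poly cnj p) (cnj w) = cnj (poly p w)" for w
    by (induction p) (auto simp: map_poly_pCons)
  from this[of "1 / cnj z"] have "poly (map_poly cnj p) (1 / z) = cnj (poly p (1 / cnj z))"
    by simp
  ultimately show ?thesis
    using assms by (simp add: reversed_poly_def poly_reflect_poly_nz inverse_eq_divide)
qed

definition verblunsky_coeff :: "complex measure \<Rightarrow> nat \<Rightarrow> complex" where
  "verblunsky_coeff \<mu> k = (THE a. monic_OP \<mu> (Suc k) =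
     [:0, 1:] * monic_OP \<mu> k - Polynomial.smult (cnj a) (reversed_poly (monic_OP \<mu> k)))"


text \<open>The space of Verblunsky coefficient sequences. A sequence is a pair of its length and its
  entries; entries past the length do not exist and are represented by \<open>0\<close>.\<close>

type_synonym vseq = "enat \<times> (nat \<Rightarrow> complex)"

abbreviation vlen :: "vseq \<Rightarrow> enat" where "vlen \<equiv> fst"
abbreviation ventry :: "vseq \<Rightarrow> nat \<Rightarrow> complex" where "ventry \<equiv> snd"

definition verblunsky :: "complex measure \<Rightarrow> vseq" where
  "verblunsky \<mu> = (support_size \<mu>,
     \<lambda>k. if enat k < support_size \<mu> then verblunsky_coeff \<mu> k else 0)"

definition Y :: "vseq set" where
  "Y = {\<alpha>. 1 \<le> vlen \<alpha> \<and>
     (\<forall>k. enat k < vlen \<alpha> \<longrightarrow>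
        (if enat (Suc k) = vlen \<alpha> then cmod (ventry \<alpha> k) = 1 else cmod (ventry \<alpha> k) < 1)) \<and>
     (\<forall>k. vlen \<alpha> \<le> enat k \<longrightarrow> ventry \<alpha> k = 0)}"

definition Y_conv :: "(nat \<Rightarrow> vseq) \<Rightarrow> vseq \<Rightarrow> bool" where
  "Y_conv f \<alpha> \<longleftrightarrow>
     (if vlen \<alpha> = \<infinity>
      then ((\<lambda>j. vlen (f j)) \<longlonglongrightarrow> \<infinity>) \<and> (\<forall>k. (\<lambda>j. ventry (f j) k) \<longlonglongrightarrow> ventry \<alpha> k)
      else (\<forall>k. enat k < vlen \<alpha> \<longrightarrow>
             (\<forall>\<^sub>F j in sequentially. enat k < vlen (f j)) \<and>
             (\<lambda>j. ventry (f j) k) \<longlonglongrightarrow> ventry \<alpha> k))"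

text \<open>The topology prescribed by this notion of convergence: a set is open iff every
  sequence in \<open>Y\<close> that converges to one of its points is eventually inside it. A metrizable topology is determined by its convergent
  sequences in this way, and \<open>limitin_Y_top\<close> below shows that the convergent sequences are indeed
  the prescribed ones.\<close>

definition Y_top :: "vseq topology" where
  "Y_top = topology (\<lambda>W. W \<subseteq> Y \<and>
     (\<forall>f \<alpha>. range f \<subseteq> Y \<and> \<alpha> \<in> W \<and> Y_conv f \<alpha> \<longrightarrow> (\<forall>\<^sub>F j in sequentially. f j \<in> W)))"

lemma openin_Y_top:
  "openin Y_top W \<longleftrightarrow> W \<subseteq> Y \<and>
     (\<forall>f \<alpha>. range f \<subseteq> Y \<and> \<alpha> \<in> W \<and> Y_conv f \<alpha> \<longrightarrow> (\<forall>\<^sub>F j in sequentially. f j \<in> W))"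
  (is "_ \<longleftrightarrow> ?P W")
proof -
  have "istopology ?P"
    unfolding istopology_def
  proof (intro conjI allI impI)
    fix S T assume S: "?P S" and T: "?P T"
    show "S \<inter> T \<subseteq> Y" using S by blast
    fix f \<alpha> assume "range f \<subseteq> Y \<and> \<alpha> \<in> S \<inter> T \<and> Y_conv f \<alpha>"
    then have "\<forall>\<^sub>F j in sequentially. f j \<in> S" "\<forall>\<^sub>F j in sequentially. f j \<in> T"
      using S T by blast+
    then show "\<forall>\<^sub>F j in sequentially. f j \<in> S \<inter> T" by eventually_elim simp
  next
    fix K assume K: "\<forall>S\<in>K. ?P S"
    show "\<Union>K \<subseteq> Y" using K by blast
    fix f \<alpha> assume a: "range f \<subseteq> Y \<and> \<alpha> \<in> \<Union>K \<and> Y_conv f \<alpha>"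
    then obtain S where S: "S \<in> K" "\<alpha> \<in> S" by blast
    with K a have "\<forall>\<^sub>F j in sequentially. f j \<in> S" by blast
    then show "\<forall>\<^sub>F j in sequentially. f j \<in> \<Union>K"
      by eventually_elim (use S in blast)
  qed
  then show ?thesis by (simp add: Y_top_def)
qed

lemma topspace_Y_top: "topspace Y_top = Y"
proof -
  have "openin Y_top Y"
    unfolding openin_Y_top by (intro conjI allI impI always_eventually) auto
  then have "Y \<subseteq> topspace Y_top" by (rule openin_subset)
  moreover have "topspace Y_top \<subseteq> Y"
    using openin_topspace[of Y_top] unfolding openin_Y_top by (rule conjunct1)
  ultimately show ?thesis by simp
qed

lemma Y_conv_entryD:
  assumes "Y_conv f \<alpha>" "enat k < vlen \<alpha>"
  shows "\<forall>\<^sub>F j in sequentially. enat k < vlen (f j)"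
    and "(\<lambda>j. ventry (f j) k) \<longlonglongrightarrow> ventry \<alpha> k"
  using assms by (auto simp: Y_conv_def order_tendsto_iff split: if_splits)

lemma limitin_Y_top:
  assumes f: "range f \<subseteq> Y"
  shows "limitin Y_top f \<alpha> sequentially \<longleftrightarrow> \<alpha> \<in> Y \<and> Y_conv f \<alpha>"
proof
  assume \<alpha>: "\<alpha> \<in> Y \<and> Y_conv f \<alpha>"
  show "limitin Y_top f \<alpha> sequentially"
    unfolding limitin_def topspace_Y_top
  proof (intro conjI allI impI)
    show "\<alpha> \<in> Y" using \<alpha> ..
    fix W assume W: "openin Y_top W \<and> \<alpha> \<in> W"
    then have "range f \<subseteq> Y \<and> \<alpha> \<in> W \<and> Y_conv f \<alpha> \<longrightarrow> (\<forall>\<^sub>F j in sequentially. f j \<in> W)"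
      unfolding openin_Y_top by metis
    then show "\<forall>\<^sub>F j in sequentially. f j \<in> W" using f \<alpha> W by simp
  qed
next
  assume lim: "limitin Y_top f \<alpha> sequentially"
  then have \<alpha>: "\<alpha> \<in> Y" by (simp add: limitin_def topspace_Y_top)
  have nbhd: "\<forall>\<^sub>F j in sequentially. enat k < vlen (f j) \<and> dist (ventry (f j) k) (ventry \<alpha> k) < e"
    if k: "enat k < vlen \<alpha>" and e: "e > 0" for k e
  proof -
    define W where "W = {\<beta> \<in> Y. enat k < vlen \<beta> \<and> dist (ventry \<beta> k) (ventry \<alpha> k) < e}"
    have "openin Y_top W"
      unfolding openin_Y_top
    proof (intro conjI allI impI)
      show "W \<subseteq> Y" by (auto simp: W_def)
      fix g \<beta> assume g: "range g \<subseteq> Y \<and> \<beta> \<in> W \<and> Y_conv g \<beta>"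
      then have \<beta>: "enat k < vlen \<beta>" "dist (ventry \<beta> k) (ventry \<alpha> k) < e"
        by (auto simp: W_def)
      have "(\<lambda>j. dist (ventry (g j) k) (ventry \<alpha> k)) \<longlonglongrightarrow> dist (ventry \<beta> k) (ventry \<alpha> k)"
        using Y_conv_entryD(2)[of g \<beta> k] g \<beta> by (intro tendsto_intros) auto
      then have "\<forall>\<^sub>F j in sequentially. dist (ventry (g j) k) (ventry \<alpha> k) < e"
        using \<beta>(2) by (rule order_tendstoD)
      moreover have "\<forall>\<^sub>F j in sequentially. enat k < vlen (g j)"
        using Y_conv_entryD(1)[of g \<beta> k] g \<beta> by auto
      ultimately show "\<forall>\<^sub>F j in sequentially. g j \<in> W"
        by eventually_elim (use g in \<open>auto simp: W_def\<close>)
    qed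
    moreover have "\<alpha> \<in> W" using \<alpha> k e by (simp add: W_def)
    ultimately have "\<forall>\<^sub>F j in sequentially. f j \<in> W"
      using lim by (auto simp: limitin_def)
    then show ?thesis by eventually_elim (simp add: W_def)
  qed
  have len: "\<forall>\<^sub>F j in sequentially. enat k < vlen (f j)" if "enat k < vlen \<alpha>" for k
    using nbhd[OF that, of 1] by (auto elim: eventually_mono)
  have ent: "(\<lambda>j. ventry (f j) k) \<longlonglongrightarrow> ventry \<alpha> k" if "enat k < vlen \<alpha>" for k
  proof (rule tendstoI)
    fix e :: real assume "0 < e"
    from nbhd[OF that this]
    show "\<forall>\<^sub>F j in sequentially. dist (ventry (f j) k) (ventry \<alpha> k) < e"
      by eventually_elim simp
  qed
  have inf: "(\<lambda>j. vlen (f j)) \<longlonglongrightarrow> \<infinity>" if "vlen \<alpha> = \<infinity>"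
  proof (rule order_tendstoI)
    fix a :: enat assume "a < \<infinity>"
    then obtain k where "a = enat k" by (cases a) auto
    then show "\<forall>\<^sub>F j in sequentially. a < vlen (f j)" using len[of k] that by simp
  qed auto
  show "\<alpha> \<in> Y \<and> Y_conv f \<alpha>"
    using \<alpha> len ent inf by (auto simp: Y_conv_def)
qed


text \<open>Large deviation principles\<close>

definition log_ereal :: "real \<Rightarrow> ereal" where
  "log_ereal p = (if p = 0 then - \<infinity> else ereal (ln p))"

definition borel_of :: "'a topology \<Rightarrow> 'a measure" where
  "borel_of X = sigma (topspace X) {W. openin X W}"

definition lsc_on_topology :: "'a topology \<Rightarrow> ('a \<Rightarrow> ereal) \<Rightarrow> bool" where
  "lsc_on_topology X I \<longleftrightarrow> (\<forall>c. openin X {x \<in> topspace X. c < I x})"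

text \<open>The sequence of measures and the speed are indexed from \<open>1\<close>; their values at \<open>0\<close> play no
  role.\<close>

definition LDP :: "'a topology \<Rightarrow> (nat \<Rightarrow> 'a measure) \<Rightarrow> ('a \<Rightarrow> ereal) \<Rightarrow> (nat \<Rightarrow> real) \<Rightarrow> bool" where
  "LDP X P I a \<longleftrightarrow>
     completely_metrizable_space X \<and> second_countable X \<and>
     (\<forall>n\<ge>1. prob_space (P n) \<and> sets (P n) = sets (borel_of X)) \<and>
     (\<forall>n\<ge>1. 0 < a n) \<and> filterlim a at_top sequentially \<and>
     (\<forall>x\<in>topspace X. 0 \<le> I x) \<and> lsc_on_topology X I \<and>
     (\<forall>W. openin X W \<longrightarrow>
        - (INF x\<in>W. I x) \<le> liminf (\<lambda>n. ereal (1 / a n) * log_ereal (measure (P n) W))) \<and>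
     (\<forall>K. closedin X K \<longrightarrow>
        limsup (\<lambda>n. ereal (1 / a n) * log_ereal (measure (P n) K)) \<le> - (INF x\<in>K. I x))"

definition good_rate_function :: "'a topology \<Rightarrow> ('a \<Rightarrow> ereal) \<Rightarrow> bool" where
  "good_rate_function X I \<longleftrightarrow>
     (\<forall>c::real. 0 < c \<longrightarrow> compactin X {x \<in> topspace X. I x \<le> ereal c})"

definition verblunsky_rate :: "vseq \<Rightarrow> ereal" where
  "verblunsky_rate \<alpha> =
     (\<Sum>j. if enat j < vlen \<alpha> then - log_ereal (1 - (cmod (ventry \<alpha> j))\<^sup>2) else 0)"

end

theory Submission
  imports Defs "Jordan_Normal_Form.Spectral_Radius" "HOL-Real_Asymp.Real_Asymp"
begin

text \<open>Since \<open>U\<close> and \<open>U (1 \<oplus> W)\<close> have the same law for independent Haar matrices \<open>U\<close> of size \<open>n\<close> and \<open>W\<close>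
  of size \<open>n - 1\<close>, one step of the Schur algorithm shows that \<open>\<alpha>\<^sub>0\<close> is the conjugate of the corner
  entry of \<open>U\<close> and that \<open>(\<alpha>\<^sub>1, \<alpha>\<^sub>2, \<dots>)\<close> is independent of it and distributed like the coefficients of
  \<open>W\<close>. The law of \<open>|U\<^sub>0\<^sub>0|\<^sup>2\<close> has density \<open>(n - 1) (1 - t)\<^sup>n\<^sup>-\<^sup>2\<close>: rotating two coordinates yields a recursion for
  its moments. With \<open>p\<^sub>k = \<Prod>\<^sub>j\<^sub><\<^sub>k (1 - |\<alpha>\<^sub>j|\<^sup>2)\<close>, induction on \<open>k\<close> then gives
  \<open>P(p\<^sub>k < \<delta>) \<le> n\<^sup>k \<delta>\<^sup>n\<^sup>-\<^sup>k\<^sup>-\<^sup>1\<close>, and a lower bound \<open>C p\<^sub>k(z)\<^sup>n\<close> for the probability that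
  \<open>\<alpha>\<^sub>0, \<dots>, \<alpha>\<^sub>k\<^sub>-\<^sub>1\<close> are close to \<open>z\<^sub>0, \<dots>, z\<^sub>k\<^sub>-\<^sub>1\<close>. As \<open>Y\<close> is compact and the rate is the increasing limit of
  \<open>- log p\<^sub>k\<close>, a closed set on which the rate exceeds \<open>c\<close> lies in some \<open>{p\<^sub>k < e\<^sup>-\<^sup>c}\<close>, which gives the
  upper bound; the lower bound follows because the boxes form neighbourhood bases at the points of finite
  rate.\<close>

section \<open>The space of Verblunsky sequences\<close>

text \<open>Several obstacles shape the proof. The spectral measure and its coefficients are
  definite descriptions, which say nothing about measurability in U. They are therefore recomputed
  by a Szego recursion on vectors that uses only arithmetic in the entries of U; with total division
  the identification holds for every unitary matrix, repeated eigenvalues and vanishing weights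
  included, so no exceptional set has to be removed at this point. Haar measure is characterized by
  left invariance; right invariance is recovered by integrating a function of
  \<open>mat_adjoint V * U\<close> in both orders. The Schur step requires a corner entry of modulus
  below 1, and it rests on the orthogonality of \<Phi>_k to 1 for k > 0: this is what lets the 2 x 2
  block act trivially on the remaining vectors. Finally, only the modulus of the corner entry gets
  an explicit law; its phase is handled by covering an annulus with finitely many rotated copies of
  one disc.\<close>

definition vprod :: "(nat \<Rightarrow> complex) \<Rightarrow> nat \<Rightarrow> real" where
  "vprod a k = (\<Prod>j<k. 1 - (cmod (a j))\<^sup>2)"

lemma vprod_0 [simp]: "vprod a 0 = 1"
  by (simp add: vprod_def)

lemma vprod_Suc: "vprod a (Suc k) = vprod a k * (1 - (cmod (a k))\<^sup>2)"
  by (simp add: vprod_def)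

lemma vprod_Suc_shift: "vprod a (Suc k) = (1 - (cmod (a 0))\<^sup>2) * vprod (\<lambda>j. a (Suc j)) k"
  unfolding vprod_def by (subst prod.lessThan_Suc_shift) simp

lemma vprod_nonneg: "(\<And>j. cmod (a j) \<le> 1) \<Longrightarrow> 0 \<le> vprod a k"
  unfolding vprod_def by (intro prod_nonneg) (simp add: power_le_one)

lemma vprod_Suc_le: "(\<And>j. cmod (a j) \<le> 1) \<Longrightarrow> vprod a (Suc k) \<le> vprod a k"
  unfolding vprod_Suc by (rule mult_right_le_one_le) (auto simp: vprod_nonneg power_le_one)

lemma vprod_antimono:
  assumes "\<And>j. cmod (a j) \<le> 1" "k \<le> l"
  shows "vprod a l \<le> vprod a k"
  using assms(2) by (induction l rule: dec_induct) (auto intro: order_trans[OF vprod_Suc_le] assms(1))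

lemma vprod_le_1: "(\<And>j. cmod (a j) \<le> 1) \<Longrightarrow> vprod a k \<le> 1"
  using vprod_antimono[of a 0 k] by simp

lemma Y_entry_le_1: "\<alpha> \<in> Y \<Longrightarrow> cmod (ventry \<alpha> k) \<le> 1"
  unfolding Y_def by (cases "enat k < vlen \<alpha>") (auto split: if_splits intro: less_imp_le)

text \<open>Only the last entry of a finite sequence has modulus 1, and the padding zeros contribute
  factors 1. So the length can be read off from the first zero of the products, which is how
  \<open>Y_embed\<close> remembers it.\<close>

lemma Y_vprod_eq_0_iff:
  assumes "\<alpha> \<in> Y"
  shows "vprod (ventry \<alpha>) k = 0 \<longleftrightarrow> vlen \<alpha> \<le> enat k"
proof
  assume "vprod (ventry \<alpha>) k = 0"
  then obtain j where j: "j < k" "1 - (cmod (ventry \<alpha> j))\<^sup>2 = 0"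
    by (auto simp: vprod_def)
  then have u: "cmod (ventry \<alpha> j) = 1"
    using norm_ge_zero[of "ventry \<alpha> j"] by (simp add: power2_eq_1_iff)
  then have "ventry \<alpha> j \<noteq> 0" by auto
  then have "enat j < vlen \<alpha>" using assms unfolding Y_def by (metis (mono_tags, lifting) mem_Collect_eq not_less)
  then have "enat (Suc j) = vlen \<alpha>" using assms u by (auto simp: Y_def split: if_splits)
  then show "vlen \<alpha> \<le> enat k" using j(1) by (metis Suc_leI enat_ord_simps(1))
next
  assume le: "vlen \<alpha> \<le> enat k"
  then obtain m where m: "vlen \<alpha> = enat m" by (cases "vlen \<alpha>") auto
  have "1 \<le> vlen \<alpha>" using assms by (simp add: Y_def)
  then obtain j where j: "m = Suc j" using m by (cases m) (auto simp: one_enat_def)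
  have "enat j < vlen \<alpha>" "enat (Suc j) = vlen \<alpha>" using m j by auto
  then have "cmod (ventry \<alpha> j) = 1" using assms unfolding Y_def by auto
  moreover have "j < k" using le m j by simp
  ultimately show "vprod (ventry \<alpha>) k = 0" unfolding vprod_def
    by (intro prod_zero bexI[of _ j]) auto
qed

text \<open>Beyond the length of a finite limit, the topology of \<open>Y\<close> leaves the entries
  of the approximating sequences uncontrolled. Weighting the k-th entry with the product of the
  earlier factors repairs this, since that product tends to 0 there.\<close>

definition Y_embed :: "vseq \<Rightarrow> nat \<Rightarrow> real \<times> complex" where
  "Y_embed \<alpha> k = (vprod (ventry \<alpha>) k, of_real (vprod (ventry \<alpha>) k) * ventry \<alpha> k)"

text \<open>The conditions are closed because the quotient \<open>\<beta>\<^sub>k / p\<^sub>k\<close>, which recovers the entry, has been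
  cleared from the recursion \<open>p\<^sub>k\<^sub>+\<^sub>1 = p\<^sub>k (1 - |\<alpha>\<^sub>k|\<^sup>2)\<close>.\<close>

definition Y_image :: "(nat \<Rightarrow> real \<times> complex) set" where
  "Y_image = {g. fst (g 0) = 1 \<and>
     (\<forall>k. fst (g k) * fst (g (Suc k)) = (fst (g k))\<^sup>2 - (cmod (snd (g k)))\<^sup>2 \<and>
          0 \<le> fst (g (Suc k)) \<and> fst (g (Suc k)) \<le> fst (g k) \<and> cmod (snd (g k)) \<le> fst (g k))}"

lemma Y_embed_in_image:
  assumes "\<alpha> \<in> Y" shows "Y_embed \<alpha> \<in> Y_image"
proof -
  let ?p = "vprod (ventry \<alpha>)"
  note e = Y_entry_le_1[OF assms]
  have p: "0 \<le> ?p k" for k by (rule vprod_nonneg[OF e])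
  have n: "cmod (of_real (?p k) * ventry \<alpha> k) = ?p k * cmod (ventry \<alpha> k)" for k
    using p[of k] by (simp add: norm_mult)
  show ?thesis
    unfolding Y_image_def mem_Collect_eq Y_embed_def fst_conv snd_conv n
  proof (intro conjI allI)
    fix k
    show "?p k * ?p (Suc k) = (?p k)\<^sup>2 - (?p k * cmod (ventry \<alpha> k))\<^sup>2"
      unfolding vprod_Suc by (simp add: power2_eq_square algebra_simps)
    show "?p k * cmod (ventry \<alpha> k) \<le> ?p k" by (rule mult_left_le[OF e p])
  qed (simp_all add: p vprod_Suc_le[OF e])
qed

lemma Y_image_le_1: "g \<in> Y_image \<Longrightarrow> 0 \<le> fst (g k) \<and> fst (g k) \<le> 1"
proof (induction k)
  case (Suc k)
  then have "0 \<le> fst (g (Suc k))" "fst (g (Suc k)) \<le> fst (g k)" by (auto simp: Y_image_def)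
  with Suc show ?case by auto
qed (simp add: Y_image_def)

lemma Y_image_antimono: 
  assumes "g \<in> Y_image" "k \<le> l"
  shows "fst (g l) \<le> fst (g k)"
  using assms(2) 
proof (induction l rule: dec_induct)
  case (step m)
  have "fst (g (Suc m)) \<le> fst (g m)" using assms(1) by (simp add: Y_image_def)
  with step show ?case by simp
qed simp

text \<open>The inverse of the embedding: the length is the first index at which the first
  coordinate vanishes, and each entry is a quotient. Past the length the quotient is a division by
  zero, which yields exactly the padding 0 that \<open>Y\<close> demands.\<close>

lemma Y_image_subset:
  assumes g: "g \<in> Y_image" shows "g \<in> Y_embed ` Y"
proof -
  define N where "N = (if \<exists>k. fst (g k) = 0 then enat (LEAST k. fst (g k) = 0) else \<infinity>)"
  define a where "a k = snd (g k) / of_real (fst (g k))" for k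
  note mono = Y_image_antimono[OF g]
  have g0: "fst (g 0) = 1" using g by (simp add: Y_image_def)
  have gS: "fst (g k) * fst (g (Suc k)) = (fst (g k))\<^sup>2 - (cmod (snd (g k)))\<^sup>2"
    "0 \<le> fst (g (Suc k))" "fst (g (Suc k)) \<le> fst (g k)" "cmod (snd (g k)) \<le> fst (g k)" for k
    using g by (auto simp: Y_image_def)
  have ge0: "0 \<le> fst (g k)" for k using Y_image_le_1[OF g] by auto
  have N: "enat k < N \<longleftrightarrow> fst (g k) \<noteq> 0" for k
  proof (cases "\<exists>k. fst (g k) = 0")
    case True
    have z: "fst (g (LEAST k. fst (g k) = 0)) = 0" using True by (rule LeastI_ex)
    show ?thesis
    proof
      assume "enat k < N"
      then show "fst (g k) \<noteq> 0" using True not_less_Least by (auto simp: N_def)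
    next
      assume nz: "fst (g k) \<noteq> 0"
      show "enat k < N"
      proof (rule ccontr)
        assume "\<not> enat k < N"
        then have "(LEAST k. fst (g k) = 0) \<le> k" using True by (simp add: N_def)
        from mono[OF this] z nz ge0[of k] show False by auto
      qed
    qed
  qed (auto simp: N_def)
  \<comment> \<open>The cleared recursion of \<open>Y_image\<close> divided by its first factor. If
    that factor is 0, monotonicity and nonnegativity force both sides to be 0.\<close>
  have fac: "fst (g (Suc k)) = fst (g k) * (1 - (cmod (a k))\<^sup>2)" for k
  proof (cases "fst (g k) = 0")
    case True
    then show ?thesis using gS[of k] by auto
  next
    case False
    then have "fst (g (Suc k)) = ((fst (g k))\<^sup>2 - (cmod (snd (g k)))\<^sup>2) / fst (g k)"
      using gS(1)[of k] by (simp add: field_simps)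
    also have "\<dots> = fst (g k) * (1 - (cmod (a k))\<^sup>2)"
      using False ge0[of k] by (simp add: a_def norm_divide power_divide) (simp add: divide_simps power2_eq_square algebra_simps)
    finally show ?thesis .
  qed
  have vp: "vprod a k = fst (g k)" for k
    by (induction k) (simp_all add: g0 vprod_Suc fac)
  have a1: "cmod (a k) \<le> 1" for k
    using gS(4)[of k] ge0[of k] by (auto simp: a_def norm_divide divide_le_eq_1)
  have "(N, a) \<in> Y"
    unfolding Y_def
  proof (clarsimp, intro conjI allI impI)
    show "1 \<le> N" using N[of 0] g0 by (simp add: one_enat_def Suc_ile_eq)
    fix k
    show "cmod (a k) < 1" if "enat k < N" "enat (Suc k) \<noteq> N"
    proof -
      have "enat (Suc k) < N" using that by (metis Suc_ile_eq antisym_conv2)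
      then have "fst (g (Suc k)) \<noteq> 0" using N by simp
      then have "cmod (a k) \<noteq> 1" using fac[of k] by auto
      then show ?thesis using a1[of k] by simp
    qed
    show "cmod (a k) = 1" if "enat k < N" "enat (Suc k) = N"
    proof -
      have "fst (g (Suc k)) = 0" "fst (g k) \<noteq> 0" using that N[of "Suc k"] N[of k] by auto
      then have "(cmod (a k))\<^sup>2 = 1" using fac[of k] by simp
      then show ?thesis using norm_ge_zero[of "a k"] by (simp add: power2_eq_1_iff)
    qed
    show "a k = 0" if "N \<le> enat k"
      using that N[of k] by (simp add: a_def not_less[symmetric])
  qed
  moreover have "Y_embed (N, a) = g"
  proof
    fix k
    have "fst (g k) = 0 \<Longrightarrow> snd (g k) = 0" using gS(4)[of k] by simp
    then show "Y_embed (N, a) k = g k"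
      by (auto simp: Y_embed_def vp a_def prod_eq_iff)
  qed
  ultimately show ?thesis by (metis imageI)
qed

lemma Y_embed_image: "Y_embed ` Y = Y_image"
  using Y_embed_in_image Y_image_subset by blast

lemma vprod_tendsto:
  "(\<And>j. j < k \<Longrightarrow> (\<lambda>i. f i j) \<longlonglongrightarrow> a j) \<Longrightarrow> (\<lambda>i. vprod (f i) k) \<longlonglongrightarrow> vprod a k"
  unfolding vprod_def by (intro tendsto_intros) auto

lemma Y_conv_iff_embed:
  assumes f: "range f \<subseteq> Y" and \<alpha>: "\<alpha> \<in> Y"
  shows "Y_conv f \<alpha> \<longleftrightarrow> (\<forall>k. (\<lambda>j. Y_embed (f j) k) \<longlonglongrightarrow> Y_embed \<alpha> k)"
proof (intro iffI allI)
  fix k assume conv: "Y_conv f \<alpha>"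
  have fY: "f j \<in> Y" for j using f by blast
  show "(\<lambda>j. Y_embed (f j) k) \<longlonglongrightarrow> Y_embed \<alpha> k"
  proof (cases "enat k < vlen \<alpha>")
    case True
    have "(\<lambda>j. ventry (f j) i) \<longlonglongrightarrow> ventry \<alpha> i" if "i \<le> k" for i
      using Y_conv_entryD(2)[OF conv, of i] that True by (meson enat_ord_simps(1) le_less_trans)
    then show ?thesis
      unfolding Y_embed_def by (intro tendsto_intros vprod_tendsto) auto
  next
    case False
    \<comment> \<open>The k-th entry of the limit does not exist. The product up to the length m of
      the limit already tends to 0 and dominates both coordinates at k.\<close>
    then obtain m where m: "vlen \<alpha> = enat m" "m \<le> k" by (cases "vlen \<alpha>") auto
    have "(\<lambda>j. vprod (ventry (f j)) m) \<longlonglongrightarrow> vprod (ventry \<alpha>) m"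
      by (intro vprod_tendsto Y_conv_entryD(2)[OF conv]) (simp add: m)
    also have "vprod (ventry \<alpha>) m = 0" using Y_vprod_eq_0_iff[OF \<alpha>] m by simp
    finally have lim: "(\<lambda>j. vprod (ventry (f j)) m) \<longlonglongrightarrow> 0" .
    have le: "vprod (ventry (f j)) k \<le> vprod (ventry (f j)) m" "0 \<le> vprod (ventry (f j)) k" for j
      using vprod_antimono[OF Y_entry_le_1[OF fY] m(2)] vprod_nonneg[OF Y_entry_le_1[OF fY]] by auto
    have "(\<lambda>j. vprod (ventry (f j)) k) \<longlonglongrightarrow> 0"
      using le by (intro tendsto_sandwich[OF _ _ tendsto_const lim]) auto
    moreover have "(\<lambda>j. of_real (vprod (ventry (f j)) k) * ventry (f j) k) \<longlonglongrightarrow> 0"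
    proof (rule Lim_null_comparison[OF _ lim], rule always_eventually, rule allI)
      fix j
      have "cmod (of_real (vprod (ventry (f j)) k) * ventry (f j) k) \<le> vprod (ventry (f j)) k"
        using le(2)[of j] Y_entry_le_1[OF fY, of j k] by (simp add: norm_mult mult_left_le)
      then show "cmod (of_real (vprod (ventry (f j)) k) * ventry (f j) k) \<le> vprod (ventry (f j)) m"
        using le(1)[of j] by simp
    qed
    moreover have "vprod (ventry \<alpha>) k = 0" using Y_vprod_eq_0_iff[OF \<alpha>] m by simp
    ultimately show ?thesis unfolding Y_embed_def by (auto intro: tendsto_Pair)
  qed
next
  assume lim: "\<forall>k. (\<lambda>j. Y_embed (f j) k) \<longlonglongrightarrow> Y_embed \<alpha> k"
  have fY: "f j \<in> Y" for j using f by blast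
  have p: "(\<lambda>j. vprod (ventry (f j)) k) \<longlonglongrightarrow> vprod (ventry \<alpha>) k" for k
    using tendsto_fst[OF lim[rule_format, of k]] by (simp add: Y_embed_def)
  have b: "(\<lambda>j. of_real (vprod (ventry (f j)) k) * ventry (f j) k)
     \<longlonglongrightarrow> of_real (vprod (ventry \<alpha>) k) * ventry \<alpha> k" for k
    using tendsto_snd[OF lim[rule_format, of k]] by (simp add: Y_embed_def)
  have ev: "\<forall>\<^sub>F j in sequentially. enat k < vlen (f j)"
    and ent: "(\<lambda>j. ventry (f j) k) \<longlonglongrightarrow> ventry \<alpha> k" if k: "enat k < vlen \<alpha>" for k
  proof -
    \<comment> \<open>A nonzero limit of the products forces the k-th entries to exist eventually
      and allows the weight to be divided out.\<close>
    have nz: "vprod (ventry \<alpha>) k \<noteq> 0" using Y_vprod_eq_0_iff[OF \<alpha>] k by simp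
    have evn: "\<forall>\<^sub>F j in sequentially. vprod (ventry (f j)) k \<noteq> 0"
      using tendsto_imp_eventually_ne[OF p nz] .
    then show "\<forall>\<^sub>F j in sequentially. enat k < vlen (f j)"
      by eventually_elim (simp add: Y_vprod_eq_0_iff[OF fY])
    have "(\<lambda>j. of_real (vprod (ventry (f j)) k) * ventry (f j) k / of_real (vprod (ventry (f j)) k))
       \<longlonglongrightarrow> of_real (vprod (ventry \<alpha>) k) * ventry \<alpha> k / of_real (vprod (ventry \<alpha>) k)"
      using nz by (intro tendsto_divide b tendsto_of_real p) auto
    then have "(\<lambda>j. of_real (vprod (ventry (f j)) k) * ventry (f j) k / of_real (vprod (ventry (f j)) k))
       \<longlonglongrightarrow> ventry \<alpha> k" using nz by simp
    then show "(\<lambda>j. ventry (f j) k) \<longlonglongrightarrow> ventry \<alpha> k"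
      by (rule Lim_transform_eventually) (use evn in eventually_elim, simp)
  qed
  show "Y_conv f \<alpha>"
  proof (cases "vlen \<alpha> = \<infinity>")
    case True
    have "(\<lambda>j. vlen (f j)) \<longlonglongrightarrow> \<infinity>"
    proof (rule order_tendstoI)
      fix a :: enat assume "a < \<infinity>"
      then obtain k where "a = enat k" by (cases a) auto
      then show "\<forall>\<^sub>F j in sequentially. a < vlen (f j)" using ev[of k] True by simp
    qed auto
    then show ?thesis using True ent by (simp add: Y_conv_def)
  next
    case False
    then show ?thesis using ev ent by (auto simp: Y_conv_def)
  qed
qed

lemma inj_on_Y_embed: "inj_on Y_embed Y"
proof (rule inj_onI)
  fix \<alpha> \<beta> assume \<alpha>: "\<alpha> \<in> Y" and \<beta>: "\<beta> \<in> Y" and eq: "Y_embed \<alpha> = Y_embed \<beta>"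
  have p: "vprod (ventry \<alpha>) k = vprod (ventry \<beta>) k" for k
    using fun_cong[OF eq, of k] by (simp add: Y_embed_def)
  have "enat k < vlen \<alpha> \<longleftrightarrow> enat k < vlen \<beta>" for k
    using Y_vprod_eq_0_iff[OF \<alpha>, of k] Y_vprod_eq_0_iff[OF \<beta>, of k] p[of k] by (auto simp: not_le[symmetric])
  moreover have "x \<le> y" if "\<And>k. enat k < x \<Longrightarrow> enat k < y" for x y :: enat
  proof (rule ccontr)
    assume "\<not> x \<le> y"
    then have "y < x" by simp
    moreover from this obtain m where "y = enat m" by (cases y) auto
    ultimately show False using that[of m] by simp
  qed
  ultimately have len: "vlen \<alpha> = vlen \<beta>" by (intro antisym) auto
  have "ventry \<alpha> k = ventry \<beta> k" for k
  proof (cases "enat k < vlen \<alpha>")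
    case True
    then have "vprod (ventry \<alpha>) k \<noteq> 0" using Y_vprod_eq_0_iff[OF \<alpha>, of k] by simp
    then show ?thesis using fun_cong[OF eq, of k] p by (simp add: Y_embed_def)
  next
    case False
    then show ?thesis using \<alpha> \<beta> len by (auto simp: Y_def)
  qed
  then show "\<alpha> = \<beta>" using len by (auto simp: prod_eq_iff)
qed

lemma closed_Y_image: "closed Y_image"
  unfolding Y_image_def
  by (intro closed_Collect_conj closed_Collect_all closed_Collect_eq closed_Collect_le continuous_intros)
    (auto intro!: continuous_intros continuous_on_product_coordinates)

lemma compact_Y_image: "compact Y_image"
proof -
  let ?B = "{0..1} \<times> cball (0::complex) 1 :: (real \<times> complex) set"
  have "compactin (product_topology (\<lambda>_::nat. euclidean) UNIV) (PiE UNIV (\<lambda>_::nat. ?B))"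
    unfolding compactin_PiE by (auto intro!: compact_Times)
  then have c: "compact (PiE UNIV (\<lambda>_::nat. ?B))"
    unfolding euclidean_product_topology by simp
  have "Y_image \<subseteq> PiE UNIV (\<lambda>_::nat. ?B)"
  proof
    fix g assume g: "g \<in> Y_image"
    have "cmod (snd (g k)) \<le> fst (g k)" for k using g by (simp add: Y_image_def)
    then have "g k \<in> ?B" for k
      using Y_image_le_1[OF g, of k] order_trans[of "cmod (snd (g k))" "fst (g k)" 1]
      by (simp add: mem_Times_iff)
    then show "g \<in> PiE UNIV (\<lambda>_::nat. ?B)" by auto
  qed
  then show ?thesis using compact_Int_closed[OF c closed_Y_image] by (simp add: inf.absorb2)
qed

section \<open>The topology of \<open>Y\<close> as the topology of a compact subset of a countable
  product\<close>

lemma tendsto_fun_iff: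
  fixes f :: "nat \<Rightarrow> nat \<Rightarrow> real \<times> complex"
  shows "f \<longlonglongrightarrow> g \<longleftrightarrow> (\<forall>k. (\<lambda>j. f j k) \<longlonglongrightarrow> g k)"
  using limitin_componentwise[of "\<lambda>_. euclidean" UNIV f g sequentially]
  by (simp add: euclidean_product_topology)

text \<open>The topology defined through sequences is the one induced by \<open>Y_embed\<close>. In
  the first countable product, closedness of the image of the complement of W can be tested on
  sequences, and such sequences lift back to \<open>Y\<close> because the whole image is
  closed.\<close>

lemma openin_Y_top_iff:
  "openin Y_top W \<longleftrightarrow> (\<exists>T. open T \<and> W = Y \<inter> Y_embed -` T)"
proof
  assume W: "openin Y_top W"
  then have WY: "W \<subseteq> Y" by (simp add: openin_Y_top)
  have "closed (Y_image - Y_embed ` W)"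
    unfolding closed_sequential_limits
  proof (intro allI impI, elim conjE)
    fix h g assume h: "\<forall>n. h n \<in> Y_image - Y_embed ` W" and lim: "h \<longlonglongrightarrow> g"
    have "g \<in> Y_image" using closed_sequentially[OF closed_Y_image _ lim] h by blast
    then obtain \<alpha> where \<alpha>: "\<alpha> \<in> Y" "g = Y_embed \<alpha>" using Y_embed_image by blast
    have "\<forall>n. \<exists>\<beta>. \<beta> \<in> Y \<and> \<beta> \<notin> W \<and> h n = Y_embed \<beta>" using h Y_embed_image by blast
    then obtain f where f: "\<And>n. f n \<in> Y" "\<And>n. f n \<notin> W" "\<And>n. h n = Y_embed (f n)" by metis
    have hf: "h = (\<lambda>n. Y_embed (f n))" using f(3) by auto
    have rf: "range f \<subseteq> Y" using f(1) by auto
    have conv: "Y_conv f \<alpha>"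
      using lim unfolding Y_conv_iff_embed[OF rf \<alpha>(1)] hf \<alpha>(2) tendsto_fun_iff by simp
    have "g \<notin> Y_embed ` W"
    proof
      assume "g \<in> Y_embed ` W"
      then have "\<alpha> \<in> W" using \<alpha> WY inj_on_Y_embed by (auto dest: inj_onD)
      then have "\<forall>\<^sub>F j in sequentially. f j \<in> W" using W rf conv unfolding openin_Y_top by blast
      then show False using f(2) by simp
    qed
    then show "g \<in> Y_image - Y_embed ` W" using \<open>g \<in> Y_image\<close> by simp
  qed
  then have "open (- (Y_image - Y_embed ` W))" by (rule open_Compl)
  moreover have "W = Y \<inter> Y_embed -` (- (Y_image - Y_embed ` W))"
    using WY inj_on_Y_embed Y_embed_image by (auto dest: inj_onD)
  ultimately show "\<exists>T. open T \<and> W = Y \<inter> Y_embed -` T" by blast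
next
  assume "\<exists>T. open T \<and> W = Y \<inter> Y_embed -` T"
  then obtain T where T: "open T" "W = Y \<inter> Y_embed -` T" by blast
  show "openin Y_top W"
    unfolding openin_Y_top
  proof (intro conjI allI impI)
    fix f \<alpha> assume a: "range f \<subseteq> Y \<and> \<alpha> \<in> W \<and> Y_conv f \<alpha>"
    then have "(\<lambda>j. Y_embed (f j)) \<longlonglongrightarrow> Y_embed \<alpha>"
      using Y_conv_iff_embed[of f \<alpha>] T(2) by (simp add: tendsto_fun_iff)
    then have "\<forall>\<^sub>F j in sequentially. Y_embed (f j) \<in> T"
      using T a by (auto dest: topological_tendstoD)
    then show "\<forall>\<^sub>F j in sequentially. f j \<in> W"
      by eventually_elim (use a T in auto)
  qed (use T in simp)
qed

lemma homeomorphic_map_Y_embed: "homeomorphic_map Y_top (top_of_set Y_image) Y_embed"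
  unfolding homeomorphic_map_def quotient_map_def
proof (intro conjI allI impI)
  show "Y_embed ` topspace Y_top = topspace (top_of_set Y_image)"
    by (simp add: topspace_Y_top Y_embed_image)
  show "inj_on Y_embed (topspace Y_top)" by (simp add: topspace_Y_top inj_on_Y_embed)
  fix U assume "U \<subseteq> topspace (top_of_set Y_image)"
  then have U: "U \<subseteq> Y_image" by simp
  have "(Y \<inter> Y_embed -` U = Y \<inter> Y_embed -` T) \<longleftrightarrow> (U = Y_image \<inter> T)" for T
  proof -
    have "(Y \<inter> Y_embed -` U = Y \<inter> Y_embed -` T) \<longleftrightarrow> (\<forall>g\<in>Y_embed ` Y. g \<in> U \<longleftrightarrow> g \<in> T)"
      unfolding set_eq_iff Int_iff vimage_eq by blast
    also have "\<dots> \<longleftrightarrow> U = Y_image \<inter> T"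
      using U unfolding Y_embed_image by blast
    finally show ?thesis .
  qed
  then show "openin Y_top {x \<in> topspace Y_top. Y_embed x \<in> U} = openin (top_of_set Y_image) U"
    unfolding openin_Y_top_iff openin_open topspace_Y_top
    by (simp add: vimage_def Int_def)
qed

lemma homeomorphic_Y_top: "Y_top homeomorphic_space top_of_set Y_image"
  using homeomorphic_map_Y_embed homeomorphic_map_imp_homeomorphic_space by blast

lemma compact_space_Y_top: "compact_space Y_top"
  using homeomorphic_compact_space[OF homeomorphic_Y_top] compact_Y_image
  by (simp add: compact_space_subtopology compactin_euclidean_iff)

lemma completely_metrizable_Y_top: "completely_metrizable_space Y_top"
  using homeomorphic_completely_metrizable_space[OF homeomorphic_Y_top]
    completely_metrizable_space_closedin[OF completely_metrizable_space_euclidean, of Y_image] closed_Y_image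
  by simp

lemma second_countable_Y_top: "second_countable Y_top"
proof -
  have "second_countable (euclidean :: (nat \<Rightarrow> real \<times> complex) topology)"
  proof -
    obtain B :: "(nat \<Rightarrow> real \<times> complex) set set" where B: "countable B" "topological_basis B"
      using ex_countable_basis by blast
    show ?thesis unfolding second_countable_def
    proof (intro exI[of _ B] conjI ballI allI impI)
      show "countable B" by fact
      show "openin euclidean V" if "V \<in> B" for V using B(2) that by (simp add: topological_basis_open)
      show "\<exists>V\<in>B. x \<in> V \<and> V \<subseteq> U" if "openin euclidean U \<and> x \<in> U" for U x
        using topological_basisE[OF B(2), of U x] that by (metis open_openin)
    qed
  qed
  then have "second_countable (top_of_set Y_image)" by (rule second_countable_subtopology)
  then show ?thesis using homeomorphic_space_second_countability[OF homeomorphic_Y_top] by simp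
qed

section \<open>A criterion for the large deviation principle\<close>

lemma log_ereal_1 [simp]: "log_ereal 1 = 0"
  by (simp add: log_ereal_def zero_ereal_def)

lemma log_ereal_mult: "0 \<le> p \<Longrightarrow> 0 \<le> q \<Longrightarrow> log_ereal (p * q) = log_ereal p + log_ereal q"
  by (auto simp: log_ereal_def ln_mult)

lemma log_ereal_mono: "0 \<le> p \<Longrightarrow> p \<le> q \<Longrightarrow> log_ereal p \<le> log_ereal q"
  by (auto simp: log_ereal_def)

lemma log_ereal_nonpos: "0 \<le> p \<Longrightarrow> p \<le> 1 \<Longrightarrow> log_ereal p \<le> 0"
  using log_ereal_mono[of p 1] by simp

text \<open>Indices past the length would contribute minus log 1, which is 0, so the case
  distinction in the rate disappears. The remaining nonnegative series is the supremum of its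
  partial sums.\<close>

lemma verblunsky_rate_eq_SUP:
  assumes "\<alpha> \<in> Y"
  shows "verblunsky_rate \<alpha> = (SUP k. - log_ereal (vprod (ventry \<alpha>) k))"
proof -
  note e = Y_entry_le_1[OF assms]
  let ?f = "\<lambda>j. if enat j < vlen \<alpha> then - log_ereal (1 - (cmod (ventry \<alpha> j))\<^sup>2) else 0"
  have q: "0 \<le> 1 - (cmod (ventry \<alpha> j))\<^sup>2" "1 - (cmod (ventry \<alpha> j))\<^sup>2 \<le> 1" for j
    using e[of j] by (auto simp: power_le_one)
  have f: "?f j = - log_ereal (1 - (cmod (ventry \<alpha> j))\<^sup>2)" for j
    using assms by (auto simp: Y_def)
  have f0: "0 \<le> ?f j" for j
    unfolding f using log_ereal_nonpos[OF q] by simp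
  have "(\<Sum>j<k. ?f j) = - log_ereal (vprod (ventry \<alpha>) k)" for k
  proof (induction k)
    case (Suc k)
    have "(\<Sum>j<Suc k. ?f j) = - log_ereal (vprod (ventry \<alpha>) k) + - log_ereal (1 - (cmod (ventry \<alpha> k))\<^sup>2)"
      using Suc f[of k] by simp
    also have "\<dots> = - (log_ereal (vprod (ventry \<alpha>) k) + log_ereal (1 - (cmod (ventry \<alpha> k))\<^sup>2))"
      by (auto simp: log_ereal_def)
    also have "\<dots> = - log_ereal (vprod (ventry \<alpha>) (Suc k))"
      unfolding vprod_Suc using vprod_nonneg[OF e] q by (subst log_ereal_mult) auto
    finally show ?case .
  qed simp
  then show ?thesis
    unfolding verblunsky_rate_def using f0 by (subst suminf_ereal_eq_SUP) auto
qed

lemma openin_vprod_less: "openin Y_top {\<alpha> \<in> Y. vprod (ventry \<alpha>) k < t}"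
proof -
  have "open {g :: nat \<Rightarrow> real \<times> complex. fst (g k) < t}"
    by (intro open_Collect_less continuous_intros continuous_on_product_coordinates)
  moreover have "{\<alpha> \<in> Y. vprod (ventry \<alpha>) k < t} = Y \<inter> Y_embed -` {g. fst (g k) < t}"
    by (auto simp: Y_embed_def)
  ultimately show ?thesis unfolding openin_Y_top_iff by blast
qed

lemma less_verblunsky_rate_iff:
  assumes "\<alpha> \<in> Y"
  shows "ereal c < verblunsky_rate \<alpha> \<longleftrightarrow> (\<exists>k. vprod (ventry \<alpha>) k < exp (- c))"
proof -
  have "ereal c < - log_ereal (vprod (ventry \<alpha>) k) \<longleftrightarrow> vprod (ventry \<alpha>) k < exp (- c)" for k
  proof -
    have v: "0 \<le> vprod (ventry \<alpha>) k" using vprod_nonneg[OF Y_entry_le_1[OF assms]] .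
    show ?thesis
    proof (cases "vprod (ventry \<alpha>) k = 0")
      case False
      then have "0 < vprod (ventry \<alpha>) k" using v by simp
      then show ?thesis using ln_less_cancel_iff[of "vprod (ventry \<alpha>) k" "exp (- c)"]
        by (auto simp: log_ereal_def)
    qed (simp add: log_ereal_def)
  qed
  then show ?thesis unfolding verblunsky_rate_eq_SUP[OF assms] less_SUP_iff by simp
qed

lemma verblunsky_rate_nonneg: "\<alpha> \<in> Y \<Longrightarrow> 0 \<le> verblunsky_rate \<alpha>"
  unfolding verblunsky_rate_eq_SUP by (rule SUP_upper2[of 0]) auto

lemma openin_less_verblunsky_rate: "openin Y_top {\<alpha> \<in> Y. ereal c < verblunsky_rate \<alpha>}"
proof -
  have "{\<alpha> \<in> Y. ereal c < verblunsky_rate \<alpha>} = (\<Union>k. {\<alpha> \<in> Y. vprod (ventry \<alpha>) k < exp (- c)})"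
    using less_verblunsky_rate_iff by auto
  then show ?thesis using openin_vprod_less by auto
qed

lemma lsc_verblunsky_rate: "lsc_on_topology Y_top verblunsky_rate"
  unfolding lsc_on_topology_def topspace_Y_top
proof
  fix c :: ereal
  show "openin Y_top {x \<in> Y. c < verblunsky_rate x}"
  proof (cases c)
    case (real r)
    then show ?thesis using openin_less_verblunsky_rate by simp
  next
    case PInf
    then show ?thesis by simp
  next
    case MInf
    then have "{x \<in> Y. c < verblunsky_rate x} = topspace Y_top"
      using verblunsky_rate_nonneg less_le_trans[of "-\<infinity>" "0::ereal"] by (auto simp: topspace_Y_top)
    then show ?thesis by (metis openin_topspace)
  qed
qed

lemma good_verblunsky_rate: "good_rate_function Y_top verblunsky_rate"
  unfolding good_rate_function_def topspace_Y_top
proof (intro allI impI)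
  fix c :: real
  have "{x \<in> Y. verblunsky_rate x \<le> ereal c} = Y - {\<alpha> \<in> Y. ereal c < verblunsky_rate \<alpha>}"
    by auto
  then have "closedin Y_top {x \<in> Y. verblunsky_rate x \<le> ereal c}"
    using openin_less_verblunsky_rate[of c]
    by (metis closedin_diff closedin_topspace topspace_Y_top)
  then show "compactin Y_top {x \<in> Y. verblunsky_rate x \<le> ereal c}"
    using closedin_compact_space compact_space_Y_top by blast
qed

lemma openin_borel_of: "openin X W \<Longrightarrow> W \<in> sets (borel_of X)"
  unfolding borel_of_def by (subst sets_measure_of) (auto dest: openin_subset)

text \<open>The open sets increase with k because the products decrease, so a finite subcover of the
  compact set K collapses to its member of largest index.\<close>

lemma closedin_Y_exponent:
  assumes K: "closedin Y_top K" and c: "ereal c < (INF x\<in>K. verblunsky_rate x)"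
  shows "\<exists>k. K \<subseteq> {\<alpha> \<in> Y. vprod (ventry \<alpha>) k < exp (- c)}"
proof -
  let ?A = "\<lambda>k. {\<alpha> \<in> Y. vprod (ventry \<alpha>) k < exp (- c)}"
  have KY: "K \<subseteq> Y" using closedin_subset[OF K] by (simp add: topspace_Y_top)
  have "compactin Y_top K" using K closedin_compact_space compact_space_Y_top by blast
  moreover have "K \<subseteq> \<Union> (range ?A)"
  proof
    fix x assume x: "x \<in> K"
    then have "ereal c < verblunsky_rate x" using c by (meson INF_lower less_le_trans)
    then show "x \<in> \<Union> (range ?A)" using less_verblunsky_rate_iff[of x c] KY x by auto
  qed
  moreover have "\<And>U. U \<in> range ?A \<Longrightarrow> openin Y_top U" using openin_vprod_less by auto
  ultimately have "\<exists>\<F>. finite \<F> \<and> \<F> \<subseteq> range ?A \<and> K \<subseteq> \<Union>\<F>"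
    by (intro compactinD) auto
  then obtain \<F> where F: "finite \<F>" "\<F> \<subseteq> range ?A" "K \<subseteq> \<Union>\<F>" by blast
  then obtain S where S: "finite S" "\<F> = ?A ` S" using finite_subset_image[of \<F> ?A UNIV] by blast
  define m where "m = Max (insert 0 S)"
  have "?A k \<subseteq> ?A m" if "k \<in> S" for k
  proof
    fix \<alpha> assume "\<alpha> \<in> ?A k"
    moreover have "k \<le> m" using that S(1) unfolding m_def by simp
    ultimately show "\<alpha> \<in> ?A m"
      using vprod_antimono[of "ventry \<alpha>" k m] Y_entry_le_1[of \<alpha>] by (auto intro: le_less_trans)
  qed
  then have "K \<subseteq> ?A m" using F(3) S(2) by blast
  then show ?thesis by blast
qed

text \<open>If no box fitted into W, boxes of k coordinates and radius 1/(k+1) would supply points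
  outside W converging to x. The bound \<open>cmod < 1\<close> belongs to the box because it forces
  the lengths of these points to tend to infinity.\<close>

lemma openin_Y_box:
  assumes W: "openin Y_top W" and x: "x \<in> W" and len: "vlen x = \<infinity>"
  shows "\<exists>k \<epsilon>. 0 < \<epsilon> \<and> {\<alpha> \<in> Y. \<forall>j<k. cmod (ventry \<alpha> j) < 1 \<and> dist (ventry \<alpha> j) (ventry x j) < \<epsilon>} \<subseteq> W"
proof (rule ccontr)
  assume no: "\<not> ?thesis"
  have "\<exists>\<alpha>\<in>Y. (\<forall>j<k. cmod (ventry \<alpha> j) < 1 \<and> dist (ventry \<alpha> j) (ventry x j) < inverse (real (Suc k))) \<and> \<alpha> \<notin> W" for k
    using no[unfolded not_ex, rule_format, of "inverse (real (Suc k))" k] by auto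
  then obtain f where f: "\<And>k. f k \<in> Y" "\<And>k. f k \<notin> W"
    "\<And>k j. j < k \<Longrightarrow> cmod (ventry (f k) j) < 1"
    "\<And>k j. j < k \<Longrightarrow> dist (ventry (f k) j) (ventry x j) < inverse (real (Suc k))"
    by metis
  have ent: "(\<lambda>k. ventry (f k) j) \<longlonglongrightarrow> ventry x j" for j
  proof (rule Lim_transform_bound[of "\<lambda>k. ventry (f k) j - ventry x j" "\<lambda>k. inverse (real (Suc k))", THEN LIM_zero_cancel])
    show "\<forall>\<^sub>F k in sequentially. norm (ventry (f k) j - ventry x j) \<le> norm (inverse (real (Suc k)))"
      using eventually_gt_at_top[of j] by eventually_elim (use f(4) in \<open>force simp: dist_norm\<close>)
    show "(\<lambda>k. inverse (real (Suc k))) \<longlonglongrightarrow> 0" by (rule LIMSEQ_inverse_real_of_nat)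
  qed
  have lt: "enat j < vlen (f k)" if "j < k" for j k
  proof (rule ccontr)
    assume "\<not> enat j < vlen (f k)"
    then have "vlen (f k) \<le> enat k" using that by (meson enat_ord_simps(1) less_imp_le not_less order_trans)
    then have "vprod (ventry (f k)) k = 0" using Y_vprod_eq_0_iff[OF f(1)] by simp
    then obtain i where "i < k" "(cmod (ventry (f k) i))\<^sup>2 = 1" by (auto simp: vprod_def)
    then show False using f(3)[of i k] norm_ge_zero[of "ventry (f k) i"] by (auto simp: power2_eq_1_iff)
  qed
  have "(\<lambda>k. vlen (f k)) \<longlonglongrightarrow> \<infinity>"
  proof (rule order_tendstoI)
    fix a :: enat assume "a < \<infinity>"
    then obtain m where m: "a = enat m" by (cases a) auto
    show "\<forall>\<^sub>F k in sequentially. a < vlen (f k)"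
      using eventually_gt_at_top[of m] by (rule eventually_mono) (simp add: lt m)
  qed auto
  then have "Y_conv f x" using len ent by (simp add: Y_conv_def)
  moreover have "range f \<subseteq> Y" using f(1) by auto
  ultimately have "\<forall>\<^sub>F j in sequentially. f j \<in> W" using W x unfolding openin_Y_top by blast
  then show False using f(2) by simp
qed

text \<open>On the scale (1/n) log, the factor n^k, the shift of the exponent by k + 1 and the
  constant C all disappear, so exponential bounds for finitely many coefficients are enough. Taking
  both bounds as assumptions separates the topology of \<open>Y\<close> from the random
  matrices.\<close>

lemma verblunsky_LDP_criterion:
  assumes prob: "\<And>n. 1 \<le> n \<Longrightarrow> prob_space (P n)"
    and sets: "\<And>n. 1 \<le> n \<Longrightarrow> sets (P n) = sets (borel_of Y_top)"
    and upper: "\<And>n k \<delta>. k < n \<Longrightarrow> 0 < \<delta> \<Longrightarrow> \<delta> \<le> 1 \<Longrightarrow>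
      measure (P n) {\<alpha> \<in> Y. vprod (ventry \<alpha>) k < \<delta>} \<le> real n ^ k * \<delta> ^ (n - Suc k)"
    and lower: "\<And>z k \<epsilon>. (\<And>j. cmod (z j) < 1) \<Longrightarrow> 0 < \<epsilon> \<Longrightarrow>
      \<exists>C>0. \<forall>\<^sub>F n in sequentially. C * vprod z k ^ n \<le>
        measure (P n) {\<alpha> \<in> Y. \<forall>j<k. cmod (ventry \<alpha> j) < 1 \<and> dist (ventry \<alpha> j) (z j) < \<epsilon>}"
  shows "LDP Y_top P verblunsky_rate (\<lambda>n. real n)"
proof -
  have le0: "ereal (1 / real n) * log_ereal (measure (P n) A) \<le> 0" if "1 \<le> n" for n A
  proof -
    have "measure (P n) A \<le> 1" using prob_space.prob_le_1[OF prob[OF that]] .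
    then have "0 \<le> - log_ereal (measure (P n) A)" using log_ereal_nonpos[of "measure (P n) A"] by simp
    then have "0 \<le> ereal (1 / real n) * - log_ereal (measure (P n) A)"
      by (intro ereal_0_le_mult) auto
    then show ?thesis by simp
  qed
  have up: "limsup (\<lambda>n. ereal (1 / real n) * log_ereal (measure (P n) K)) \<le> - (INF x\<in>K. verblunsky_rate x)"
    (is "?L \<le> _") if K: "closedin Y_top K" for K
  proof (rule ccontr)
    assume "\<not> ?thesis"
    then have "- ?L < (INF x\<in>K. verblunsky_rate x)" by (simp add: ereal_uminus_less_reorder not_le)
    \<comment> \<open>A level strictly between the two sides turns a failure of the upper bound into
      an estimate by a single set of small products.\<close>
    then obtain c where c: "- ?L < ereal c" "ereal c < (INF x\<in>K. verblunsky_rate x)"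
      using ereal_dense2 by blast
    have "?L \<le> 0"
      using le0 by (intro Limsup_bounded eventually_sequentiallyI[of 1]) auto
    then have "0 \<le> - ?L" by simp
    then have c0: "0 < c" using c(1) by (metis ereal_less(2) le_less_trans)
    obtain k where k: "K \<subseteq> {\<alpha> \<in> Y. vprod (ventry \<alpha>) k < exp (- c)}"
      using closedin_Y_exponent[OF K c(2)] by blast
    \<comment> \<open>The logarithm of the bound n^k e^(-c(n-k-1)), divided by n; it tends to
      -c.\<close>
    let ?b = "\<lambda>n. (real k * ln (real n) + real (n - Suc k) * (- c)) / real n"
    have "ereal (1 / real n) * log_ereal (measure (P n) K) \<le> ereal (?b n)" if n: "k < n" for n
    proof -
      have n1: "1 \<le> n" using n by simp
      interpret prob_space "P n" using prob[OF n1] .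
      have "measure (P n) K \<le> measure (P n) {\<alpha> \<in> Y. vprod (ventry \<alpha>) k < exp (- c)}"
        by (intro finite_measure_mono k) (simp add: sets[OF n1] openin_borel_of openin_vprod_less)
      also have "\<dots> \<le> real n ^ k * exp (- c) ^ (n - Suc k)"
        using c0 by (intro upper n) auto
      finally have "log_ereal (measure (P n) K) \<le> log_ereal (real n ^ k * exp (- c) ^ (n - Suc k))"
        by (intro log_ereal_mono) auto
      also have "\<dots> = ereal (real k * ln (real n) + real (n - Suc k) * (- c))"
        using n1 by (simp add: log_ereal_def ln_mult ln_realpow)
      finally have "ereal (1 / real n) * log_ereal (measure (P n) K) \<le> 
         ereal (1 / real n) * ereal (real k * ln (real n) + real (n - Suc k) * (- c))"
        by (intro ereal_mult_left_mono) auto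
      then show ?thesis by simp
    qed
    then have "?L \<le> limsup (\<lambda>n. ereal (?b n))"
      by (intro Limsup_mono eventually_sequentiallyI[of "Suc k"]) auto
    also have "(\<lambda>n. ereal (?b n)) \<longlonglongrightarrow> ereal (- c)"
    proof (rule tendsto_ereal, rule Lim_transform_eventually)
      show "(\<lambda>n. real k * (ln (real n) / real n) + (- c) + c * real (Suc k) / real n) \<longlonglongrightarrow> - c"
        by real_asymp
      show "\<forall>\<^sub>F n in sequentially. real k * (ln (real n) / real n) + (- c) + c * real (Suc k) / real n = ?b n"
        using eventually_gt_at_top[of k]
        by eventually_elim (simp add: of_nat_diff field_simps)
    qed
    then have "limsup (\<lambda>n. ereal (?b n)) = ereal (- c)" by (rule lim_imp_Limsup[OF sequentially_bot])
    finally have "- ereal (- c) \<le> - ?L" unfolding ereal_minus_le_minus .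
    then have "ereal c \<le> - ?L" by simp
    then show False using c(1) by simp
  qed
  have lo: "- (INF x\<in>W. verblunsky_rate x) \<le> liminf (\<lambda>n. ereal (1 / real n) * log_ereal (measure (P n) W))"
    (is "_ \<le> ?L") if W: "openin Y_top W" for W
  proof -
    have WY: "W \<subseteq> Y" using W by (simp add: openin_Y_top)
    have "- verblunsky_rate x \<le> ?L" if x: "x \<in> W" for x
    proof (cases "verblunsky_rate x = \<infinity>")
      \<comment> \<open>Points of infinite rate impose no lower bound. At finite rate every product
        is nonzero, so the sequence is infinite and its boxes are available.\<close>
      case False
      have xY: "x \<in> Y" using x WY by blast
      have nz: "vprod (ventry x) k \<noteq> 0" for k
      proof
        assume "vprod (ventry x) k = 0"
        then have "\<infinity> \<le> verblunsky_rate x"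
          unfolding verblunsky_rate_eq_SUP[OF xY] by (intro SUP_upper2[of k]) (auto simp: log_ereal_def)
        then show False using False by simp
      qed
      then have "vlen x > enat k" for k using Y_vprod_eq_0_iff[OF xY, of k] by simp
      then have len: "vlen x = \<infinity>" by (metis enat.exhaust less_irrefl)
      then have z: "cmod (ventry x j) < 1" for j using xY by (auto simp: Y_def)
      obtain k \<epsilon> where \<epsilon>: "0 < \<epsilon>" and box: "{\<alpha> \<in> Y. \<forall>j<k. cmod (ventry \<alpha> j) < 1 \<and> dist (ventry \<alpha> j) (ventry x j) < \<epsilon>} \<subseteq> W"
        using openin_Y_box[OF W x len] by blast
      let ?p = "vprod (ventry x) k"
      have p: "0 < ?p" using nz[of k] vprod_nonneg[of "ventry x" k] Y_entry_le_1[OF xY] by fastforce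
      obtain C where C: "0 < C" and ev: "\<forall>\<^sub>F n in sequentially. C * ?p ^ n \<le>
        measure (P n) {\<alpha> \<in> Y. \<forall>j<k. cmod (ventry \<alpha> j) < 1 \<and> dist (ventry \<alpha> j) (ventry x j) < \<epsilon>}"
      proof -
        have "\<exists>C>0. \<forall>\<^sub>F n in sequentially. C * ?p ^ n \<le>
          measure (P n) {\<alpha> \<in> Y. \<forall>j<k. cmod (ventry \<alpha> j) < 1 \<and> dist (ventry \<alpha> j) (ventry x j) < \<epsilon>}"
          by (rule lower) (use z \<epsilon> in auto)
        then show thesis using that by blast
      qed
      have "\<forall>\<^sub>F n in sequentially. ereal (ln C / real n + ln ?p) \<le> ereal (1 / real n) * log_ereal (measure (P n) W)"
        using ev eventually_ge_at_top[of 1]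
      proof eventually_elim
        case (elim n)
        interpret prob_space "P n" using prob[OF elim(2)] .
        have "C * ?p ^ n \<le> measure (P n) W"
          using elim(1) by (rule order_trans) (intro finite_measure_mono box, simp add: sets[OF elim(2)] openin_borel_of W)
        then have "log_ereal (C * ?p ^ n) \<le> log_ereal (measure (P n) W)"
          using C p by (intro log_ereal_mono) auto
        then have "ereal (1 / real n) * log_ereal (C * ?p ^ n) \<le> ereal (1 / real n) * log_ereal (measure (P n) W)"
          by (intro ereal_mult_left_mono) auto
        moreover have "ereal (1 / real n) * log_ereal (C * ?p ^ n) = ereal (ln C / real n + ln ?p)"
          using C p elim(2) by (simp add: log_ereal_def ln_mult ln_realpow field_simps)
        ultimately show ?case by simp
      qed
      then have "liminf (\<lambda>n. ereal (ln C / real n + ln ?p)) \<le> ?L" by (rule Liminf_mono)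
      moreover have "(\<lambda>n. ereal (ln C / real n + ln ?p)) \<longlonglongrightarrow> ereal (ln ?p)"
        using tendsto_add[OF lim_const_over_n[of "ln C"] tendsto_const[of "ln ?p"]]
        by (intro tendsto_ereal) simp
      then have "liminf (\<lambda>n. ereal (ln C / real n + ln ?p)) = ereal (ln ?p)"
        by (rule lim_imp_Liminf[OF sequentially_bot])
      \<comment> \<open>The box sees only the first k factors, and minus the logarithm of their
        product is at most the rate.\<close>
      moreover have "- ereal (ln ?p) \<le> verblunsky_rate x"
        unfolding verblunsky_rate_eq_SUP[OF xY] using p by (intro SUP_upper2[of k]) (auto simp: log_ereal_def)
      then have "- verblunsky_rate x \<le> ereal (ln ?p)" by (subst ereal_uminus_le_reorder) simp
      ultimately show ?thesis by simp
    qed simp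
    then have "- ?L \<le> (INF x\<in>W. verblunsky_rate x)"
      by (intro INF_greatest) (subst ereal_uminus_le_reorder, simp)
    then show ?thesis by (subst ereal_uminus_le_reorder)
  qed
  show ?thesis
    unfolding LDP_def topspace_Y_top
    using prob sets up lo filterlim_real_sequentially
    by (auto simp: completely_metrizable_Y_top second_countable_Y_top verblunsky_rate_nonneg lsc_verblunsky_rate)
qed

section \<open>Unitary matrices\<close>

unbundle no vec_syntax

lemma mat_adjoint_dim [simp]: "dim_row (mat_adjoint A) = dim_col A" "dim_col (mat_adjoint A) = dim_row A"
  by (auto simp: mat_adjoint_def)

lemma mat_adjoint_carrier [simp]: "A \<in> carrier_mat n m \<Longrightarrow> mat_adjoint A \<in> carrier_mat m n"
  by (rule carrier_matI) auto

lemma mat_adjoint_index [simp]: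
  fixes A :: "complex mat"
  shows "i < dim_col A \<Longrightarrow> j < dim_row A \<Longrightarrow> mat_adjoint A $$ (i, j) = cnj (A $$ (j, i))"
  by (simp add: mat_adjoint_def mat_of_rows_index)

lemma mat_adjoint_adjoint [simp]: "mat_adjoint (mat_adjoint A) = (A :: complex mat)"
  by (rule eq_matI) auto

lemma mat_adjoint_mult:
  assumes "A \<in> carrier_mat n m" "B \<in> carrier_mat m l"
  shows "mat_adjoint (A * B) = mat_adjoint B * (mat_adjoint A :: complex mat)"
proof (rule eq_matI)
  fix i j assume "i < dim_row (mat_adjoint B * mat_adjoint A)" "j < dim_col (mat_adjoint B * mat_adjoint A)"
  then have "i < l" "j < n" using assms by auto
  then show "mat_adjoint (A * B) $$ (i, j) = (mat_adjoint B * mat_adjoint A) $$ (i, j)"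
    using assms by (auto simp: scalar_prod_def mult.commute intro!: sum.cong)
qed (use assms in auto)

lemma cscalar_prod_adjoint:
  fixes A :: "complex mat"
  assumes "A \<in> carrier_mat n m" "x \<in> carrier_vec m" "y \<in> carrier_vec n"
  shows "(A *\<^sub>v x) \<bullet>c y = x \<bullet>c (mat_adjoint A *\<^sub>v y)"
proof -
  have "(A *\<^sub>v x) \<bullet>c y = (\<Sum>i<n. \<Sum>j<m. A $$ (i, j) * x $ j * cnj (y $ i))"
    using assms by (auto simp: scalar_prod_def sum_distrib_right lessThan_atLeast0 intro!: sum.cong)
  also have "\<dots> = (\<Sum>j<m. \<Sum>i<n. A $$ (i, j) * x $ j * cnj (y $ i))"
    by (rule sum.swap)
  also have "\<dots> = x \<bullet>c (mat_adjoint A *\<^sub>v y)"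
    using assms by (auto simp: scalar_prod_def sum_distrib_left lessThan_atLeast0 ac_simps intro!: sum.cong)
  finally show ?thesis .
qed

lemma mult_mat_vec_index:
  "A \<in> carrier_mat n m \<Longrightarrow> x \<in> carrier_vec m \<Longrightarrow> i < n \<Longrightarrow> (A *\<^sub>v x) $ i = (\<Sum>j<m. A $$ (i, j) * x $ j)"
  by (auto simp: scalar_prod_def lessThan_atLeast0 intro!: sum.cong)

lemma mult_mat_index:
  "A \<in> carrier_mat n m \<Longrightarrow> B \<in> carrier_mat m l \<Longrightarrow> i < n \<Longrightarrow> j < l \<Longrightarrow>
    (A * B) $$ (i, j) = (\<Sum>k<m. A $$ (i, k) * B $$ (k, j))"
  by (auto simp: scalar_prod_def lessThan_atLeast0 intro!: sum.cong)

lemma cscalar_prod_sum: "y \<in> carrier_vec n \<Longrightarrow> x \<bullet>c y = (\<Sum>i<n. x $ i * cnj (y $ i))"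
  by (auto simp: scalar_prod_def lessThan_atLeast0 intro!: sum.cong)

lemma unit_vec_cscalar [simp]: "x \<in> carrier_vec n \<Longrightarrow> i < n \<Longrightarrow> x \<bullet>c unit_vec n i = (x $ i :: complex)"
  by (subst cscalar_prod_sum[of _ n]) (auto simp: if_distrib cong: if_cong)

lemma mult_mat_unit_vec: "A \<in> carrier_mat n m \<Longrightarrow> j < m \<Longrightarrow> A *\<^sub>v unit_vec m j = (col A j :: complex vec)"
  by (rule eq_vecI) (auto simp: scalar_prod_right_unit)

lemma unitary_groupI:
  assumes "U \<in> carrier_mat n n"
    "\<And>i j. i < n \<Longrightarrow> j < n \<Longrightarrow> (\<Sum>k<n. cnj (U $$ (k, i)) * U $$ (k, j)) = (if i = j then 1 else 0)"
  shows "U \<in> unitary_group n"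
  unfolding unitary_group_def
proof (intro CollectI conjI assms eq_matI)
  fix i j assume "i < dim_row (1\<^sub>m n :: complex mat)" "j < dim_col (1\<^sub>m n :: complex mat)"
  then show "(mat_adjoint U * U) $$ (i, j) = 1\<^sub>m n $$ (i, j)"
    using assms by (subst mult_mat_index[of _ n n _ n]) auto
qed (use assms in auto)

lemma unitary_group_carrier: "U \<in> unitary_group n \<Longrightarrow> U \<in> carrier_mat n n"
  by (simp add: unitary_group_def)

lemma unitary_group_col_sum:
  assumes "U \<in> unitary_group n" "i < n" "j < n"
  shows "(\<Sum>k<n. cnj (U $$ (k, i)) * U $$ (k, j)) = (if i = j then 1 else 0)"
proof -
  have "(mat_adjoint U * U) $$ (i, j) = 1\<^sub>m n $$ (i, j)" using assms by (simp add: unitary_group_def)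
  then show ?thesis
    using assms unitary_group_carrier[OF assms(1)] by (subst (asm) mult_mat_index[of _ n n _ n]) auto
qed

lemma unitary_group_adjoint_left: "U \<in> unitary_group n \<Longrightarrow> mat_adjoint U * U = 1\<^sub>m n"
  by (simp add: unitary_group_def)

lemma unitary_group_adjoint_right: "U \<in> unitary_group n \<Longrightarrow> U * mat_adjoint U = 1\<^sub>m n"
  by (rule mat_mult_left_right_inverse) (auto simp: unitary_group_def)

lemma unitary_group_one: "1\<^sub>m n \<in> unitary_group n"
  by (rule unitary_groupI) (auto simp: if_distrib cong: if_cong)

lemma unitary_group_adjoint: "U \<in> unitary_group n \<Longrightarrow> mat_adjoint U \<in> unitary_group n"
  using unitary_group_adjoint_right[of U n] by (simp add: unitary_group_def)

lemma unitary_group_mult: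
  assumes "U \<in> unitary_group n" "V \<in> unitary_group n" shows "U * V \<in> unitary_group n"
proof -
  have c: "U \<in> carrier_mat n n" "V \<in> carrier_mat n n" "mat_adjoint U \<in> carrier_mat n n" "mat_adjoint V \<in> carrier_mat n n"
    using assms by (auto simp: unitary_group_def)
  have "mat_adjoint (U * V) * (U * V) = mat_adjoint V * (mat_adjoint U * U) * V"
    using c by (simp add: mat_adjoint_mult[of _ n n] assoc_mult_mat[of _ n n _ n _ n] mult_carrier_mat[of _ n n _ n])
  then show ?thesis using assms c by (simp add: unitary_group_def)
qed

lemma of_real_sum_norm_square: "of_real (\<Sum>i\<in>A. (cmod (f i))\<^sup>2) = (\<Sum>i\<in>A. f i * cnj (f i))"
  by (simp only: of_real_sum complex_norm_square)

lemma unitary_row_norm: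
  assumes "U \<in> unitary_group n" "i < n" shows "(\<Sum>k<n. (cmod (U $$ (i, k)))\<^sup>2) = 1"
proof -
  have c: "U \<in> carrier_mat n n" using assms by (simp add: unitary_group_carrier)
  have "of_real (\<Sum>k<n. (cmod (U $$ (i, k)))\<^sup>2) = (\<Sum>k<n. U $$ (i, k) * cnj (U $$ (i, k)))"
    by (rule of_real_sum_norm_square)
  also have "\<dots> = (\<Sum>k<n. cnj (mat_adjoint U $$ (k, i)) * mat_adjoint U $$ (k, i))"
    using c assms(2) by (intro sum.cong) auto
  also have "\<dots> = 1"
    using unitary_group_col_sum[OF unitary_group_adjoint[OF assms(1)] assms(2,2)] by simp
  finally show ?thesis by (metis of_real_eq_1_iff)
qed

lemma unitary_col_norm:
  assumes "U \<in> unitary_group n" "i < n" shows "(\<Sum>k<n. (cmod (U $$ (k, i)))\<^sup>2) = 1"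
proof -
  have "of_real (\<Sum>k<n. (cmod (U $$ (k, i)))\<^sup>2) = (\<Sum>k<n. U $$ (k, i) * cnj (U $$ (k, i)))"
    by (rule of_real_sum_norm_square)
  also have "\<dots> = (\<Sum>k<n. cnj (U $$ (k, i)) * U $$ (k, i))"
    by (rule sum.cong) (rule refl, rule mult.commute)
  also have "\<dots> = 1" using unitary_group_col_sum[OF assms(1,2,2)] by simp
  finally show ?thesis by (metis of_real_eq_1_iff)
qed

lemma unitary_cscalar_prod:
  assumes "U \<in> unitary_group n" "x \<in> carrier_vec n" "y \<in> carrier_vec n"
  shows "(U *\<^sub>v x) \<bullet>c (U *\<^sub>v y) = x \<bullet>c y"
proof -
  have c: "U \<in> carrier_mat n n" using assms by (simp add: unitary_group_carrier)
  have "(U *\<^sub>v x) \<bullet>c (U *\<^sub>v y) = x \<bullet>c (mat_adjoint U *\<^sub>v (U *\<^sub>v y))"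
    using c assms by (intro cscalar_prod_adjoint) auto
  also have "mat_adjoint U *\<^sub>v (U *\<^sub>v y) = y"
    using c assms by (subst assoc_mult_mat_vec[symmetric, of _ n n _ n]) (auto simp: unitary_group_adjoint_left)
  finally show ?thesis .
qed

subsection \<open>Householder reflections, Givens rotations and diagonalization\<close>

text \<open>Householder reflection. With w the phase of v_0, the vector y = e_0 - cnj w v has a real
  entry y_0, and the reflection at the hyperplane orthogonal to y sends e_0 to cnj w v. Multiplying
  the reflection by w gives K e_0 = v.\<close>

lemma exists_unitary_col_0:
  assumes v: "v \<in> carrier_vec n" "(\<Sum>i<n. (cmod (v $ i))\<^sup>2) = 1"
  shows "\<exists>K\<in>unitary_group n. \<forall>i<n. K $$ (i, 0) = v $ i"
proof -
  have n: "0 < n" using v(2) by (cases n) auto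
  define r where "r = cmod (v $ 0)"
  define w where "w = (if r = 0 then 1 else v $ 0 / of_real r)"
  define y where "y i = (if i = 0 then 1 else 0) - cnj w * v $ i" for i
  define s where "s = (\<Sum>i<n. (cmod (y i))\<^sup>2)"
  have w1: "cmod w = 1" by (auto simp: w_def r_def norm_divide)
  have ww: "w * cnj w = 1" using w1 by (simp add: complex_norm_square[symmetric])
  have v0: "v $ 0 = w * of_real r" by (auto simp: w_def r_def)
  have y0: "y 0 = of_real (1 - r)"
    using ww by (simp add: y_def v0 algebra_simps)
  have rest: "(\<Sum>i\<in>{..<n} - {0}. (cmod (v $ i))\<^sup>2) = 1 - r\<^sup>2"
    using v(2) n by (subst (asm) sum.remove[of _ 0]) (auto simp: r_def)
  have "s = (1 - r)\<^sup>2 + (\<Sum>i\<in>{..<n} - {0}. (cmod (v $ i))\<^sup>2)"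
    unfolding s_def using n y0
    by (subst sum.remove[of _ 0]) (auto simp: y_def norm_mult w1 intro!: sum.cong arg_cong2[where f="(+)"] simp flip: of_real_diff)
  then have s: "s = 2 * (1 - r)" unfolding rest by (simp add: power2_eq_square algebra_simps)
  have ss: "(\<Sum>k<n. y k * cnj (y k)) = of_real s" unfolding s_def by (simp only: of_real_sum_norm_square)
  \<comment> \<open>When s = 0, division by zero gives t = 0 and K is w times the identity, which is
    right because v = w e_0 in that case. The identity used for unitarity holds either way.\<close>
  define t :: complex where "t = 2 / of_real s"
  have t: "cnj t = t" "t * t * of_real s = 2 * t" by (auto simp: t_def)
  define K where "K = mat n n (\<lambda>(i, j). w * ((if i = j then 1 else 0) - t * y i * cnj (y j)))"
  have "K \<in> unitary_group n"
  proof (rule unitary_groupI)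
    fix i j assume ij: "i < n" "j < n"
    have "(\<Sum>k<n. cnj (K $$ (k, i)) * K $$ (k, j)) =
      (\<Sum>k<n. (if k = i then if k = j then 1 else 0 else 0) - (if k = i then t * y k * cnj (y j) else 0)
          - (if k = j then t * y i * cnj (y k) else 0) + t * t * y i * cnj (y j) * (y k * cnj (y k)))"
    proof (rule sum.cong)
      fix k assume "k \<in> {..<n}"
      then have "cnj (K $$ (k, i)) * K $$ (k, j) = (w * cnj w) * (((if k = i then 1 else 0) - t * cnj (y k) * y i)
         * ((if k = j then 1 else 0) - t * y k * cnj (y j)))"
        using ij t(1) by (simp add: K_def)
      then show "cnj (K $$ (k, i)) * K $$ (k, j) = (if k = i then if k = j then 1 else 0 else 0) - (if k = i then t * y k * cnj (y j) else 0)
          - (if k = j then t * y i * cnj (y k) else 0) + t * t * y i * cnj (y j) * (y k * cnj (y k))"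
        unfolding ww mult_1 by (rule trans) (auto simp: algebra_simps)
    qed simp
    also have "\<dots> = (if i = j then 1 else 0) - 2 * t * y i * cnj (y j) + (t * t * of_real s) * y i * cnj (y j)"
      using ij unfolding sum.distrib sum_subtractf sum_distrib_left[symmetric] ss by simp
    finally show "(\<Sum>k<n. cnj (K $$ (k, i)) * K $$ (k, j)) = (if i = j then 1 else 0)"
      unfolding t(2) by simp
  qed (simp add: K_def)
  moreover have "K $$ (i, 0) = v $ i" if i: "i < n" for i
  proof (cases "s = 0")
    case True
    then have r: "r = 1" using s by simp
    have "K $$ (i, 0) = (if i = 0 then w else 0)" using i n True by (simp add: K_def t_def)
    moreover have "v $ i = (if i = 0 then w else 0)"
    proof (cases "i = 0")
      case False
      have "(\<Sum>i\<in>{..<n} - {0}. (cmod (v $ i))\<^sup>2) = 0" using rest r by simp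
      then have "\<forall>i\<in>{..<n} - {0}. (cmod (v $ i))\<^sup>2 = 0"
        by (subst (asm) sum_nonneg_eq_0_iff) auto
      then show ?thesis using i False by simp
    qed (simp add: v0 r)
    ultimately show ?thesis by simp
  next
    case False
    then have r: "r \<noteq> 1" using s by simp
    have h: "t * y i * cnj (y 0) = y i"
    proof -
      have "t * cnj (y 0) = 1" using r unfolding t_def y0 s by simp
      then show ?thesis by (simp add: ac_simps)
    qed
    have "K $$ (i, 0) = w * ((if i = 0 then 1 else 0) - t * y i * cnj (y 0))"
      using i n by (simp add: K_def)
    also have "\<dots> = w * (cnj w * v $ i)" unfolding h by (simp add: y_def)
    finally show ?thesis using ww by (simp add: mult.assoc[symmetric])
  qed
  ultimately show ?thesis by blast
qed

text \<open>The block sum c \<oplus> Z; with c = 1 it embeds U(n) into U(n+1) as the stabilizer of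
  the first basis vector.\<close>

definition mat_corner :: "complex \<Rightarrow> complex mat \<Rightarrow> complex mat" where
  "mat_corner c Z = mat (Suc (dim_row Z)) (Suc (dim_col Z))
     (\<lambda>(i, j). if i = 0 then (if j = 0 then c else 0) else if j = 0 then 0 else Z $$ (i - 1, j - 1))"

lemma mat_corner_dim [simp]: "dim_row (mat_corner c Z) = Suc (dim_row Z)" "dim_col (mat_corner c Z) = Suc (dim_col Z)"
  by (auto simp: mat_corner_def)

lemma mat_corner_carrier [simp]: "mat_corner c Z \<in> carrier_mat (Suc n) (Suc m) \<longleftrightarrow> Z \<in> carrier_mat n m"
  by (intro iffI carrier_matI) (auto dest: carrier_matD)

lemma mat_corner_index:
  "Z \<in> carrier_mat n m \<Longrightarrow> i \<le> n \<Longrightarrow> j \<le> m \<Longrightarrow> mat_corner c Z $$ (i, j) =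
    (if i = 0 then (if j = 0 then c else 0) else if j = 0 then 0 else Z $$ (i - 1, j - 1))"
  by (auto simp: mat_corner_def)

lemma mat_corner_mult:
  assumes "Z \<in> carrier_mat n m" "W \<in> carrier_mat m l"
  shows "mat_corner c Z * mat_corner d W = mat_corner (c * d) (Z * W)"
proof (rule eq_matI)
  fix i j assume "i < dim_row (mat_corner (c * d) (Z * W))" "j < dim_col (mat_corner (c * d) (Z * W))"
  then have ij: "i < Suc n" "j < Suc l" using assms by auto
  have "(mat_corner c Z * mat_corner d W) $$ (i, j) = (\<Sum>k<Suc m. mat_corner c Z $$ (i, k) * mat_corner d W $$ (k, j))"
    using assms ij by (intro mult_mat_index) auto
  also have "\<dots> = mat_corner (c * d) (Z * W) $$ (i, j)"
    unfolding sum.lessThan_Suc_shift using assms ij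
    by (cases i; cases j) (auto simp: mat_corner_index[of _ n m] mat_corner_index[of _ m l] mat_corner_index[of _ n l] mult_mat_index[of _ n m _ l] simp del: index_mult_mat(1) intro!: sum.neutral sum.cong)
  finally show "(mat_corner c Z * mat_corner d W) $$ (i, j) = mat_corner (c * d) (Z * W) $$ (i, j)" .
qed (use assms in auto)

lemma mat_corner_adjoint: "mat_adjoint (mat_corner c Z) = mat_corner (cnj c) (mat_adjoint Z)"
  by (rule eq_matI) (auto simp: mat_corner_def)

lemma mat_corner_one: "mat_corner 1 (1\<^sub>m n) = 1\<^sub>m (Suc n)"
  by (rule eq_matI) (auto simp: mat_corner_def)

lemma mat_corner_unitary:
  assumes "cmod c = 1" "Z \<in> unitary_group n" shows "mat_corner c Z \<in> unitary_group (Suc n)"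
proof -
  have "cnj c * c = 1" using assms(1) by (simp add: complex_norm_square[symmetric] mult.commute)
  moreover have "Z \<in> carrier_mat n n" using assms(2) by (simp add: unitary_group_carrier)
  ultimately show ?thesis
    using assms(2) by (auto simp: unitary_group_def mat_corner_adjoint mat_corner_mult[of _ n n _ n] mat_corner_one)
qed

lemma mat_corner_mult_vec:
  assumes "Z \<in> carrier_mat n m" "x \<in> carrier_vec m"
  shows "mat_corner c Z *\<^sub>v vCons a x = vCons (c * a) (Z *\<^sub>v x)"
proof (rule eq_vecI)
  fix i assume "i < dim_vec (vCons (c * a) (Z *\<^sub>v x))"
  then have i: "i < Suc n" using assms by auto
  have "(mat_corner c Z *\<^sub>v vCons a x) $ i = (\<Sum>k<Suc m. mat_corner c Z $$ (i, k) * vCons a x $ k)"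
    using assms i by (intro mult_mat_vec_index) auto
  also have "\<dots> = vCons (c * a) (Z *\<^sub>v x) $ i"
    unfolding sum.lessThan_Suc_shift using assms i
    by (cases i) (auto simp: mat_corner_index[of _ n m] mult_mat_vec_index[of _ n m] simp del: index_mult_mat_vec intro!: sum.neutral sum.cong)
  finally show "(mat_corner c Z *\<^sub>v vCons a x) $ i = vCons (c * a) (Z *\<^sub>v x) $ i" .
qed (use assms in auto)

text \<open>Unit length of the first column makes the corner unimodular, and unit length of the
  first row then leaves nothing for its other entries.\<close>

lemma unitary_corner_cases:
  assumes U: "U \<in> unitary_group (Suc n)" and col: "\<And>i. 0 < i \<Longrightarrow> i \<le> n \<Longrightarrow> U $$ (i, 0) = 0"
  shows "cmod (U $$ (0, 0)) = 1 \<and> (\<exists>Z\<in>unitary_group n. U = mat_corner (U $$ (0, 0)) Z)"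
proof -
  have c: "U \<in> carrier_mat (Suc n) (Suc n)" using U by (simp add: unitary_group_carrier)
  have "(\<Sum>k<Suc n. (cmod (U $$ (k, 0)))\<^sup>2) = 1" using unitary_col_norm[OF U] by simp
  then have "(cmod (U $$ (0, 0)))\<^sup>2 = 1"
    unfolding sum.lessThan_Suc_shift using col by (simp add: sum.neutral)
  then have u: "cmod (U $$ (0, 0)) = 1" using norm_ge_zero[of "U $$ (0,0)"] by (auto simp: power2_eq_1_iff simp del: norm_ge_zero)
  have "(\<Sum>k<Suc n. (cmod (U $$ (0, k)))\<^sup>2) = 1" using unitary_row_norm[OF U] by simp
  then have "(\<Sum>k<n. (cmod (U $$ (0, Suc k)))\<^sup>2) = 0"
    unfolding sum.lessThan_Suc_shift using u by simp
  then have row: "U $$ (0, Suc k) = 0" if "k < n" for k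
    using that by (subst (asm) sum_nonneg_eq_0_iff) auto
  define Z where "Z = mat n n (\<lambda>(i, j). U $$ (Suc i, Suc j))"
  have Zc: "Z \<in> carrier_mat n n" by (simp add: Z_def)
  have eq: "U = mat_corner (U $$ (0, 0)) Z"
  proof (rule eq_matI)
    fix i j assume "i < dim_row (mat_corner (U $$ (0, 0)) Z)" "j < dim_col (mat_corner (U $$ (0, 0)) Z)"
    then have "i < Suc n" "j < Suc n" using Zc by auto
    then show "U $$ (i, j) = mat_corner (U $$ (0, 0)) Z $$ (i, j)"
      using col[of i] row by (cases i; cases j) (auto simp: mat_corner_def Z_def)
  qed (use c Zc in auto)
  have "Z \<in> unitary_group n"
  proof (rule unitary_groupI[OF Zc])
    fix i j assume ij: "i < n" "j < n"
    have "(\<Sum>k<Suc n. cnj (U $$ (k, Suc i)) * U $$ (k, Suc j)) = (if i = j then 1 else 0)"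
      using unitary_group_col_sum[OF U, of "Suc i" "Suc j"] ij by simp
    then show "(\<Sum>k<n. cnj (Z $$ (k, i)) * Z $$ (k, j)) = (if i = j then 1 else 0)"
      unfolding sum.lessThan_Suc_shift using row ij by (simp add: Z_def)
  qed
  then show ?thesis using u eq by blast
qed

text \<open>Deflation: a unit eigenvector is completed to a unitary K, conjugation by K turns the
  first column into a multiple of e_0, and the lower block of the resulting block sum is handled by
  induction.\<close>

lemma unitary_diagonalization:
  "U \<in> unitary_group n \<Longrightarrow> \<exists>Q\<in>unitary_group n. \<exists>l. (\<forall>i<n. cmod (l i) = 1) \<and> U * Q = Q * mat_diag n l"
proof (induction n arbitrary: U)
  case 0
  then show ?case
    by (intro bexI[of _ "1\<^sub>m 0"] exI[of _ "\<lambda>_. 1"]) (auto simp: unitary_group_one dest: unitary_group_carrier intro!: eq_matI)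
next
  case (Suc n)
  note U = Suc.prems
  have Uc: "U \<in> carrier_mat (Suc n) (Suc n)" using U by (simp add: unitary_group_carrier)
  obtain e where "eigenvalue U e" using spectrum_non_empty[OF Uc] by (auto simp: spectrum_def)
  then obtain x where x: "x \<in> carrier_vec (Suc n)" "x \<noteq> 0\<^sub>v (Suc n)" "U *\<^sub>v x = e \<cdot>\<^sub>v x"
    using Uc by (auto simp: eigenvalue_def eigenvector_def)
  define s where "s = sqrt (\<Sum>i<Suc n. (cmod (x $ i))\<^sup>2)"
  have "(\<Sum>i<Suc n. (cmod (x $ i))\<^sup>2) \<noteq> 0"
  proof
    assume "(\<Sum>i<Suc n. (cmod (x $ i))\<^sup>2) = 0"
    then have "\<forall>i\<in>{..<Suc n}. (cmod (x $ i))\<^sup>2 = 0" by (subst (asm) sum_nonneg_eq_0_iff) auto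
    then have "x = 0\<^sub>v (Suc n)" using x(1) by (intro eq_vecI) auto
    then show False using x(2) by simp
  qed
  moreover have "0 \<le> (\<Sum>i<Suc n. (cmod (x $ i))\<^sup>2)" by (intro sum_nonneg) auto
  ultimately have s: "0 < s" "s\<^sup>2 = (\<Sum>i<Suc n. (cmod (x $ i))\<^sup>2)"
    unfolding s_def by (simp_all only: real_sqrt_gt_0_iff real_sqrt_pow2)
  define v where "v = (1 / of_real s) \<cdot>\<^sub>v x"
  have v: "v \<in> carrier_vec (Suc n)" "U *\<^sub>v v = e \<cdot>\<^sub>v v"
    using x Uc by (simp_all add: v_def mult_mat_vec[OF Uc x(1)] smult_smult_assoc mult.commute)
  have "(\<Sum>i<Suc n. (cmod (v $ i))\<^sup>2) = (\<Sum>i<Suc n. (cmod (x $ i))\<^sup>2 / s\<^sup>2)"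
    using x(1) s(1) by (intro sum.cong) (auto simp: v_def norm_mult norm_divide power_divide)
  also have "\<dots> = 1" using s by (simp only: sum_divide_distrib[symmetric] s(2)[symmetric]) simp
  finally obtain K where K: "K \<in> unitary_group (Suc n)" "\<And>i. i < Suc n \<Longrightarrow> K $$ (i, 0) = v $ i"
    using exists_unitary_col_0[OF v(1)] by blast
  have Kc: "K \<in> carrier_mat (Suc n) (Suc n)" "mat_adjoint K \<in> carrier_mat (Suc n) (Suc n)"
    using K(1) by (auto simp: unitary_group_carrier)
  have Ke: "K *\<^sub>v unit_vec (Suc n) 0 = v"
    using K(2) Kc v(1) by (subst mult_mat_unit_vec[of _ "Suc n" "Suc n"]) (auto intro!: eq_vecI)
  define W where "W = mat_adjoint K * U * K"
  have W: "W \<in> unitary_group (Suc n)"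
    unfolding W_def using K U by (intro unitary_group_mult unitary_group_adjoint)
  have Wc: "W \<in> carrier_mat (Suc n) (Suc n)" using W by (rule unitary_group_carrier)
  have "W *\<^sub>v unit_vec (Suc n) 0 = mat_adjoint K *\<^sub>v (U *\<^sub>v (K *\<^sub>v unit_vec (Suc n) 0))"
    unfolding W_def using Kc Uc by (simp add: assoc_mult_mat_vec[of _ "Suc n" "Suc n" _ "Suc n"] assoc_mult_mat[of _ "Suc n" "Suc n" _ "Suc n" _ "Suc n"] mult_carrier_mat[of _ "Suc n" "Suc n" _ "Suc n"])
  also have "\<dots> = e \<cdot>\<^sub>v (mat_adjoint K *\<^sub>v (K *\<^sub>v unit_vec (Suc n) 0))"
    unfolding Ke v(2) using Kc v(1) by (simp add: mult_mat_vec[of _ "Suc n" "Suc n"])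
  also have "mat_adjoint K *\<^sub>v (K *\<^sub>v unit_vec (Suc n) 0) = unit_vec (Suc n) 0"
    using Kc by (subst assoc_mult_mat_vec[symmetric, of _ "Suc n" "Suc n" _ "Suc n"]) (auto simp: unitary_group_adjoint_left[OF K(1)])
  finally have colW: "col W 0 = e \<cdot>\<^sub>v unit_vec (Suc n) 0" using Wc by (simp add: mult_mat_unit_vec)
  have We: "W $$ (i, 0) = (if i = 0 then e else 0)" if "i < Suc n" for i
  proof -
    have "W $$ (i, 0) = col W 0 $ i" using that Wc by simp
    then show ?thesis unfolding colW using that by simp
  qed
  obtain Z where Z: "Z \<in> unitary_group n" "W = mat_corner e Z" and e: "cmod e = 1"
    using unitary_corner_cases[OF W] We by auto
  obtain Q l where Q: "Q \<in> unitary_group n" and l: "\<forall>i<n. cmod (l i) = 1" and ZQ: "Z * Q = Q * mat_diag n l"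
    using Suc.IH[OF Z(1)] by blast
  have Qc: "Q \<in> carrier_mat n n" "Z \<in> carrier_mat n n" using Q Z by (auto simp: unitary_group_carrier)
  have diag: "mat_diag (Suc n) (case_nat e l) = mat_corner e (mat_diag n l)"
    by (rule eq_matI) (auto simp: mat_corner_def mat_diag_def split: nat.split)
  have KW: "U * K = K * W"
  proof -
    have "K * W = (K * mat_adjoint K) * U * K"
      unfolding W_def using Kc Uc by (simp add: assoc_mult_mat[of _ "Suc n" "Suc n" _ "Suc n" _ "Suc n"] mult_carrier_mat[of _ "Suc n" "Suc n" _ "Suc n"])
    then show ?thesis using Uc by (simp add: unitary_group_adjoint_right[OF K(1)])
  qed
  have "U * (K * mat_corner 1 Q) = K * (W * mat_corner 1 Q)"
    using KW Kc Uc Wc Qc by (simp add: assoc_mult_mat[symmetric, of _ "Suc n" "Suc n" _ "Suc n" _ "Suc n"] mult_carrier_mat[of _ "Suc n" "Suc n" _ "Suc n"])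
  also have "W * mat_corner 1 Q = mat_corner 1 Q * mat_corner e (mat_diag n l)"
    using Z(2) ZQ Qc by (simp add: mat_corner_mult[of _ n n _ n])
  also have "K * (mat_corner 1 Q * mat_corner e (mat_diag n l)) = (K * mat_corner 1 Q) * mat_diag (Suc n) (case_nat e l)"
    unfolding diag using Kc Qc by (intro assoc_mult_mat[symmetric, of _ "Suc n" "Suc n" _ "Suc n" _ "Suc n"]) auto
  finally show ?case
    using unitary_group_mult[OF K(1) mat_corner_unitary[of 1, OF _ Q]] l e
    by (intro bexI[of _ "K * mat_corner 1 Q"] exI[of _ "case_nat e l"]) (auto split: nat.split)
qed

lemma mult_mat_zero_vec [simp]: "A \<in> carrier_mat n m \<Longrightarrow> A *\<^sub>v 0\<^sub>v m = (0\<^sub>v n :: complex vec)"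
  by (rule eq_vecI) auto

text \<open>On the span of e_0 and e_l this is the block with rows (a, cnj b) and (b, -cnj a), of
  determinant -1 when unitary. For l = 1, a = cnj \<alpha> and positive b it is the block
  \<Theta>(\<alpha>) of the CMV factorization, which is why the Schur step below shifts the
  coefficients exactly.\<close>

definition givens :: "nat \<Rightarrow> nat \<Rightarrow> complex \<Rightarrow> complex \<Rightarrow> complex mat" where
  "givens n l a b = mat n n (\<lambda>(i, j).
     if i = 0 then (if j = 0 then a else if j = l then cnj b else 0)
     else if i = l then (if j = 0 then b else if j = l then - cnj a else 0)
     else if i = j then 1 else 0)"

lemma givens_carrier [simp]: "givens n l a b \<in> carrier_mat n n"
  by (simp add: givens_def)

lemma givens_dim [simp]: "dim_row (givens n l a b) = n" "dim_col (givens n l a b) = n"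
  by (auto simp: givens_def)

lemma givens_unitary:
  assumes l: "0 < l" "l < n" and ab: "(cmod a)\<^sup>2 + (cmod b)\<^sup>2 = 1"
  shows "givens n l a b \<in> unitary_group n"
proof (rule unitary_groupI)
  fix i j assume ij: "i < n" "j < n"
  have "of_real ((cmod a)\<^sup>2 + (cmod b)\<^sup>2) = (1 :: complex)" using ab by simp
  then have ab': "a * cnj a + b * cnj b = 1" by (simp only: of_real_add complex_norm_square)
  let ?G = "givens n l a b"
  have "(\<Sum>k<n. cnj (?G $$ (k, i)) * ?G $$ (k, j)) = (\<Sum>k\<in>{0, l, i}. cnj (?G $$ (k, i)) * ?G $$ (k, j))"
    using ij l by (intro sum.mono_neutral_right) (auto simp: givens_def)
  also have "\<dots> = (if i = j then 1 else 0)"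
    using ij l ab' by (cases "i = 0 \<or> i = l"; auto simp: givens_def insert_commute) (simp_all add: algebra_simps)
  finally show "(\<Sum>k<n. cnj (?G $$ (k, i)) * ?G $$ (k, j)) = (if i = j then 1 else 0)" .
qed simp

lemma givens_mult_00:
  assumes "0 < l" "l < n" "U \<in> carrier_mat n n"
  shows "(givens n l a b * U) $$ (0, 0) = a * U $$ (0, 0) + cnj b * U $$ (l, 0)"
proof -
  have "(givens n l a b * U) $$ (0, 0) = (\<Sum>k<n. givens n l a b $$ (0, k) * U $$ (k, 0))"
    using assms by (intro mult_mat_index[of _ n n _ n]) auto
  also have "\<dots> = (\<Sum>k\<in>{0, l}. givens n l a b $$ (0, k) * U $$ (k, 0))"
    using assms by (intro sum.mono_neutral_right) (auto simp: givens_def)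
  finally show ?thesis using assms by (simp add: givens_def)
qed

lemma givens_fixes:
  assumes "0 < l" "l < n" "x \<in> carrier_vec n" "x $ 0 = 0" "x $ l = 0"
  shows "givens n l a b *\<^sub>v x = x"
proof (rule eq_vecI)
  fix i assume "i < dim_vec x"
  then have i: "i < n" using assms by simp
  have "(givens n l a b *\<^sub>v x) $ i = (\<Sum>k<n. givens n l a b $$ (i, k) * x $ k)"
    using assms i by (intro mult_mat_vec_index) auto
  also have "\<dots> = (\<Sum>k\<in>{i}. givens n l a b $$ (i, k) * x $ k)"
    using assms i by (intro sum.mono_neutral_right) (auto simp: givens_def)
  also have "\<dots> = x $ i" using assms i by (auto simp: givens_def)
  finally show "(givens n l a b *\<^sub>v x) $ i = x $ i" .
qed (use assms in auto)

subsection \<open>The Szego recursion in the Krylov space\<close>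

text \<open>\<open>X\<^sub>k = \<Phi>\<^sub>k(U) e\<^sub>1\<close> and \<open>Y\<^sub>k = \<Phi>\<^sub>k\<^sup>*(U) e\<^sub>1\<close>. Once \<open>X\<^sub>k = 0\<close>, division by zero makes all further
  coefficients vanish, in accordance with the convention for \<^const>\<open>verblunsky\<close>.\<close>

definition krylov_coeff :: "complex mat \<Rightarrow> complex vec \<times> complex vec \<Rightarrow> complex" where
  "krylov_coeff U z = cnj ((U *\<^sub>v fst z) \<bullet>c snd z / (fst z \<bullet>c fst z))"

primrec krylov :: "complex mat \<Rightarrow> nat \<Rightarrow> complex vec \<times> complex vec" where
  "krylov U 0 = (unit_vec (dim_row U) 0, unit_vec (dim_row U) 0)"
| "krylov U (Suc k) =
     (U *\<^sub>v fst (krylov U k) - cnj (krylov_coeff U (krylov U k)) \<cdot>\<^sub>v snd (krylov U k),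
      snd (krylov U k) - krylov_coeff U (krylov U k) \<cdot>\<^sub>v (U *\<^sub>v fst (krylov U k)))"

definition krylov_alpha :: "complex mat \<Rightarrow> nat \<Rightarrow> complex" where
  "krylov_alpha U k = krylov_coeff U (krylov U k)"

lemma krylov_carrier:
  assumes "U \<in> carrier_mat n n"
  shows "fst (krylov U k) \<in> carrier_vec n" "snd (krylov U k) \<in> carrier_vec n"
proof -
  have "fst (krylov U k) \<in> carrier_vec n \<and> snd (krylov U k) \<in> carrier_vec n"
    using assms by (induction k) auto
  then show "fst (krylov U k) \<in> carrier_vec n" "snd (krylov U k) \<in> carrier_vec n" by auto
qed

lemma krylov_alpha_0: "U \<in> carrier_mat n n \<Longrightarrow> 0 < n \<Longrightarrow> krylov_alpha U 0 = cnj (U $$ (0, 0))"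
  by (simp add: krylov_alpha_def krylov_coeff_def mult_mat_unit_vec[of U n n] unit_vec_cscalar[of _ n])

text \<open>K carries the Krylov pairs of W to those of U and preserves inner products; since it
  fixes e_0, the starting vectors match.\<close>

lemma krylov_alpha_intertwine:
  assumes K: "K \<in> unitary_group n" "K *\<^sub>v unit_vec n 0 = unit_vec n 0"
    and U: "U \<in> carrier_mat n n" "W \<in> carrier_mat n n" and eq: "U * K = K * W"
  shows "krylov_alpha U k = krylov_alpha W k"
proof -
  have Kc: "K \<in> carrier_mat n n" using K(1) by (rule unitary_group_carrier)
  note c = krylov_carrier[OF U(2)]
  have UK: "U *\<^sub>v (K *\<^sub>v x) = K *\<^sub>v (W *\<^sub>v x)" if "x \<in> carrier_vec n" for x
    using assoc_mult_mat_vec[OF U(1) Kc that] assoc_mult_mat_vec[OF Kc U(2) that] eq by simp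
  have coeff: "krylov_coeff U (K *\<^sub>v x, K *\<^sub>v y) = krylov_coeff W (x, y)"
    if "x \<in> carrier_vec n" "y \<in> carrier_vec n" for x y
    using that U by (simp add: krylov_coeff_def UK unitary_cscalar_prod[OF K(1)])
  have kr: "krylov U k = (K *\<^sub>v fst (krylov W k), K *\<^sub>v snd (krylov W k))" for k
  proof (induction k)
    case 0
    then show ?case using U K(2) by simp
  next
    case (Suc k)
    show ?case
      using U Kc c[of k] coeff[OF c[of k]]
      by (simp add: Suc UK mult_minus_distrib_mat_vec[of _ n n] mult_mat_vec[of _ n n])
  qed
  show ?thesis unfolding krylov_alpha_def kr using coeff[OF c[of k]] by simp
qed

text \<open>For U = G (1 \<oplus> Z), the Krylov vectors at step k + 1 are r (0 \<oplus> X_k) and r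
  G (0 \<oplus> Y_k), where X_k and Y_k belong to Z. Indeed U (0 \<oplus> x) = G (0 \<oplus> Z x),
  so one more step produces r G (0 \<oplus> X_(k+1)). As X_(k+1) is orthogonal to e_0, G fixes 0
  \<oplus> X_(k+1) and drops out. The coefficients agree because G is unitary and the factors r
  cancel.\<close>

lemma krylov_schur_step:
  assumes m: "0 < m" and Z: "Z \<in> unitary_group m" and r: "0 < r" and ar: "(cmod a)\<^sup>2 + r\<^sup>2 = 1"
    and orth: "\<And>k. 0 < k \<Longrightarrow> fst (krylov Z k) $ 0 = 0"
  shows "krylov_alpha (givens (Suc m) (Suc 0) a (of_real r) * mat_corner 1 Z) 0 = cnj a"
    and "krylov_alpha (givens (Suc m) (Suc 0) a (of_real r) * mat_corner 1 Z) (Suc k) = krylov_alpha Z k"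
proof -
  let ?G = "givens (Suc m) (Suc 0) a (of_real r)" and ?N = "Suc m"
  let ?U = "?G * mat_corner 1 Z"
  have G: "?G \<in> unitary_group ?N" using m ar by (intro givens_unitary) auto
  have Zc: "Z \<in> carrier_mat m m" using Z by (rule unitary_group_carrier)
  have Uc: "?U \<in> carrier_mat ?N ?N" using Zc by auto
  note c = krylov_carrier[OF Zc]
  have U0: "?U *\<^sub>v vCons 0 x = ?G *\<^sub>v vCons 0 (Z *\<^sub>v x)" if "x \<in> carrier_vec m" for x
    using that Zc by (subst assoc_mult_mat_vec[of _ ?N ?N _ ?N]) (auto simp: mat_corner_mult_vec[of _ m m])
  have e0: "unit_vec ?N 0 = vCons 1 (0\<^sub>v m)"
    by (rule eq_vecI) (auto simp: vec_index_vCons)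
  have Ue0: "?U *\<^sub>v unit_vec ?N 0 = ?G *\<^sub>v unit_vec ?N 0"
    using Zc by (subst assoc_mult_mat_vec[of _ ?N ?N _ ?N]) (auto simp: e0 mat_corner_mult_vec[of _ m m])
  have Ge: "?G *\<^sub>v unit_vec ?N 0 = vCons a (of_real r \<cdot>\<^sub>v unit_vec m 0)"
    using m by (subst mult_mat_unit_vec[of _ ?N ?N]) (auto simp: givens_def vec_index_vCons intro!: eq_vecI)
  have e1: "vCons 0 (unit_vec m 0) = unit_vec ?N 1"
    using m by (intro eq_vecI) (auto simp: vec_index_vCons unit_vec_def)
  have Ge1: "?G *\<^sub>v vCons 0 (unit_vec m 0) = vCons (of_real r) (- cnj a \<cdot>\<^sub>v unit_vec m 0)"
    unfolding e1 using m by (subst mult_mat_unit_vec[of _ ?N ?N]) (auto simp: givens_def vec_index_vCons intro!: eq_vecI)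
  have Gfix: "?G *\<^sub>v vCons 0 x = vCons 0 x" if "x \<in> carrier_vec m" "x $ 0 = 0" for x
    using that m by (intro givens_fixes) auto
  have U00: "?U $$ (0, 0) = a"
  proof -
    have "?U $$ (0, 0) = (?U *\<^sub>v unit_vec ?N 0) $ 0" using Uc by (simp add: mult_mat_unit_vec[of _ ?N ?N])
    then show ?thesis unfolding Ue0 Ge by simp
  qed
  then show a0: "krylov_alpha ?U 0 = cnj a" using Uc by (subst krylov_alpha_0) auto
  have rr: "complex_of_real r * of_real r = 1 - a * cnj a"
  proof -
    have "of_real ((cmod a)\<^sup>2 + r\<^sup>2) = (1 :: complex)" using ar by simp
    then have "a * cnj a + of_real (r\<^sup>2) = 1" by (simp only: of_real_add complex_norm_square)
    then show ?thesis by (simp add: power2_eq_square algebra_simps)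
  qed
  have coeff: "krylov_coeff ?U (of_real r \<cdot>\<^sub>v vCons 0 x, of_real r \<cdot>\<^sub>v (?G *\<^sub>v vCons 0 y)) = krylov_coeff Z (x, y)"
    if x: "x \<in> carrier_vec m" and y: "y \<in> carrier_vec m" for x y
  proof -
    have "(?U *\<^sub>v (of_real r \<cdot>\<^sub>v vCons 0 x)) \<bullet>c (of_real r \<cdot>\<^sub>v (?G *\<^sub>v vCons 0 y))
      = of_real r * of_real r * ((?G *\<^sub>v vCons 0 (Z *\<^sub>v x)) \<bullet>c (?G *\<^sub>v vCons 0 y))"
      using x y Zc Uc by (simp add: mult_mat_vec[of _ ?N ?N] U0 conjugate_smult_vec)
    also have "(?G *\<^sub>v vCons 0 (Z *\<^sub>v x)) \<bullet>c (?G *\<^sub>v vCons 0 y) = (Z *\<^sub>v x) \<bullet>c y"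
      using x y Zc by (subst unitary_cscalar_prod[OF G]) auto
    finally have 1: "(?U *\<^sub>v (of_real r \<cdot>\<^sub>v vCons 0 x)) \<bullet>c (of_real r \<cdot>\<^sub>v (?G *\<^sub>v vCons 0 y)) = of_real r * of_real r * ((Z *\<^sub>v x) \<bullet>c y)" .
    have 2: "(of_real r \<cdot>\<^sub>v vCons 0 x) \<bullet>c (of_real r \<cdot>\<^sub>v vCons 0 x) = of_real r * of_real r * (x \<bullet>c x)"
      using x by (simp add: conjugate_smult_vec)
    show ?thesis unfolding krylov_coeff_def fst_conv snd_conv 1 2 using r by simp
  qed
  have kr: "krylov ?U (Suc k) = (of_real r \<cdot>\<^sub>v vCons 0 (fst (krylov Z k)), of_real r \<cdot>\<^sub>v (?G *\<^sub>v vCons 0 (snd (krylov Z k))))" for k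
  proof (induction k)
    case 0
    have d: "dim_row ?U = ?N" by simp
    have z: "krylov Z 0 = (unit_vec m 0, unit_vec m 0)" using Zc by simp
    have s: "krylov_coeff ?U (krylov ?U 0) = cnj a" using a0 by (simp add: krylov_alpha_def)
    have k0: "krylov ?U 0 = (unit_vec ?N 0, unit_vec ?N 0)" by simp
    have "vCons a (of_real r \<cdot>\<^sub>v unit_vec m 0) - a \<cdot>\<^sub>v vCons 1 (0\<^sub>v m) = of_real r \<cdot>\<^sub>v vCons 0 (unit_vec m 0)"
      by (rule eq_vecI) (auto simp: vec_index_vCons)
    \<comment> \<open>Here r^2 = 1 - a cnj a turns the reversed vector after one step into r G (0
      \<oplus> e_0).\<close>
    moreover have "vCons 1 (0\<^sub>v m) - cnj a \<cdot>\<^sub>v vCons a (of_real r \<cdot>\<^sub>v unit_vec m 0) = of_real r \<cdot>\<^sub>v vCons (of_real r) (- cnj a \<cdot>\<^sub>v unit_vec m 0)"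
      by (rule eq_vecI) (auto simp: vec_index_vCons rr algebra_simps)
    ultimately show ?case
      unfolding krylov.simps(2) s unfolding k0 fst_conv snd_conv z Ge1 Ue0 Ge by (simp add: e0)
  next
    case (Suc k)
    let ?x = "fst (krylov Z k)" and ?y = "snd (krylov Z k)" and ?a = "krylov_coeff Z (krylov Z k)"
    note x = c(1)[of k] and y = c(2)[of k]
    have s: "krylov_coeff ?U (krylov ?U (Suc k)) = ?a"
      unfolding Suc using coeff[OF x y] by simp
    have v: "vCons 0 (Z *\<^sub>v ?x) - b \<cdot>\<^sub>v vCons 0 ?y = vCons 0 (Z *\<^sub>v ?x - b \<cdot>\<^sub>v ?y)"
       "vCons 0 ?y - b \<cdot>\<^sub>v vCons 0 (Z *\<^sub>v ?x) = vCons 0 (?y - b \<cdot>\<^sub>v (Z *\<^sub>v ?x))" for b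
      using x y Zc by (auto simp: vec_index_vCons intro!: eq_vecI)
    have dist: "of_real r \<cdot>\<^sub>v (?G *\<^sub>v u) - b \<cdot>\<^sub>v (of_real r \<cdot>\<^sub>v (?G *\<^sub>v w)) = of_real r \<cdot>\<^sub>v (?G *\<^sub>v (u - b \<cdot>\<^sub>v w))"
      if "u \<in> carrier_vec ?N" "w \<in> carrier_vec ?N" for u w b
    proof -
      have "?G *\<^sub>v (u - b \<cdot>\<^sub>v w) = ?G *\<^sub>v u - b \<cdot>\<^sub>v (?G *\<^sub>v w)"
        using that by (simp add: mult_minus_distrib_mat_vec[of _ ?N ?N] mult_mat_vec[of _ ?N ?N])
      then show ?thesis by (auto simp: algebra_simps intro!: eq_vecI)
    qed
    have Ux: "?U *\<^sub>v (of_real r \<cdot>\<^sub>v vCons 0 ?x) = of_real r \<cdot>\<^sub>v (?G *\<^sub>v vCons 0 (Z *\<^sub>v ?x))"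
      using x Uc by (simp add: mult_mat_vec[of _ ?N ?N] U0)
    have nx: "fst (krylov Z (Suc k)) = Z *\<^sub>v ?x - cnj ?a \<cdot>\<^sub>v ?y" "snd (krylov Z (Suc k)) = ?y - ?a \<cdot>\<^sub>v (Z *\<^sub>v ?x)"
      by simp_all
    have "fst (krylov ?U (Suc (Suc k))) = of_real r \<cdot>\<^sub>v (?G *\<^sub>v vCons 0 (fst (krylov Z (Suc k))))"
      unfolding krylov.simps(2)[of ?U "Suc k"] s unfolding Suc fst_conv snd_conv Ux nx
      using x y Zc by (subst dist) (auto simp: v)
    also have "?G *\<^sub>v vCons 0 (fst (krylov Z (Suc k))) = vCons 0 (fst (krylov Z (Suc k)))"
      using orth[of "Suc k"] c(1)[of "Suc k"] by (intro Gfix) auto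
    finally have f: "fst (krylov ?U (Suc (Suc k))) = of_real r \<cdot>\<^sub>v vCons 0 (fst (krylov Z (Suc k)))" .
    have "snd (krylov ?U (Suc (Suc k))) = of_real r \<cdot>\<^sub>v (?G *\<^sub>v vCons 0 (snd (krylov Z (Suc k))))"
      unfolding krylov.simps(2)[of ?U "Suc k"] s unfolding Suc fst_conv snd_conv Ux nx
      using x y Zc by (subst dist) (auto simp: v)
    with f show ?case by (simp only: prod_eq_iff fst_conv snd_conv)
  qed
  show "krylov_alpha ?U (Suc k) = krylov_alpha Z k"
    unfolding krylov_alpha_def kr using coeff[OF c[of k]] by simp
qed

text \<open>K is chosen so that 1 \<oplus> K carries (a, r, 0, ..., 0), the first column of G, to
  the first column of U. Then the adjoint of G times the conjugated U fixes e_0 and splits as 1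
  \<oplus> Z. The bound on the corner entry makes r positive, so that the rest of the column can be
  normalized.\<close>

lemma unitary_corner_givens_factorization:
  assumes U: "U \<in> unitary_group (Suc m)" and m: "0 < m" and a: "cmod (U $$ (0, 0)) < 1"
  shows "\<exists>K\<in>unitary_group m. \<exists>Z\<in>unitary_group m. \<exists>r>0. (cmod (U $$ (0, 0)))\<^sup>2 + r\<^sup>2 = 1 \<and>
    U * mat_corner 1 K = mat_corner 1 K * (givens (Suc m) (Suc 0) (U $$ (0, 0)) (of_real r) * mat_corner 1 Z)"
proof -
  let ?N = "Suc m" and ?a = "U $$ (0, 0)"
  have Uc: "U \<in> carrier_mat ?N ?N" using U by (rule unitary_group_carrier)
  define r where "r = sqrt (1 - (cmod ?a)\<^sup>2)"
  have "(cmod ?a)\<^sup>2 < 1" using a by (simp add: abs_square_less_1)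
  then have r: "0 < r" "(cmod ?a)\<^sup>2 + r\<^sup>2 = 1" by (auto simp: r_def)
  define v where "v = vec m (\<lambda>i. U $$ (Suc i, 0) / of_real r)"
  have "(\<Sum>k<?N. (cmod (U $$ (k, 0)))\<^sup>2) = 1" using unitary_col_norm[OF U] by simp
  then have rs: "(\<Sum>k<m. (cmod (U $$ (Suc k, 0)))\<^sup>2) = r\<^sup>2"
    unfolding sum.lessThan_Suc_shift using r(2) by simp
  have "(\<Sum>i<m. (cmod (v $ i))\<^sup>2) = (\<Sum>k<m. (cmod (U $$ (Suc k, 0)))\<^sup>2 / r\<^sup>2)"
    using r by (intro sum.cong) (auto simp: v_def norm_divide power_divide)
  also have "\<dots> = 1" using r by (simp add: sum_divide_distrib[symmetric] rs)
  finally obtain K where K: "K \<in> unitary_group m" "\<And>i. i < m \<Longrightarrow> K $$ (i, 0) = v $ i"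
    using exists_unitary_col_0[of v m] by (auto simp: v_def)
  let ?K = "mat_corner 1 K" and ?G = "givens ?N (Suc 0) ?a (of_real r)"
  have Kc: "K \<in> carrier_mat m m" using K(1) by (rule unitary_group_carrier)
  have K': "?K \<in> unitary_group ?N" using mat_corner_unitary[OF _ K(1)] by simp
  have G: "?G \<in> unitary_group ?N" using m r(2) by (intro givens_unitary) auto
  have cs: "?K \<in> carrier_mat ?N ?N" "mat_adjoint ?K \<in> carrier_mat ?N ?N" "?G \<in> carrier_mat ?N ?N" "mat_adjoint ?G \<in> carrier_mat ?N ?N"
    using Kc by auto
  define W where "W = mat_adjoint ?G * (mat_adjoint ?K * (U * ?K))"
  have W: "W \<in> unitary_group ?N"
    unfolding W_def by (intro unitary_group_mult unitary_group_adjoint G K' U)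
  have Wc: "W \<in> carrier_mat ?N ?N" using W by (rule unitary_group_carrier)
  have e0: "unit_vec ?N 0 = vCons 1 (0\<^sub>v m)"
    by (rule eq_vecI) (auto simp: vec_index_vCons)
  have Ke: "?K *\<^sub>v unit_vec ?N 0 = unit_vec ?N 0"
    unfolding e0 using Kc by (simp add: mat_corner_mult_vec[of _ m m])
  have Ge: "?G *\<^sub>v unit_vec ?N 0 = vCons ?a (of_real r \<cdot>\<^sub>v unit_vec m 0)"
    using m by (subst mult_mat_unit_vec[of _ ?N ?N]) (auto simp: givens_def vec_index_vCons intro!: eq_vecI)
  have "?K *\<^sub>v (?G *\<^sub>v unit_vec ?N 0) = vCons ?a (of_real r \<cdot>\<^sub>v (K *\<^sub>v unit_vec m 0))"
    unfolding Ge using Kc by (simp add: mat_corner_mult_vec[of _ m m] mult_mat_vec[of _ m m])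
  also have "of_real r \<cdot>\<^sub>v (K *\<^sub>v unit_vec m 0) = vec m (\<lambda>i. U $$ (Suc i, 0))"
    using Kc m K(2) r by (subst mult_mat_unit_vec[of _ m m]) (auto simp: v_def intro!: eq_vecI)
  also have "vCons ?a (vec m (\<lambda>i. U $$ (Suc i, 0))) = U *\<^sub>v unit_vec ?N 0"
    using Uc by (subst mult_mat_unit_vec[of _ ?N ?N]) (auto simp: vec_index_vCons intro!: eq_vecI)
  finally have KG: "U *\<^sub>v unit_vec ?N 0 = ?K *\<^sub>v (?G *\<^sub>v unit_vec ?N 0)" ..
  have cancel: "mat_adjoint A *\<^sub>v (A *\<^sub>v x) = x" if "A \<in> unitary_group ?N" "x \<in> carrier_vec ?N" for A x
    using that unitary_group_carrier[OF that(1)]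
    by (subst assoc_mult_mat_vec[symmetric, of _ ?N ?N _ ?N]) (auto simp: unitary_group_adjoint_left)
  have "W *\<^sub>v unit_vec ?N 0 = mat_adjoint ?G *\<^sub>v (mat_adjoint ?K *\<^sub>v (U *\<^sub>v (?K *\<^sub>v unit_vec ?N 0)))"
    unfolding W_def using cs Uc by (simp add: assoc_mult_mat_vec[of _ ?N ?N _ ?N] mult_carrier_mat[of _ ?N ?N _ ?N])
  also have "\<dots> = unit_vec ?N 0"
    unfolding Ke KG using cs by (simp add: cancel[OF K'] cancel[OF G] mult_mat_vec_carrier[of _ ?N ?N])
  finally have colW: "col W 0 = unit_vec ?N 0" using Wc by (simp add: mult_mat_unit_vec[of _ ?N ?N])
  have We: "W $$ (i, 0) = (if i = 0 then 1 else 0)" if "i < ?N" for i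
  proof -
    have "W $$ (i, 0) = col W 0 $ i" using that Wc by simp
    then show ?thesis unfolding colW using that by simp
  qed
  obtain Z where Z: "Z \<in> unitary_group m" "W = mat_corner 1 Z"
    using unitary_corner_cases[OF W] We by auto
  have "?G * W = (?G * mat_adjoint ?G) * (mat_adjoint ?K * (U * ?K))"
    unfolding W_def using cs Uc by (simp add: assoc_mult_mat[of _ ?N ?N _ ?N _ ?N] mult_carrier_mat[of _ ?N ?N _ ?N])
  also have "\<dots> = mat_adjoint ?K * (U * ?K)"
    using cs Uc by (simp add: unitary_group_adjoint_right[OF G] mult_carrier_mat[of _ ?N ?N _ ?N])
  finally have "?K * (?G * W) = (?K * mat_adjoint ?K) * (U * ?K)"
    using cs Uc by (simp add: assoc_mult_mat[of _ ?N ?N _ ?N _ ?N] mult_carrier_mat[of _ ?N ?N _ ?N])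
  then have "U * ?K = ?K * (?G * mat_corner 1 Z)"
    using cs Uc by (simp add: unitary_group_adjoint_right[OF K'] mult_carrier_mat[of _ ?N ?N _ ?N] Z(2))
  then show ?thesis using K(1) Z(1) r by blast
qed

section \<open>Orthogonal polynomials of finitely supported measures\<close>

text \<open>Weights may vanish and points may coincide, so that the locale covers the eigenvalue
  data of every unitary matrix. Hence the support is a set of values of l, and its cardinality may
  be below n.\<close>

locale circle_weights =
  fixes n :: nat and w :: "nat \<Rightarrow> real" and l :: "nat \<Rightarrow> complex"
  assumes w_nonneg: "\<And>i. 0 \<le> w i" and w_sum: "(\<Sum>i<n. w i) = 1"
    and l_circle: "\<And>i. i < n \<Longrightarrow> cmod (l i) = 1"
begin

definition sp :: "complex poly \<Rightarrow> complex poly \<Rightarrow> complex" where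
  "sp p q = (\<Sum>i<n. of_real (w i) * poly p (l i) * cnj (poly q (l i)))"

definition supp :: "complex set" where
  "supp = l ` {i. i < n \<and> 0 < w i}"

lemma finite_supp: "finite supp"
  by (simp add: supp_def)

lemma supp_nonempty: "supp \<noteq> {}"
proof
  assume "supp = {}"
  then have "w i = 0" if "i < n" for i using that w_nonneg[of i] by (force simp: supp_def)
  then show False using w_sum by simp
qed

lemma l_cnj: "i < n \<Longrightarrow> l i * cnj (l i) = 1"
  using l_circle[of i] by (simp add: complex_norm_square[symmetric])

lemma sp_diff_left: "sp (p - p') q = sp p q - sp p' q"
  by (simp add: sp_def sum_subtractf algebra_simps)
lemma sp_smult_left: "sp (Polynomial.smult c p) q = c * sp p q"
  by (simp add: sp_def sum_distrib_left algebra_simps)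
lemma sp_cnj: "cnj (sp p q) = sp q p"
  by (simp add: sp_def algebra_simps)
lemma sp_add_right: "sp q (p + p') = sp q p + sp q p'"
  by (simp add: sp_def sum.distrib algebra_simps)
lemma sp_diff_right: "sp q (p - p') = sp q p - sp q p'"
  by (simp add: sp_def sum_subtractf algebra_simps)
lemma sp_smult_right: "sp q (Polynomial.smult c p) = cnj c * sp q p"
  by (simp add: sp_def sum_distrib_left algebra_simps)
lemma sp_0_right [simp]: "sp p 0 = 0"
  by (simp add: sp_def)

lemma sp_shift: "sp (pCons 0 p) (pCons 0 q) = sp p q"
  unfolding sp_def
proof (rule sum.cong)
  fix i assume "i \<in> {..<n}"
  then have "l i * cnj (l i) = 1" by (simp add: l_cnj)
  then have "of_real (w i) * (l i * cnj (l i)) * (poly p (l i) * cnj (poly q (l i))) = of_real (w i) * poly p (l i) * cnj (poly q (l i))"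
    by simp
  then show "of_real (w i) * poly (pCons 0 p) (l i) * cnj (poly (pCons 0 q) (l i)) = of_real (w i) * poly p (l i) * cnj (poly q (l i))"
    by (simp add: ac_simps)
qed simp

lemma sp_self: "sp p p = of_real (\<Sum>i<n. w i * (cmod (poly p (l i)))\<^sup>2)"
proof -
  have "of_real (\<Sum>i<n. w i * (cmod (poly p (l i)))\<^sup>2) = (\<Sum>i<n. of_real (w i) * (poly p (l i) * cnj (poly p (l i))))"
    by (simp only: of_real_sum of_real_mult complex_norm_square)
  then show ?thesis by (simp add: sp_def mult.assoc)
qed

lemma sp_eq_0_on_supp:
  "(\<And>z. z \<in> supp \<Longrightarrow> poly p z = 0 \<or> poly q z = 0) \<Longrightarrow> sp p q = 0"
  unfolding sp_def
proof (intro sum.neutral ballI)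
  fix i assume *: "\<And>z. z \<in> supp \<Longrightarrow> poly p z = 0 \<or> poly q z = 0" and "i \<in> {..<n}"
  then have "w i = 0 \<or> l i \<in> supp" using w_nonneg[of i] by (force simp: supp_def)
  then show "of_real (w i) * poly p (l i) * cnj (poly q (l i)) = 0" using *[of "l i"] by auto
qed

lemma sp_self_eq_0_iff: "sp p p = 0 \<longleftrightarrow> (\<forall>z\<in>supp. poly p z = 0)"
proof
  assume "sp p p = 0"
  then have "(\<Sum>i<n. w i * (cmod (poly p (l i)))\<^sup>2) = 0" unfolding sp_self of_real_eq_0_iff .
  then have "\<forall>i\<in>{..<n}. w i * (cmod (poly p (l i)))\<^sup>2 = 0"
    by (subst (asm) sum_nonneg_eq_0_iff) (auto simp: w_nonneg)
  then have "poly p (l i) = 0" if "i < n" "0 < w i" for i using that by force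
  then show "\<forall>z\<in>supp. poly p z = 0" by (auto simp: supp_def)
qed (auto intro: sp_eq_0_on_supp)

lemma poly_eq_0_if_vanishes_on_supp:
  assumes "\<And>z. z \<in> supp \<Longrightarrow> poly p z = 0" "degree p < card supp"
  shows "p = 0"
proof (rule ccontr)
  assume p: "p \<noteq> 0"
  then have "card {x. poly p x = 0} \<le> degree p" by (rule card_poly_roots_bound)
  moreover have "card supp \<le> card {x. poly p x = 0}"
    using assms(1) p by (intro card_mono poly_roots_finite) auto
  ultimately show False using assms(2) by simp
qed

lemma poly_reversed_at: "i < n \<Longrightarrow> poly (reversed_poly p) (l i) = l i ^ degree p * cnj (poly p (l i))"
proof -
  assume i: "i < n"
  then have nz: "l i \<noteq> 0" using l_circle[of i] by auto
  have "1 / cnj (l i) = l i" using l_cnj[OF i] nz by (simp add: field_simps)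
  then show ?thesis using poly_reversed_poly[OF nz, of p] by simp
qed

text \<open>The next polynomial z p - cnj \<alpha> p', with p' the reversal of p, has to be
  orthogonal to p', and p' has the same norm as p. Solving for \<alpha> gives this quotient.\<close>

definition coeff_alpha :: "complex poly \<Rightarrow> complex" where
  "coeff_alpha p = cnj (sp (pCons 0 p) (reversed_poly p) / sp p p)"

text \<open>The recursion serves as the construction, in place of a Gram-Schmidt process;
  orthogonality is derived from it in \<open>phi_orthogonal\<close>.\<close>

primrec phi :: "nat \<Rightarrow> complex poly" where
  "phi 0 = 1"
| "phi (Suc k) = pCons 0 (phi k) - Polynomial.smult (cnj (coeff_alpha (phi k))) (reversed_poly (phi k))"

definition alpha :: "nat \<Rightarrow> complex" where "alpha k = coeff_alpha (phi k)"

lemma phi_Suc: "phi (Suc k) = pCons 0 (phi k) - Polynomial.smult (cnj (alpha k)) (reversed_poly (phi k))"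
  by (simp add: alpha_def)

lemma degree_reversed_poly_le: "degree (reversed_poly p) \<le> degree p"
  unfolding reversed_poly_def by (rule order_trans[OF degree_reflect_poly_le]) (rule degree_map_poly_le)

lemma degree_phi: "degree (phi k) = k" and lead_coeff_phi: "coeff (phi k) k = 1"
proof -
  have "degree (phi k) = k \<and> coeff (phi k) k = 1"
  proof (induction k)
    case (Suc k)
    have "degree (reversed_poly (phi k)) < Suc k" using degree_reversed_poly_le[of "phi k"] Suc by simp
    then have "coeff (phi (Suc k)) (Suc k) = 1"
      using Suc by (simp add: coeff_eq_0)
    moreover have "degree (phi (Suc k)) \<le> Suc k"
      unfolding phi_Suc using \<open>degree (reversed_poly (phi k)) < Suc k\<close> Suc
      by (intro degree_diff_le) (auto intro: order_trans[OF degree_pCons_le] order_trans[OF degree_smult_le])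
    moreover have "Suc k \<le> degree (phi (Suc k))"
      using \<open>coeff (phi (Suc k)) (Suc k) = 1\<close> by (intro le_degree) simp
    ultimately show ?case by (metis order_antisym)
  qed simp
  then show "degree (phi k) = k" "coeff (phi k) k = 1" by auto
qed

text \<open>Monicity becomes the constant term 1 after reversal. In particular the reversed
  polynomial is nonzero, which makes the coefficient in the Szego recursion unique.\<close>

lemma reversed_phi: "\<exists>r. reversed_poly (phi k) = pCons 1 r \<and> (r = 0 \<or> degree r < k)"
proof -
  have "coeff (map_poly cnj (phi k)) k = 1" by (simp add: coeff_map_poly lead_coeff_phi)
  moreover have "degree (map_poly cnj (phi k)) = k" 
    using lead_coeff_phi[of k] by (subst degree_map_poly) (auto simp: degree_phi)
  ultimately have "coeff (reversed_poly (phi k)) 0 = 1" by (simp add: reversed_poly_def)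
  then obtain r where r: "reversed_poly (phi k) = pCons 1 r" by (metis coeff_pCons_0 pCons_cases)
  moreover have "r \<noteq> 0 \<Longrightarrow> degree r < k"
    using degree_reversed_poly_le[of "phi k"] unfolding r by (simp add: degree_phi)
  ultimately show ?thesis by blast
qed

lemma sp_reversed_self: "sp (reversed_poly p) (reversed_poly p) = sp p p"
  unfolding sp_self
  by (intro arg_cong[of _ _ of_real] sum.cong) (auto simp: poly_reversed_at norm_mult norm_power l_circle)

text \<open>The defining equation of \<alpha> survives the division by zero: if \<open>phi k\<close>
  has norm 0, it vanishes on the support, so the right-hand side is 0 too.\<close>

lemma alpha_sp: "cnj (alpha k) * sp (phi k) (phi k) = sp (pCons 0 (phi k)) (reversed_poly (phi k))"
proof (cases "sp (phi k) (phi k) = 0")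
  case True
  then have "\<And>z. z \<in> supp \<Longrightarrow> poly (phi k) z = 0" unfolding sp_self_eq_0_iff by auto
  then show ?thesis using True by (simp add: sp_eq_0_on_supp)
qed (simp add: alpha_def coeff_alpha_def)

text \<open>On the circle, reversing a polynomial of degree k means multiplying its conjugate value
  by z^k. Conjugating the recursion of \<open>phi\<close> therefore yields the companion recursion,
  and values on the circle are all that \<open>sp\<close> sees.\<close>

lemma reversed_phi_Suc_at:
  assumes i: "i < n"
  shows "poly (reversed_poly (phi (Suc k))) (l i) =
    poly (reversed_poly (phi k)) (l i) - alpha k * poly (pCons 0 (phi k)) (l i)"
proof -
  have lk: "l i ^ k * cnj (l i) ^ k = 1" for k using l_cnj[OF i] by (simp add: power_mult_distrib[symmetric])
  have "poly (reversed_poly (phi (Suc k))) (l i) = l i ^ Suc k * (cnj (l i) * cnj (poly (phi k) (l i))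
      - alpha k * (cnj (l i) ^ k * poly (phi k) (l i)))"
    using i by (simp only: poly_reversed_at degree_phi) (simp add: phi_Suc poly_reversed_at degree_phi del: phi.simps)
  also have "\<dots> = (l i * cnj (l i)) * (l i ^ k * cnj (poly (phi k) (l i))) - alpha k * l i * (l i ^ k * cnj (l i) ^ k) * poly (phi k) (l i)"
    by (simp add: algebra_simps)
  finally show ?thesis using i by (simp add: l_cnj lk poly_reversed_at degree_phi)
qed

lemma sp_reversed_phi_Suc: "sp (reversed_poly (phi (Suc k))) q =
  sp (reversed_poly (phi k)) q - alpha k * sp (pCons 0 (phi k)) q"
proof -
  have "sp (reversed_poly (phi (Suc k))) q = sp (reversed_poly (phi k) - Polynomial.smult (alpha k) (pCons 0 (phi k))) q"
    unfolding sp_def by (intro sum.cong) (auto simp: reversed_phi_Suc_at simp del: phi.simps)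
  then show ?thesis by (simp only: sp_diff_left sp_smult_left)
qed

text \<open>Both relations are carried through one induction. The step from k to k + 1 adds one
  direction to each: the constant 1 for \<Phi>_(k+1), and z \<Phi>_k for its reversal; the choice of
  \<alpha>_k annihilates both. The disjunct q = 0 covers zero remainders at k = 0, where no degree
  is below k.\<close>

lemma phi_orthogonal:
  "(q = 0 \<or> degree q < k \<longrightarrow> sp (phi k) q = 0) \<and>
   (q = 0 \<or> degree q < k \<longrightarrow> sp (reversed_poly (phi k)) (pCons 0 q) = 0)"
proof (induction k arbitrary: q)
  case (Suc k)
  let ?p = "phi k" and ?s = "reversed_poly (phi k)"
  have o1: "sp ?p q = 0" and o2: "sp ?s (pCons 0 q) = 0" if "q = 0 \<or> degree q < k" for q
    using Suc that by auto
  obtain r where r: "?s = pCons 1 r" "r = 0 \<or> degree r < k" using reversed_phi[of k] by blast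
  have s_split: "?s = 1 + pCons 0 r" unfolding r(1) by (simp add: one_pCons)
  have "sp ?s ?s = sp ?s 1 + sp ?s (pCons 0 r)" by (subst (2) s_split) (rule sp_add_right)
  then have s1: "sp ?s 1 = sp ?p ?p" using o2[OF r(2)] by (simp add: sp_reversed_self)
  have "sp (pCons 0 ?p) ?s = sp (pCons 0 ?p) 1 + sp (pCons 0 ?p) (pCons 0 r)"
    by (subst s_split) (rule sp_add_right)
  then have p1: "sp (pCons 0 ?p) 1 = cnj (alpha k) * sp ?p ?p"
    using o1[OF r(2)] by (simp add: sp_shift alpha_sp)
  show ?case
  proof (intro conjI impI)
    assume q: "q = 0 \<or> degree q < Suc k"
    \<comment> \<open>Splitting off the constant term leaves z q', where \<open>sp_shift\<close> and
      both induction hypotheses apply.\<close>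
    obtain c q' where q': "q = pCons c q'" by (cases q)
    have "q' = 0 \<or> degree q' < k" using q unfolding q' by (auto split: if_splits)
    then have z: "sp (phi (Suc k)) (pCons 0 q') = 0"
      unfolding phi_Suc sp_diff_left sp_smult_left sp_shift using o1 o2 by simp
    have "q = Polynomial.smult c 1 + pCons 0 q'" unfolding q' by (simp add: one_pCons)
    then have "sp (phi (Suc k)) q = cnj c * sp (phi (Suc k)) 1"
      using z by (simp only: sp_add_right sp_smult_right add_0_right)
    also have "sp (phi (Suc k)) 1 = 0"
      unfolding phi_Suc sp_diff_left sp_smult_left p1 s1 by simp
    finally show "sp (phi (Suc k)) q = 0" by simp
  next
    assume q: "q = 0 \<or> degree q < Suc k"
    \<comment> \<open>Splitting off the leading term along \<open>phi k\<close> makes z \<Phi>_k the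
      only new direction.\<close>
    define q' where "q' = q - Polynomial.smult (coeff q k) ?p"
    have q': "q' = 0 \<or> degree q' < k"
    proof -
      have "degree q' \<le> k" unfolding q'_def using q
        by (intro degree_diff_le) (auto simp: degree_phi intro: order_trans[OF degree_smult_le])
      moreover have "coeff q' k = 0" by (simp add: q'_def lead_coeff_phi)
      ultimately show ?thesis by (metis leading_coeff_0_iff le_neq_implies_less)
    qed
    have "pCons 0 q = Polynomial.smult (coeff q k) (pCons 0 ?p) + pCons 0 q'" by (simp add: q'_def)
    then have "sp (reversed_poly (phi (Suc k))) (pCons 0 q) =
      cnj (coeff q k) * sp (reversed_poly (phi (Suc k))) (pCons 0 ?p) + sp (reversed_poly (phi (Suc k))) (pCons 0 q')"
      by (simp only: sp_add_right sp_smult_right)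
    also have "sp (reversed_poly (phi (Suc k))) (pCons 0 q') = 0"
      unfolding sp_reversed_phi_Suc sp_shift using o1[OF q'] o2[OF q'] by simp
    also have "sp (reversed_poly (phi (Suc k))) (pCons 0 ?p) = 0"
    proof -
      have "sp ?s (pCons 0 ?p) = cnj (cnj (alpha k) * sp ?p ?p)" unfolding alpha_sp sp_cnj ..
      also have "\<dots> = alpha k * sp ?p ?p" by (simp only: complex_cnj_mult complex_cnj_cnj sp_cnj)
      finally show ?thesis unfolding sp_reversed_phi_Suc sp_shift by simp
    qed
    finally show "sp (reversed_poly (phi (Suc k))) (pCons 0 q) = 0" by simp
  qed
qed simp

lemma sp_phi_Suc_self: "sp (phi (Suc k)) (phi (Suc k)) = sp (phi k) (phi k) * of_real (1 - (cmod (alpha k))\<^sup>2)"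
proof -
  let ?p = "phi k" and ?s = "reversed_poly (phi k)"
  have 1: "sp (pCons 0 ?p) ?s = cnj (alpha k) * sp ?p ?p" by (simp only: alpha_sp)
  have "sp ?s (pCons 0 ?p) = cnj (cnj (alpha k) * sp ?p ?p)" unfolding alpha_sp sp_cnj ..
  then have 2: "sp ?s (pCons 0 ?p) = alpha k * sp ?p ?p" by (simp only: complex_cnj_mult complex_cnj_cnj sp_cnj)
  have "sp (phi (Suc k)) (phi (Suc k)) = sp ?p ?p * (1 - alpha k * cnj (alpha k))"
    unfolding phi_Suc sp_diff_left sp_diff_right sp_smult_left sp_smult_right sp_shift 1 2 sp_reversed_self
    by (simp add: algebra_simps)
  then show ?thesis by (simp only: of_real_diff complex_norm_square of_real_1)
qed

text \<open>A nonzero polynomial of degree k cannot vanish on more than k points. Conversely, for a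
  support of N points, \<Phi>_N differs by lower degree from the product of the factors z - s, which
  vanishes on the support; hence \<Phi>_N is orthogonal to itself. Afterwards the norms stay
  0.\<close>

lemma sp_phi_self_eq_0_iff: "sp (phi k) (phi k) = 0 \<longleftrightarrow> card supp \<le> k"
proof
  assume "sp (phi k) (phi k) = 0"
  then have v: "\<And>z. z \<in> supp \<Longrightarrow> poly (phi k) z = 0" unfolding sp_self_eq_0_iff by auto
  show "card supp \<le> k"
  proof (rule ccontr)
    assume "\<not> card supp \<le> k"
    then have "phi k = 0" using v by (intro poly_eq_0_if_vanishes_on_supp) (auto simp: degree_phi)
    then show False using lead_coeff_phi[of k] by simp
  qed
next
  assume le: "card supp \<le> k"
  let ?N = "card supp"
  let ?P = "\<Prod>s\<in>supp. [:- s, 1:]"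
  have degP: "degree ?P = ?N" by (subst degree_prod_eq_sum_degree) auto
  have leadP: "coeff ?P ?N = 1" using lead_coeff_prod[of "\<lambda>s. [:- s, 1:]" supp] degP by simp
  have P0: "poly ?P z = 0" if "z \<in> supp" for z
    using that finite_supp by (auto simp: poly_prod)
  have "phi ?N - ?P = 0 \<or> degree (phi ?N - ?P) < ?N"
  proof -
    have "degree (phi ?N - ?P) \<le> ?N" using degP by (intro degree_diff_le) (auto simp: degree_phi)
    moreover have "coeff (phi ?N - ?P) ?N = 0" by (simp add: lead_coeff_phi leadP)
    ultimately show ?thesis by (metis leading_coeff_0_iff le_neq_implies_less)
  qed
  then have "sp (phi ?N) (phi ?N - ?P) = 0" using phi_orthogonal by blast
  moreover have "sp (phi ?N) ?P = 0" using P0 by (intro sp_eq_0_on_supp) auto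
  ultimately have N: "sp (phi ?N) (phi ?N) = 0" by (simp add: sp_diff_right)
  show "sp (phi k) (phi k) = 0"
    using le by (induction k rule: dec_induct) (simp_all add: N sp_phi_Suc_self del: phi.simps)
qed

text \<open>By \<open>sp_phi_Suc_self\<close>, the number 1 - |\<alpha>_k|^2 is the ratio of
  consecutive squared norms, positive before the last index and 0 at it. Past the support the
  default value of division gives the padding 0.\<close>

lemma alpha_norm: "Suc k < card supp \<Longrightarrow> cmod (alpha k) < 1" "Suc k = card supp \<Longrightarrow> cmod (alpha k) = 1"
  "card supp \<le> k \<Longrightarrow> alpha k = 0"
proof -
  have pos: "\<exists>x. 0 < x \<and> sp (phi k) (phi k) = of_real x" if "k < card supp" for k
  proof -
    have "sp (phi k) (phi k) \<noteq> 0" using sp_phi_self_eq_0_iff[of k] that by simp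
    moreover have "0 \<le> (\<Sum>i<n. w i * (cmod (poly (phi k) (l i)))\<^sup>2)" by (intro sum_nonneg) (simp add: w_nonneg)
    ultimately show ?thesis unfolding sp_self by (metis less_eq_real_def of_real_0)
  qed
  show "cmod (alpha k) < 1" if "Suc k < card supp"
  proof -
    obtain x where "0 < x" "sp (phi k) (phi k) = of_real x" using pos[of k] \<open>Suc k < card supp\<close> by auto
    moreover obtain y where "0 < y" "sp (phi (Suc k)) (phi (Suc k)) = of_real y" using pos[of "Suc k"] \<open>Suc k < card supp\<close> by blast
    ultimately
    have "y = x * (1 - (cmod (alpha k))\<^sup>2)"
      using sp_phi_Suc_self[of k] by (metis of_real_eq_iff of_real_mult)
    then have "(cmod (alpha k))\<^sup>2 < 1" using \<open>0 < x\<close> \<open>0 < y\<close> by (metis diff_gt_0_iff_gt zero_less_mult_pos)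
    then show ?thesis by (simp add: abs_square_less_1)
  qed
  show "cmod (alpha k) = 1" if "Suc k = card supp"
  proof -
    have "sp (phi (Suc k)) (phi (Suc k)) = 0" "sp (phi k) (phi k) \<noteq> 0"
      using sp_phi_self_eq_0_iff[of "Suc k"] sp_phi_self_eq_0_iff[of k] that by auto
    then have "complex_of_real (1 - (cmod (alpha k))\<^sup>2) = 0" using sp_phi_Suc_self[of k] by (metis mult_eq_0_iff)
    then have "(cmod (alpha k))\<^sup>2 = 1" unfolding of_real_eq_0_iff by simp
    then show ?thesis using norm_ge_zero[of "alpha k"] by (auto simp: power2_eq_1_iff simp del: norm_ge_zero)
  qed
  show "alpha k = 0" if "card supp \<le> k"
    using that sp_phi_self_eq_0_iff[of k] by (simp add: alpha_def coeff_alpha_def)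
qed

lemma verblunsky_in_Y: "(enat (card supp), alpha) \<in> Y"
proof -
  have "1 \<le> card supp" using finite_supp supp_nonempty by (simp add: Suc_le_eq card_gt_0_iff)
  then show ?thesis
    unfolding Y_def using alpha_norm by (auto simp: one_enat_def Suc_le_eq le_neq_implies_less)
qed

end

section \<open>Spectral measures\<close>

lemma space_circle_borel [simp]: "space circle_borel = sphere 0 1"
  by (simp add: circle_borel_def space_restrict_space)

lemma borel_measurable_circleI: "f \<in> borel_measurable borel \<Longrightarrow> f \<in> borel_measurable circle_borel"
  unfolding circle_borel_def by (rule measurable_restrict_space1)

lemma borel_measurable_poly [measurable]: "(\<lambda>z::complex. poly p z) \<in> borel_measurable borel"
  by (intro borel_measurable_continuous_onI continuous_intros)

lemma borel_measurable_cnj [measurable (raw)]: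
  "f \<in> borel_measurable M \<Longrightarrow> (\<lambda>x. cnj (f x)) \<in> borel_measurable M"
  by (rule borel_measurable_continuous_on[where f = cnj]) (auto intro: continuous_intros)

lemma borel_measurable_power_int [measurable]: "(\<lambda>z::complex. z powi k) \<in> borel_measurable borel"
  by (cases "0 \<le> k") (simp_all add: power_int_def)

lemma circle_integrable:
  fixes f :: "complex \<Rightarrow> complex"
  assumes "prob_space \<nu>" "sets \<nu> = sets circle_borel" "f \<in> borel_measurable borel"
    "\<And>z. z \<in> sphere 0 1 \<Longrightarrow> cmod (f z) \<le> B"
  shows "integrable \<nu> f"
proof -
  interpret prob_space \<nu> by fact
  have "space \<nu> = sphere 0 1" using sets_eq_imp_space_eq[OF assms(2)] by simp
  moreover have "f \<in> borel_measurable \<nu>"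
    unfolding measurable_cong_sets[OF assms(2) refl] by (rule borel_measurable_circleI) fact
  ultimately show ?thesis using assms(4) by (intro integrable_const_bound[of _ B]) auto
qed

lemma sets_singleton_circle [simp]: "z \<in> sphere 0 1 \<Longrightarrow> {z} \<in> sets circle_borel"
  unfolding circle_borel_def sets_restrict_space by (intro image_eqI[of _ _ "{z}"]) auto

text \<open>On the circle cnj z = 1/z, so such integrals depend on the measure only through its
  moments.\<close>

lemma LINT_poly_cnj_poly:
  assumes \<nu>: "prob_space \<nu>" "sets \<nu> = sets circle_borel"
  shows "(LINT z|\<nu>. poly p z * cnj (poly q z)) =
    (\<Sum>i\<le>degree p. \<Sum>j\<le>degree q. coeff p i * cnj (coeff q j) * (LINT z|\<nu>. z powi (int i - int j)))"
proof -
  have sp: "space \<nu> = sphere 0 1" using sets_eq_imp_space_eq[OF \<nu>(2)] by simp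
  have int: "integrable \<nu> (\<lambda>z. z powi k)" for k
    using \<nu> by (rule circle_integrable[where B = 1]) (auto simp: norm_power_int)
  have "(LINT z|\<nu>. poly p z * cnj (poly q z)) =
    (LINT z|\<nu>. (\<Sum>i\<le>degree p. \<Sum>j\<le>degree q. coeff p i * cnj (coeff q j) * z powi (int i - int j)))"
  proof (rule Bochner_Integration.integral_cong[OF refl])
    fix z assume "z \<in> space \<nu>"
    then have z: "cmod z = 1" using sp by simp
    then have nz: "z \<noteq> 0" by auto
    have "z * cnj z = 1" using z by (simp add: complex_norm_square[symmetric])
    then have cz: "cnj z = inverse z" by (metis inverse_unique)
    have "z powi (int i - int j) = z ^ i * cnj (z ^ j)" for i j
      using nz by (simp add: power_int_diff cz power_inverse divide_inverse)
    then show "poly p z * cnj (poly q z) = (\<Sum>i\<le>degree p. \<Sum>j\<le>degree q. coeff p i * cnj (coeff q j) * z powi (int i - int j))"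
      unfolding poly_altdef by (simp add: sum_product algebra_simps)
  qed
  also have "\<dots> = (\<Sum>i\<le>degree p. \<Sum>j\<le>degree q. coeff p i * cnj (coeff q j) * (LINT z|\<nu>. z powi (int i - int j)))"
    using int by (simp add: Bochner_Integration.integral_sum)
  finally show ?thesis .
qed

text \<open>The polynomial vanishes at every point of S other than s, so the integral isolates the
  mass of s.\<close>

lemma LINT_indicator_singleton:
  assumes \<nu>: "prob_space \<nu>" "sets \<nu> = sets circle_borel" and AE: "AE z in \<nu>. z \<in> S"
    and S: "finite S" "S \<subseteq> sphere 0 1" "s \<in> S"
  shows "(LINT z|\<nu>. poly (\<Prod>t\<in>S - {s}. [:- t, 1:]) z) = of_real (measure \<nu> {s}) * poly (\<Prod>t\<in>S - {s}. [:- t, 1:]) s"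
proof -
  interpret prob_space \<nu> by fact
  let ?q = "\<Prod>t\<in>S - {s}. [:- t, 1:]"
  have ms: "{s} \<in> sets \<nu>" using S \<nu>(2) by auto
  have "(LINT z|\<nu>. poly ?q z) = (LINT z|\<nu>. indicator {s} z *\<^sub>R poly ?q s)"
  proof (rule integral_cong_AE)
    show "(\<lambda>z. poly ?q z) \<in> borel_measurable \<nu>"
      unfolding measurable_cong_sets[OF \<nu>(2) refl] by (rule borel_measurable_circleI) simp
    show "(\<lambda>z. indicator {s} z *\<^sub>R poly ?q s) \<in> borel_measurable \<nu>" using ms by simp
    show "AE z in \<nu>. poly ?q z = indicator {s} z *\<^sub>R poly ?q s"
      using AE by eventually_elim (use S in \<open>auto simp: poly_prod split: split_indicator\<close>)
  qed
  also have "\<dots> = of_real (measure \<nu> {s}) * poly ?q s"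
    using ms by (simp add: scaleR_conv_of_real Int_absorb2[OF sets.sets_into_space[OF ms]])
  finally show ?thesis .
qed

text \<open>Uniqueness by polynomials alone. For P vanishing exactly on S, the integral of |P|^2 is
  a combination of moments, hence 0 for \<nu> as well, which confines \<nu> to S. The interpolation
  polynomials of S then compare the point masses.\<close>

lemma circle_measure_unique:
  assumes \<nu>: "prob_space \<nu>" "sets \<nu> = sets circle_borel" and \<mu>: "prob_space \<mu>" "sets \<mu> = sets circle_borel"
    and moments: "\<And>k. (LINT z|\<nu>. z powi k) = (LINT z|\<mu>. z powi k)"
    and S: "finite S" "S \<subseteq> sphere 0 1" and AE: "AE z in \<mu>. z \<in> S"
  shows "\<nu> = \<mu>"
proof -
  interpret N: prob_space \<nu> by fact
  interpret M: prob_space \<mu> by fact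
  have eq: "(LINT z|\<nu>. poly p z * cnj (poly q z)) = (LINT z|\<mu>. poly p z * cnj (poly q z))" for p q
    unfolding LINT_poly_cnj_poly[OF \<nu>] LINT_poly_cnj_poly[OF \<mu>] moments ..
  have eq1: "(LINT z|\<nu>. poly p z) = (LINT z|\<mu>. poly p z)" for p using eq[of p 1] by simp
  let ?P = "\<Prod>t\<in>S. [:- t, 1:]"
  have P0: "poly ?P z = 0 \<longleftrightarrow> z \<in> S" for z using S(1) by (auto simp: poly_prod)
  have AE': "AE z in \<nu>. z \<in> S"
  proof -
    have "compact (poly ?P ` sphere (0::complex) 1)"
      by (intro compact_continuous_image continuous_intros) auto
    then have "bounded (poly ?P ` sphere (0::complex) 1)" by (rule compact_imp_bounded)
    then obtain B where "\<forall>y\<in>poly ?P ` sphere (0::complex) 1. cmod y \<le> B" unfolding bounded_iff by blast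
    then have B: "\<And>z. z \<in> sphere 0 1 \<Longrightarrow> cmod (poly ?P z) \<le> B" by blast
    have int: "integrable \<nu> (\<lambda>z. poly ?P z * cnj (poly ?P z))"
    proof (rule circle_integrable[OF \<nu>, where B = "B * B"])
      show "(\<lambda>z. poly ?P z * cnj (poly ?P z)) \<in> borel_measurable borel" by measurable
      show "cmod (poly ?P z * cnj (poly ?P z)) \<le> B * B" if "z \<in> sphere 0 1" for z
        using B[OF that] by (auto simp: norm_mult intro!: mult_mono order_trans[OF norm_ge_zero B[OF that]])
    qed
    have r: "(\<lambda>z. poly ?P z * cnj (poly ?P z)) = (\<lambda>z. of_real ((cmod (poly ?P z))\<^sup>2))"
      by (simp only: complex_norm_square)
    have int': "integrable \<nu> (\<lambda>z. (cmod (poly ?P z))\<^sup>2)"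
    proof -
      have "(cmod (poly ?P z))\<^sup>2 = Re (poly ?P z * cnj (poly ?P z))" for z
        by (simp only: complex_norm_square[symmetric] Re_complex_of_real)
      then show ?thesis using integrable_Re[OF int] by (simp only:)
    qed
    have "(LINT z|\<mu>. poly ?P z * cnj (poly ?P z)) = (LINT z|\<mu>. 0)"
    proof (rule integral_cong_AE)
      show "(\<lambda>z. poly ?P z * cnj (poly ?P z)) \<in> borel_measurable \<mu>"
        unfolding measurable_cong_sets[OF \<mu>(2) refl] by (rule borel_measurable_circleI) measurable
      show "AE z in \<mu>. poly ?P z * cnj (poly ?P z) = 0" using AE by eventually_elim (simp only: P0 mult_eq_0_iff, simp)
    qed simp
    then have "(LINT z|\<nu>. poly ?P z * cnj (poly ?P z)) = 0" using eq by simp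
    then have "complex_of_real (LINT z|\<nu>. (cmod (poly ?P z))\<^sup>2) = 0" unfolding r integral_complex_of_real .
    then have "(LINT z|\<nu>. (cmod (poly ?P z))\<^sup>2) = 0" by (simp only: of_real_eq_0_iff)
    then have "AE z in \<nu>. (cmod (poly ?P z))\<^sup>2 = 0"
      using integral_nonneg_eq_0_iff_AE[OF int'] by auto
    then show ?thesis by eventually_elim (metis P0 norm_eq_zero zero_eq_power2)
  qed
  have pt: "measure \<nu> {s} = measure \<mu> {s}" if s: "s \<in> S" for s
  proof -
    let ?q = "\<Prod>t\<in>S - {s}. [:- t, 1:]"
    have "poly ?q s \<noteq> 0" using S(1) by (auto simp: poly_prod)
    moreover have "of_real (measure \<nu> {s}) * poly ?q s = of_real (measure \<mu> {s}) * poly ?q s"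
      using LINT_indicator_singleton[OF \<nu> AE' S s] LINT_indicator_singleton[OF \<mu> AE S s] eq1 by metis
    ultimately show ?thesis by simp
  qed
  show ?thesis
  proof (rule measure_eqI)
    show "sets \<nu> = sets \<mu>" using \<nu> \<mu> by simp
    fix A assume A: "A \<in> sets \<nu>"
    have m: "emeasure \<kappa> A = (\<Sum>s\<in>A \<inter> S. emeasure \<kappa> {s})"
      if \<kappa>: "sets \<kappa> = sets circle_borel" "AE z in \<kappa>. z \<in> S" for \<kappa>
    proof -
      have ms: "{s} \<in> sets \<kappa>" if "s \<in> S" for s using that S(2) \<kappa>(1) by auto
      have SI: "A \<inter> S \<in> sets \<kappa>"
      proof -
        have "S = (\<Union>s\<in>S. {s})" by auto
        also have "\<dots> \<in> sets \<kappa>" using S(1) ms by (intro sets.finite_UN) auto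
        finally show ?thesis using A \<nu>(2) \<kappa>(1) by auto
      qed
      have "emeasure \<kappa> A = emeasure \<kappa> (A \<inter> S)"
        by (rule emeasure_eq_AE) (use \<kappa> A \<nu>(2) SI in \<open>auto elim!: eventually_mono\<close>)
      also have "A \<inter> S = (\<Union>s\<in>A \<inter> S. {s})" by auto
      also have "emeasure \<kappa> \<dots> = (\<Sum>s\<in>A \<inter> S. emeasure \<kappa> {s})"
        using S(1) ms by (intro sum_emeasure[symmetric]) (auto simp: disjoint_family_on_def)
      finally show ?thesis .
    qed
    show "emeasure \<nu> A = emeasure \<mu> A"
      unfolding m[OF \<nu>(2) AE'] m[OF \<mu>(2) AE]
      using pt by (intro sum.cong) (auto simp: N.emeasure_eq_measure M.emeasure_eq_measure)
  qed
qed

section \<open>The discrete measure given by the weights: support, orthogonal polynomials,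
  coefficients\<close>

context circle_weights
begin

definition wmeasure :: "complex measure" where
  "wmeasure = distr (point_measure {..<n} (\<lambda>i. ennreal (w i))) circle_borel l"

lemma sets_wmeasure [simp]: "sets wmeasure = sets circle_borel"
  by (simp add: wmeasure_def)

lemma l_measurable: "l \<in> measurable (point_measure {..<n} (\<lambda>i. ennreal (w i))) circle_borel"
  by (auto simp: measurable_point_measure_eq1 l_circle)

lemma LINT_wmeasure:
  fixes f :: "complex \<Rightarrow> 'b :: {banach, second_countable_topology}"
  assumes "f \<in> borel_measurable borel"
  shows "(LINT z|wmeasure. f z) = (\<Sum>i<n. w i *\<^sub>R f (l i))"
  unfolding wmeasure_def
  by (subst integral_distr[OF l_measurable borel_measurable_circleI[OF assms]])
    (auto intro!: lebesgue_integral_point_measure_finite simp: w_nonneg)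

lemma prob_space_wmeasure: "prob_space wmeasure"
  unfolding wmeasure_def
proof (rule prob_space.prob_space_distr[OF _ l_measurable], rule prob_spaceI)
  have "(\<Sum>i<n. ennreal (w i)) = 1" using w_sum by (subst sum_ennreal) (auto simp: w_nonneg)
  then show "emeasure (point_measure {..<n} (\<lambda>i. ennreal (w i))) (space (point_measure {..<n} (\<lambda>i. ennreal (w i)))) = 1"
    by (simp add: space_point_measure emeasure_point_measure_finite)
qed

lemma measure_wmeasure:
  assumes "A \<in> sets borel"
  shows "measure wmeasure (A \<inter> sphere 0 1) = (\<Sum>i<n. w i * indicator A (l i))"
proof -
  have "space wmeasure = sphere 0 1" using sets_eq_imp_space_eq[OF sets_wmeasure] by simp
  then have "measure wmeasure (A \<inter> sphere 0 1) = (LINT z|wmeasure. indicator A z :: real)"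
    by simp
  also have "\<dots> = (\<Sum>i<n. w i * indicator A (l i))" using assms by (subst LINT_wmeasure) auto
  finally show ?thesis .
qed

lemma AE_wmeasure: "AE z in wmeasure. z \<in> l ` {..<n}"
  unfolding wmeasure_def
proof (subst AE_distr_iff[OF l_measurable])
  have "finite (l ` {..<n})" by simp
  then have "l ` {..<n} \<in> sets borel" by (intro borel_closed finite_imp_closed)
  then show "{x \<in> space circle_borel. x \<in> l ` {..<n}} \<in> sets circle_borel"
    unfolding circle_borel_def sets_restrict_space space_restrict_space
    by (intro image_eqI[of _ _ "l ` {..<n}"]) auto
  show "AE x in point_measure {..<n} (\<lambda>i. ennreal (w i)). l x \<in> l ` {..<n}"
    by (rule AE_I2) (auto simp: space_point_measure)
qed

lemma wmeasure_unique:
  assumes "prob_space \<nu>" "sets \<nu> = sets circle_borel"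
    "\<And>k. (LINT z|\<nu>. z powi k) = (\<Sum>i<n. of_real (w i) * l i powi k)"
  shows "\<nu> = wmeasure"
proof (rule circle_measure_unique[OF assms(1,2) prob_space_wmeasure sets_wmeasure _ _ _ AE_wmeasure])
  show "(LINT z|\<nu>. z powi k) = (LINT z|wmeasure. z powi k)" for k
    unfolding assms(3) by (subst LINT_wmeasure) (auto simp: scaleR_conv_of_real)
qed (auto simp: l_circle)

lemma circle_support_wmeasure: "circle_support wmeasure = supp"
proof (rule subset_antisym; rule subsetI)
  fix z assume z: "z \<in> circle_support wmeasure"
  show "z \<in> supp"
  proof (rule ccontr)
    assume "z \<notin> supp"
    moreover have "open (- supp)" using finite_supp by (intro open_Compl finite_imp_closed)
    ultimately obtain \<epsilon> where \<epsilon>: "0 < \<epsilon>" "ball z \<epsilon> \<subseteq> - supp" by (metis ComplI openE)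
    have "w i * indicator (ball z \<epsilon>) (l i) = 0" if "i < n" for i
    proof (cases "0 < w i")
      case True
      then have "l i \<notin> ball z \<epsilon>" using \<epsilon>(2) that by (force simp: supp_def)
      then show ?thesis by simp
    next
      case False
      then show ?thesis using w_nonneg[of i] by simp
    qed
    then have "measure wmeasure (ball z \<epsilon> \<inter> sphere 0 1) = 0"
      by (subst measure_wmeasure) (simp, intro sum.neutral ballI, simp only: lessThan_iff)
    then show False using z \<epsilon>(1) by (auto simp: circle_support_def)
  qed
next
  fix z assume z: "z \<in> supp"
  then obtain i where i: "i < n" "0 < w i" "z = l i" by (auto simp: supp_def)
  have "0 < measure wmeasure (ball z \<epsilon> \<inter> sphere 0 1)" if "0 < \<epsilon>" for \<epsilon>
  proof -
    have "w i * indicator (ball z \<epsilon>) (l i) \<le> (\<Sum>i<n. w i * indicator (ball z \<epsilon>) (l i))"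
      using i by (intro member_le_sum) (auto simp: w_nonneg)
    then show ?thesis using i that by (simp add: measure_wmeasure)
  qed
  then show "z \<in> circle_support wmeasure" using i l_circle by (auto simp: circle_support_def)
qed

lemma support_size_wmeasure: "support_size wmeasure = enat (card supp)"
  by (simp add: support_size_def circle_support_wmeasure finite_supp)

lemma LINT_wmeasure_sp: "(LINT z|wmeasure. cnj (poly q z) * poly p z) = sp p q"
  by (subst LINT_wmeasure) (auto simp: sp_def scaleR_conv_of_real ac_simps)

text \<open>Two candidates differ by a polynomial of degree below k that is orthogonal to itself,
  hence vanishes on the support, hence is 0. This includes k equal to the number of support points,
  where the polynomial itself has norm 0.\<close>

lemma monic_OP_wmeasure:
  assumes k: "k \<le> card supp" shows "monic_OP wmeasure k = phi k"
  unfolding monic_OP_def LINT_wmeasure_sp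
proof (rule the_equality)
  show "degree (phi k) = k \<and> lead_coeff (phi k) = 1 \<and> (\<forall>q. degree q < k \<longrightarrow> sp (phi k) q = 0)"
    using phi_orthogonal by (simp add: degree_phi lead_coeff_phi)
  fix p assume p: "degree p = k \<and> lead_coeff p = 1 \<and> (\<forall>q. degree q < k \<longrightarrow> sp p q = 0)"
  define d where "d = p - phi k"
  have "degree d \<le> k" unfolding d_def using p by (intro degree_diff_le) (auto simp: degree_phi)
  moreover have "coeff d k = 0" using p by (auto simp: d_def lead_coeff_phi)
  ultimately have d: "d = 0 \<or> degree d < k" by (metis leading_coeff_0_iff le_neq_implies_less)
  have "d = 0"
  proof (rule ccontr)
    assume nz: "d \<noteq> 0"
    then have "sp p d = 0" "sp (phi k) d = 0" using d p phi_orthogonal by auto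
    then have "sp d d = 0" by (simp add: d_def sp_diff_left)
    then have "d = 0" using d nz k unfolding sp_self_eq_0_iff
      by (intro poly_eq_0_if_vanishes_on_supp) auto
    then show False using nz by simp
  qed
  then show "p = phi k" by (simp add: d_def)
qed

lemma verblunsky_coeff_wmeasure:
  assumes k: "k < card supp" shows "verblunsky_coeff wmeasure k = alpha k"
  unfolding verblunsky_coeff_def
proof (rule the_equality)
  have m: "monic_OP wmeasure (Suc k) = phi (Suc k)" "monic_OP wmeasure k = phi k"
    using k by (auto simp only: monic_OP_wmeasure)
  show "monic_OP wmeasure (Suc k) = [:0, 1:] * monic_OP wmeasure k - Polynomial.smult (cnj (alpha k)) (reversed_poly (monic_OP wmeasure k))"
    unfolding m phi_Suc by simp
  fix a assume a: "monic_OP wmeasure (Suc k) = [:0, 1:] * monic_OP wmeasure k - Polynomial.smult (cnj a) (reversed_poly (monic_OP wmeasure k))"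
  obtain r where r: "reversed_poly (phi k) = pCons 1 r" using reversed_phi by blast
  have "Polynomial.smult (cnj a) (reversed_poly (phi k)) = Polynomial.smult (cnj (alpha k)) (reversed_poly (phi k))"
    using a unfolding m phi_Suc by simp
  then show "a = alpha k" unfolding r by simp
qed

lemma verblunsky_wmeasure: "verblunsky wmeasure = (enat (card supp), alpha)"
  using alpha_norm(3) by (auto simp: verblunsky_def support_size_wmeasure verblunsky_coeff_wmeasure)

end

text \<open>The squared component of e_0 along the i-th eigenvector, that is, its contribution to
  the mass of the i-th eigenvalue under the spectral measure.\<close>

definition eigen_weight :: "complex mat \<Rightarrow> nat \<Rightarrow> real" where
  "eigen_weight Q i = (cmod (Q $$ (0, i)))\<^sup>2"

context
  fixes n :: nat and U Q :: "complex mat" and l :: "nat \<Rightarrow> complex"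
  assumes n: "0 < n" and U: "U \<in> unitary_group n" and Q: "Q \<in> unitary_group n"
    and l: "\<And>i. i < n \<Longrightarrow> cmod (l i) = 1" and diag: "U * Q = Q * mat_diag n l"
begin

lemma eigen_mult: "U *\<^sub>v (Q *\<^sub>v vec n f) = Q *\<^sub>v vec n (\<lambda>i. l i * f i)"
proof -
  have c: "U \<in> carrier_mat n n" "Q \<in> carrier_mat n n" using U Q by (auto dest: unitary_group_carrier)
  have "U *\<^sub>v (Q *\<^sub>v vec n f) = (Q * mat_diag n l) *\<^sub>v vec n f"
    unfolding diag[symmetric] using c by (intro assoc_mult_mat_vec[symmetric]) auto
  also have "\<dots> = Q *\<^sub>v (mat_diag n l *\<^sub>v vec n f)"
    using c by (intro assoc_mult_mat_vec) auto
  also have "mat_diag n l *\<^sub>v vec n f = vec n (\<lambda>i. l i * f i)"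
    by (rule eq_vecI) (auto simp: mat_diag_def scalar_prod_def if_distrib[of "\<lambda>x. x * _"] cong: if_cong)
  finally show ?thesis .
qed

lemma eigen_adjoint_mult: "mat_adjoint U *\<^sub>v (Q *\<^sub>v vec n f) = Q *\<^sub>v vec n (\<lambda>i. cnj (l i) * f i)"
proof -
  have c: "U \<in> carrier_mat n n" "Q \<in> carrier_mat n n" using U Q by (auto dest: unitary_group_carrier)
  have "l i * (cnj (l i) * f i) = f i" if "i < n" for i
    using l[OF that] by (simp add: mult.assoc[symmetric] complex_norm_square[symmetric])
  then have "vec n f = vec n (\<lambda>i. l i * (cnj (l i) * f i))" by (intro eq_vecI) auto
  then have "Q *\<^sub>v vec n f = U *\<^sub>v (Q *\<^sub>v vec n (\<lambda>i. cnj (l i) * f i))" by (simp only: eigen_mult)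
  then have "mat_adjoint U *\<^sub>v (Q *\<^sub>v vec n f) = (mat_adjoint U * U) *\<^sub>v (Q *\<^sub>v vec n (\<lambda>i. cnj (l i) * f i))"
    using c by (simp add: assoc_mult_mat_vec[of _ n n _ n])
  then show ?thesis using c by (simp add: unitary_group_adjoint_left[OF U])
qed

lemma eigen_cscalar: "(Q *\<^sub>v vec n f) \<bullet>c (Q *\<^sub>v vec n g) = (\<Sum>i<n. f i * cnj (g i))"
  by (subst unitary_cscalar_prod[OF Q]) (auto simp: cscalar_prod_sum[of _ n])

lemma eigen_unit_vec: "unit_vec n 0 = Q *\<^sub>v vec n (\<lambda>i. cnj (Q $$ (0, i)))"
proof -
  have c: "Q \<in> carrier_mat n n" using Q by (auto dest: unitary_group_carrier)
  have "mat_adjoint Q *\<^sub>v unit_vec n 0 = vec n (\<lambda>i. cnj (Q $$ (0, i)))"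
    using c n by (subst mult_mat_unit_vec[of _ n n]) (auto intro!: eq_vecI)
  then have "Q *\<^sub>v vec n (\<lambda>i. cnj (Q $$ (0, i))) = Q *\<^sub>v (mat_adjoint Q *\<^sub>v unit_vec n 0)" by simp
  also have "\<dots> = (Q * mat_adjoint Q) *\<^sub>v unit_vec n 0"
    using c by (intro assoc_mult_mat_vec[symmetric, of _ n n _ n]) auto
  finally show ?thesis by (simp add: unitary_group_adjoint_right[OF Q])
qed

lemma eigen_circle_weights: "circle_weights n (eigen_weight Q) l"
  using unitary_row_norm[OF Q n] l by unfold_locales (auto simp: eigen_weight_def)

interpretation circle_weights n "eigen_weight Q" l
  by (rule eigen_circle_weights)

lemma pow_mat_eigen_mult:
  assumes A: "A \<in> carrier_mat n n" "\<And>f. A *\<^sub>v (Q *\<^sub>v vec n f) = Q *\<^sub>v vec n (\<lambda>i. c i * f i)"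
  shows "(A ^\<^sub>m k) *\<^sub>v (Q *\<^sub>v vec n f) = Q *\<^sub>v vec n (\<lambda>i. c i ^ k * f i)"
proof (induction k arbitrary: f)
  case 0
  have "Q *\<^sub>v vec n f \<in> carrier_vec n" using unitary_group_carrier[OF Q] by auto
  then show ?case using A(1) by simp
next
  case (Suc k)
  have "(A ^\<^sub>m Suc k) *\<^sub>v (Q *\<^sub>v vec n f) = (A ^\<^sub>m k) *\<^sub>v (A *\<^sub>v (Q *\<^sub>v vec n f))"
    using A(1) unitary_group_carrier[OF Q] by (simp add: assoc_mult_mat_vec[of _ n n _ n])
  then show ?case unfolding A(2) Suc by (simp add: ac_simps)
qed

lemma spectral_moments:
  "(unitary_power U k *\<^sub>v unit_vec n 0) \<bullet>c unit_vec n 0 = (\<Sum>i<n. of_real (eigen_weight Q i) * l i powi k)"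
proof -
  have Uc: "U \<in> carrier_mat n n" using U by (rule unitary_group_carrier)
  have "(unitary_power U k *\<^sub>v unit_vec n 0) = Q *\<^sub>v vec n (\<lambda>i. l i powi k * cnj (Q $$ (0, i)))"
  proof (cases "0 \<le> k")
    case True
    then show ?thesis
      unfolding unitary_power_def eigen_unit_vec
      using pow_mat_eigen_mult[OF Uc eigen_mult] by (simp add: power_int_def)
  next
    case False
    have "inverse (l i) = cnj (l i)" if "i < n" for i
      using l_cnj[OF that] by (rule inverse_unique)
    then have "vec n (\<lambda>i. cnj (l i) ^ nat (- k) * cnj (Q $$ (0, i))) = vec n (\<lambda>i. l i powi k * cnj (Q $$ (0, i)))"
      using False by (intro eq_vecI) (auto simp: power_int_def)
    then show ?thesis
      unfolding unitary_power_def eigen_unit_vec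
      using pow_mat_eigen_mult[OF _ eigen_adjoint_mult] Uc False by simp
  qed
  then have "(unitary_power U k *\<^sub>v unit_vec n 0) \<bullet>c unit_vec n 0 =
      (\<Sum>i<n. l i powi k * (cnj (Q $$ (0, i)) * Q $$ (0, i)))"
    by (subst (2) eigen_unit_vec) (simp add: eigen_cscalar mult.assoc)
  also have "\<dots> = (\<Sum>i<n. of_real (eigen_weight Q i) * l i powi k)"
    by (intro sum.cong) (auto simp: eigen_weight_def complex_norm_square ac_simps simp del: of_real_power)
  finally show ?thesis .
qed

lemma spectral_measure_eigen: "spectral_measure U = wmeasure"
proof -
  have "dim_row U = n" using unitary_group_carrier[OF U] by simp
  then show ?thesis
    unfolding spectral_measure_def is_spectral_measure_def
    using spectral_moments
    by (intro the_equality conjI allI prob_space_wmeasure sets_wmeasure wmeasure_unique)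
      (auto simp: LINT_wmeasure scaleR_conv_of_real)
qed

text \<open>The vector with eigencoordinates cnj Q_0i p(l_i) is p(U) e_0. The correspondence turns
  \<open>sp\<close> into the inner product and multiplication by z into U, so the vector recursion
  mirrors that of \<open>phi\<close>.\<close>

lemma krylov_eigen:
  "krylov U k = (Q *\<^sub>v vec n (\<lambda>i. cnj (Q $$ (0, i)) * poly (phi k) (l i)),
     Q *\<^sub>v vec n (\<lambda>i. cnj (Q $$ (0, i)) * poly (reversed_poly (phi k)) (l i)))"
  and krylov_alpha_eigen: "krylov_alpha U k = alpha k"
proof -
  let ?v = "\<lambda>p. Q *\<^sub>v vec n (\<lambda>i. cnj (Q $$ (0, i)) * poly p (l i))"
  have Qc: "Q \<in> carrier_mat n n" using Q by (rule unitary_group_carrier)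
  have ip: "?v p \<bullet>c ?v q = sp p q" for p q
    unfolding eigen_cscalar sp_def
    by (intro sum.cong) (auto simp: eigen_weight_def complex_norm_square ac_simps simp del: of_real_power)
  have shift: "U *\<^sub>v ?v p = ?v (pCons 0 p)" for p
    unfolding eigen_mult by (simp add: ac_simps)
  have lin: "Q *\<^sub>v vec n f - c \<cdot>\<^sub>v (Q *\<^sub>v vec n g) = Q *\<^sub>v vec n (\<lambda>i. f i - c * g i)" for f g c
  proof -
    have "vec n (\<lambda>i. f i - c * g i) = vec n f - c \<cdot>\<^sub>v vec n g" by (rule eq_vecI) auto
    then show ?thesis using Qc by (simp add: mult_minus_distrib_mat_vec[of _ n n] mult_mat_vec[of _ n n])
  qed
  have coeff: "krylov_coeff U (?v (phi k), ?v (reversed_poly (phi k))) = alpha k" for k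
    unfolding krylov_coeff_def fst_conv snd_conv shift ip alpha_def coeff_alpha_def ..
  have kr: "krylov U k = (?v (phi k), ?v (reversed_poly (phi k)))" for k
  proof (induction k)
    case 0
    have "reversed_poly 1 = (1 :: complex poly)" by (simp add: reversed_poly_def)
    then show ?case using unitary_group_carrier[OF U] eigen_unit_vec by simp
  next
    case (Suc k)
    have 1: "?v (pCons 0 (phi k)) - cnj (alpha k) \<cdot>\<^sub>v ?v (reversed_poly (phi k)) = ?v (phi (Suc k))"
      unfolding lin phi_Suc by (simp add: algebra_simps)
    have 2: "?v (reversed_poly (phi k)) - alpha k \<cdot>\<^sub>v ?v (pCons 0 (phi k)) = ?v (reversed_poly (phi (Suc k)))"
      unfolding lin by (intro arg_cong[of _ _ "\<lambda>x. Q *\<^sub>v x"] eq_vecI)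
        (auto simp: reversed_phi_Suc_at algebra_simps simp del: phi.simps)
    show ?case unfolding krylov.simps Suc coeff unfolding fst_conv snd_conv shift 1 2 ..
  qed
  then show "krylov U k = (?v (phi k), ?v (reversed_poly (phi k)))" .
  show "krylov_alpha U k = alpha k" unfolding krylov_alpha_def kr coeff ..
qed

lemma verblunsky_eigen: "verblunsky (spectral_measure U) = (enat (card supp), krylov_alpha U)"
  unfolding spectral_measure_eigen verblunsky_wmeasure using krylov_alpha_eigen by auto

lemma krylov_orthogonal_eigen: "0 < k \<Longrightarrow> fst (krylov U k) $ 0 = 0"
proof -
  assume k: "0 < k"
  have "fst (krylov U k) $ 0 = fst (krylov U k) \<bullet>c unit_vec n 0"
    using krylov_carrier[OF unitary_group_carrier[OF U]] n by simp
  also have "\<dots> = sp (phi k) 1"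
    unfolding krylov_eigen fst_conv sp_def
    by (subst eigen_unit_vec, unfold eigen_cscalar, intro sum.cong)
      (auto simp: eigen_weight_def complex_norm_square ac_simps simp del: of_real_power)
  also have "\<dots> = 0" using phi_orthogonal[of 1 k] k by simp
  finally show ?thesis .
qed

end

text \<open>Diagonalization of an arbitrary unitary matrix supplies the weights, so this holds at
  every U and not merely almost surely.\<close>

lemma verblunsky_spectral_measure:
  assumes "0 < n" "U \<in> unitary_group n"
  shows "verblunsky (spectral_measure U) \<in> Y" "ventry (verblunsky (spectral_measure U)) = krylov_alpha U"
proof -
  obtain Q l where d: "Q \<in> unitary_group n" "\<forall>i<n. cmod (l i) = 1" "U * Q = Q * mat_diag n l"
    using unitary_diagonalization[OF assms(2)] by blast
  note * = assms d(1) d(2)[rule_format] d(3)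
  interpret circle_weights n "eigen_weight Q" l by (rule eigen_circle_weights[OF *])
  show "ventry (verblunsky (spectral_measure U)) = krylov_alpha U"
    using verblunsky_eigen[OF *] by simp
  show "verblunsky (spectral_measure U) \<in> Y"
    using verblunsky_in_Y verblunsky_wmeasure spectral_measure_eigen[OF *] by simp
qed

lemma krylov_orthogonal:
  assumes "0 < n" "U \<in> unitary_group n" "0 < k"
  shows "fst (krylov U k) $ 0 = 0"
proof -
  obtain Q l where d: "Q \<in> unitary_group n" "\<forall>i<n. cmod (l i) = 1" "U * Q = Q * mat_diag n l"
    using unitary_diagonalization[OF assms(2)] by blast
  show ?thesis by (rule krylov_orthogonal_eigen[OF assms(1,2) d(1) d(2)[rule_format] d(3) assms(3)])
qed

section \<open>Haar measure\<close>

lemma space_unitary_borel [simp]: "space (unitary_borel n) = unitary_group n"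
  by (simp add: unitary_borel_def)

lemma entry_measurable:
  assumes "i < n" "j < n"
  shows "(\<lambda>U. U $$ (i, j)) \<in> borel_measurable (unitary_borel n)"
proof -
  let ?f = "\<lambda>U. \<lambda>ij\<in>{..<n} \<times> {..<n}. (U :: complex mat) $$ ij"
  have "?f \<in> measurable (unitary_borel n) (\<Pi>\<^sub>M ij\<in>{..<n} \<times> {..<n}. borel)"
    unfolding unitary_borel_def by (rule measurable_vimage_algebra1) (auto simp: space_PiM)
  moreover have "(\<lambda>g. g (i, j)) \<in> measurable (\<Pi>\<^sub>M ij\<in>{..<n} \<times> {..<n}. borel :: complex measure) borel"
    using assms by (intro measurable_component_singleton) auto
  ultimately have "(\<lambda>U. ?f U (i, j)) \<in> borel_measurable (unitary_borel n)"
    by (rule measurable_compose)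
  then show ?thesis using assms by simp
qed

lemma measurable_unitary_borelI:
  assumes "\<And>x. x \<in> space M \<Longrightarrow> f x \<in> unitary_group n"
    "\<And>i j. i < n \<Longrightarrow> j < n \<Longrightarrow> (\<lambda>x. f x $$ (i, j)) \<in> borel_measurable M"
  shows "f \<in> measurable M (unitary_borel n)"
  unfolding unitary_borel_def
  using assms by (intro measurable_vimage_algebra2 measurable_restrict) auto

lemma entry_measurable_compose:
  "f \<in> measurable M (unitary_borel n) \<Longrightarrow> i < n \<Longrightarrow> j < n \<Longrightarrow> (\<lambda>x. f x $$ (i, j)) \<in> borel_measurable M"
  using measurable_compose[OF _ entry_measurable] by blast

lemma measurable_mat_mult:
  assumes f: "f \<in> measurable M (unitary_borel n)" and g: "g \<in> measurable M (unitary_borel n)"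
  shows "(\<lambda>x. f x * g x) \<in> measurable M (unitary_borel n)"
proof (rule measurable_unitary_borelI)
  have fg: "f x \<in> unitary_group n" "g x \<in> unitary_group n" if "x \<in> space M" for x
    using measurable_space[OF f that] measurable_space[OF g that] by auto
  then show "f x * g x \<in> unitary_group n" if "x \<in> space M" for x
    using that by (intro unitary_group_mult)
  fix i j assume ij: "i < n" "j < n"
  have "(\<lambda>x. \<Sum>k<n. f x $$ (i, k) * g x $$ (k, j)) \<in> borel_measurable M"
    using ij by (intro borel_measurable_sum borel_measurable_times entry_measurable_compose[OF f] entry_measurable_compose[OF g]) auto
  then show "(\<lambda>x. (f x * g x) $$ (i, j)) \<in> borel_measurable M"
    by (rule measurable_cong[THEN iffD1, rotated])
      (rule mult_mat_index[symmetric, of _ n n _ n], auto intro: unitary_group_carrier fg ij)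
qed

lemma measurable_mat_adjoint:
  assumes f: "f \<in> measurable M (unitary_borel n)"
  shows "(\<lambda>x. mat_adjoint (f x)) \<in> measurable M (unitary_borel n)"
proof (rule measurable_unitary_borelI)
  have fg: "f x \<in> unitary_group n" if "x \<in> space M" for x
    using measurable_space[OF f that] by auto
  then show "mat_adjoint (f x) \<in> unitary_group n" if "x \<in> space M" for x
    using that by (intro unitary_group_adjoint)
  fix i j assume ij: "i < n" "j < n"
  have "(\<lambda>x. cnj (f x $$ (j, i))) \<in> borel_measurable M"
    using ij by (intro borel_measurable_cnj entry_measurable_compose[OF f])
  moreover have "cnj (f x $$ (j, i)) = mat_adjoint (f x) $$ (i, j)" if "x \<in> space M" for x
    using ij unitary_group_carrier[OF fg[OF that]] by simp
  ultimately show "(\<lambda>x. mat_adjoint (f x) $$ (i, j)) \<in> borel_measurable M"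
    by (simp cong: measurable_cong)
qed

lemma measurable_mat_corner:
  assumes f: "f \<in> measurable M (unitary_borel m)"
  shows "(\<lambda>x. mat_corner 1 (f x)) \<in> measurable M (unitary_borel (Suc m))"
proof (rule measurable_unitary_borelI)
  have fg: "f x \<in> unitary_group m" if "x \<in> space M" for x
    using measurable_space[OF f that] by auto
  then show "mat_corner 1 (f x) \<in> unitary_group (Suc m)" if "x \<in> space M" for x
    using that by (intro mat_corner_unitary) auto
  fix i j assume ij: "i < Suc m" "j < Suc m"
  have "(\<lambda>x. if i = 0 then (if j = 0 then 1 else 0) else if j = 0 then 0 else f x $$ (i - 1, j - 1)) \<in> borel_measurable M"
    using ij entry_measurable_compose[OF f, of "i - 1" "j - 1"] by (cases "i = 0"; cases "j = 0") auto
  then show "(\<lambda>x. mat_corner 1 (f x) $$ (i, j)) \<in> borel_measurable M"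
    by (rule measurable_cong[THEN iffD1, rotated])
      (rule mat_corner_index[symmetric, of _ m m], use ij unitary_group_carrier[OF fg] in auto)
qed

text \<open>The Krylov vectors arise from the entries of U by sums, products, conjugation and total
  division, all of which are Borel. This is the route to measurability of the coefficients.\<close>

lemma krylov_measurable:
  assumes n: "0 < n"
  shows "i < n \<Longrightarrow> (\<lambda>U. fst (krylov U k) $ i) \<in> borel_measurable (unitary_borel n)"
    and "i < n \<Longrightarrow> (\<lambda>U. snd (krylov U k) $ i) \<in> borel_measurable (unitary_borel n)"
    and krylov_alpha_measurable: "(\<lambda>U. krylov_alpha U k) \<in> borel_measurable (unitary_borel n)"
proof -
  let ?M = "unitary_borel n"
  note c = krylov_carrier[OF unitary_group_carrier]
  have cong: "f \<in> borel_measurable ?M" if "\<And>U. U \<in> unitary_group n \<Longrightarrow> f U = g U" "g \<in> borel_measurable ?M"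
    for f g :: "complex mat \<Rightarrow> complex"
    using measurable_cong[of ?M f g borel] that by simp
  have Ux: "(\<lambda>U. (U *\<^sub>v X U) $ i) \<in> borel_measurable ?M"
    if "\<And>U. U \<in> unitary_group n \<Longrightarrow> X U \<in> carrier_vec n" "\<And>i. i < n \<Longrightarrow> (\<lambda>U. X U $ i) \<in> borel_measurable ?M" "i < n" for X i
  proof (rule cong)
    show "(U *\<^sub>v X U) $ i = (\<Sum>j<n. U $$ (i, j) * X U $ j)" if "U \<in> unitary_group n" for U
      using \<open>i < n\<close> unitary_group_carrier[OF that] \<open>\<And>U. U \<in> unitary_group n \<Longrightarrow> X U \<in> carrier_vec n\<close>[OF that]
      by (intro mult_mat_vec_index)
    show "(\<lambda>U. \<Sum>j<n. U $$ (i, j) * X U $ j) \<in> borel_measurable ?M"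
      using that by (intro borel_measurable_sum borel_measurable_times entry_measurable) auto
  qed
  have ip: "(\<lambda>U. X U \<bullet>c Z U) \<in> borel_measurable ?M"
    if "\<And>i. i < n \<Longrightarrow> (\<lambda>U. X U $ i) \<in> borel_measurable ?M"
      "\<And>U. U \<in> unitary_group n \<Longrightarrow> Z U \<in> carrier_vec n" "\<And>i. i < n \<Longrightarrow> (\<lambda>U. Z U $ i) \<in> borel_measurable ?M" for X Z :: "complex mat \<Rightarrow> complex vec"
  proof (rule cong)
    show "X U \<bullet>c Z U = (\<Sum>i<n. X U $ i * cnj (Z U $ i))" if "U \<in> unitary_group n" for U
      by (rule cscalar_prod_sum) (rule \<open>\<And>U. U \<in> unitary_group n \<Longrightarrow> Z U \<in> carrier_vec n\<close>[OF that])
    show "(\<lambda>U. \<Sum>i<n. X U $ i * cnj (Z U $ i)) \<in> borel_measurable ?M"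
      using that by (intro borel_measurable_sum borel_measurable_times borel_measurable_cnj) auto
  qed
  have al: "(\<lambda>U. krylov_alpha U k) \<in> borel_measurable ?M"
    if "\<And>i. i < n \<Longrightarrow> (\<lambda>U. fst (krylov U k) $ i) \<in> borel_measurable ?M"
       "\<And>i. i < n \<Longrightarrow> (\<lambda>U. snd (krylov U k) $ i) \<in> borel_measurable ?M" for k
    unfolding krylov_alpha_def krylov_coeff_def
    by (intro borel_measurable_cnj borel_measurable_divide ip Ux c that)
  have "\<forall>i<n. (\<lambda>U. fst (krylov U k) $ i) \<in> borel_measurable ?M \<and> (\<lambda>U. snd (krylov U k) $ i) \<in> borel_measurable ?M" for k
  proof (induction k)
    case 0
    have e: "(\<lambda>U. (unit_vec (dim_row U) 0 :: complex vec) $ i) \<in> borel_measurable ?M" if "i < n" for i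
      by (rule cong[of _ "\<lambda>_. if i = 0 then 1 else 0"]) (use that n in \<open>auto dest!: unitary_group_carrier\<close>)
    then show ?case by simp
  next
    case (Suc k)
    then have f: "\<And>i. i < n \<Longrightarrow> (\<lambda>U. fst (krylov U k) $ i) \<in> borel_measurable ?M"
      and s: "\<And>i. i < n \<Longrightarrow> (\<lambda>U. snd (krylov U k) $ i) \<in> borel_measurable ?M" by auto
    have 1: "(\<lambda>U. fst (krylov U (Suc k)) $ i) \<in> borel_measurable ?M" if i: "i < n" for i
    proof (rule cong)
      show "fst (krylov U (Suc k)) $ i = (U *\<^sub>v fst (krylov U k)) $ i - cnj (krylov_alpha U k) * snd (krylov U k) $ i"
        if "U \<in> unitary_group n" for U
        using c(2)[OF that, of k] i unitary_group_carrier[OF that] by (simp add: krylov_alpha_def)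
      show "(\<lambda>U. (U *\<^sub>v fst (krylov U k)) $ i - cnj (krylov_alpha U k) * snd (krylov U k) $ i) \<in> borel_measurable ?M"
        by (intro borel_measurable_diff borel_measurable_times borel_measurable_cnj Ux f s al c i)
    qed
    have 2: "(\<lambda>U. snd (krylov U (Suc k)) $ i) \<in> borel_measurable ?M" if i: "i < n" for i
    proof (rule cong)
      show "snd (krylov U (Suc k)) $ i = snd (krylov U k) $ i - krylov_alpha U k * (U *\<^sub>v fst (krylov U k)) $ i"
        if "U \<in> unitary_group n" for U
        using c(2)[OF that, of k] i unitary_group_carrier[OF that] by (simp add: krylov_alpha_def)
      show "(\<lambda>U. snd (krylov U k) $ i - krylov_alpha U k * (U *\<^sub>v fst (krylov U k)) $ i) \<in> borel_measurable ?M"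
        by (intro borel_measurable_diff borel_measurable_times Ux f s al c i)
    qed
    from 1 2 show ?case by blast
  qed
  then show "i < n \<Longrightarrow> (\<lambda>U. fst (krylov U k) $ i) \<in> borel_measurable ?M"
    "i < n \<Longrightarrow> (\<lambda>U. snd (krylov U k) $ i) \<in> borel_measurable ?M"
    "(\<lambda>U. krylov_alpha U k) \<in> borel_measurable ?M"
    using al by blast+
qed

text \<open>Open sets of \<open>Y\<close> are preimages under \<open>Y_embed\<close>, and a map into
  the countable product is Borel as soon as its coordinates are; these are expressions in
  \<open>krylov_alpha\<close>.\<close>

lemma verblunsky_measurable:
  assumes n: "0 < n"
  shows "(\<lambda>U. verblunsky (spectral_measure U)) \<in> measurable (unitary_borel n) (borel_of Y_top)"
  unfolding borel_of_def topspace_Y_top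
proof (rule measurable_measure_of)
  let ?f = "\<lambda>U. verblunsky (spectral_measure U)" and ?M = "unitary_borel n"
  show "{W. openin Y_top W} \<subseteq> Pow Y" by (auto simp: openin_Y_top)
  show "?f \<in> space ?M \<rightarrow> Y" using verblunsky_spectral_measure(1)[OF n] by auto
  fix W assume "W \<in> {W. openin Y_top W}"
  then obtain T where T: "open T" "W = Y \<inter> Y_embed -` T" unfolding openin_Y_top_iff by blast
  have p: "(\<lambda>U. vprod (krylov_alpha U) k) \<in> borel_measurable ?M" for k
    unfolding vprod_def using krylov_alpha_measurable[OF n] by measurable
  have "(\<lambda>U k. (vprod (krylov_alpha U) k, of_real (vprod (krylov_alpha U) k) * krylov_alpha U k)) \<in> borel_measurable ?M"
  proof (rule measurable_coordinatewise_then_product)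
    fix k
    show "(\<lambda>U. (vprod (krylov_alpha U) k, of_real (vprod (krylov_alpha U) k) * krylov_alpha U k)) \<in> borel_measurable ?M"
      using p[of k] krylov_alpha_measurable[OF n, of k] by (intro borel_measurable_Pair borel_measurable_times) auto
  qed
  then have "(\<lambda>U k. (vprod (krylov_alpha U) k, of_real (vprod (krylov_alpha U) k) * krylov_alpha U k)) -` T \<inter> space ?M \<in> sets ?M"
    using T(1) by (intro measurable_sets) auto
  also have "(\<lambda>U k. (vprod (krylov_alpha U) k, of_real (vprod (krylov_alpha U) k) * krylov_alpha U k)) -` T \<inter> space ?M = ?f -` W \<inter> space ?M"
  proof -
    have "Y_embed (?f U) = (\<lambda>k. (vprod (krylov_alpha U) k, of_real (vprod (krylov_alpha U) k) * krylov_alpha U k))"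
      if "U \<in> unitary_group n" for U
      using verblunsky_spectral_measure(2)[OF n that] by (auto simp: Y_embed_def)
    then show ?thesis using verblunsky_spectral_measure(1)[OF n]
      by (intro Set.set_eqI) (simp add: T(2) conj_ac, metis)
  qed
  finally show "?f -` W \<inter> space ?M \<in> sets ?M" .
qed

section \<open>Left, adjoint and right invariance of Haar measure\<close>

locale haar =
  fixes n :: nat and H :: "complex mat measure"
  assumes haar: "haar_unitary n H"
begin

sublocale prob_space H
  using haar by (simp add: haar_unitary_def)

lemma sets_H [simp]: "sets H = sets (unitary_borel n)"
  using haar by (simp add: haar_unitary_def)

lemma space_H [simp]: "space H = unitary_group n"
  using sets_eq_imp_space_eq[OF sets_H] by simp

lemma measurable_H [simp]: "measurable H N = measurable (unitary_borel n) N" "measurable N H = measurable N (unitary_borel n)"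
  by (rule measurable_cong_sets[OF sets_H refl], rule measurable_cong_sets[OF refl sets_H])

lemma id_measurable: "(\<lambda>U. U) \<in> measurable (unitary_borel n) (unitary_borel n)"
  by simp

lemma left_mult_measurable: "V \<in> unitary_group n \<Longrightarrow> (\<lambda>U. V * U) \<in> measurable (unitary_borel n) (unitary_borel n)"
  by (intro measurable_mat_mult measurable_const) auto

lemma right_mult_measurable: "V \<in> unitary_group n \<Longrightarrow> (\<lambda>U. U * V) \<in> measurable (unitary_borel n) (unitary_borel n)"
  by (intro measurable_mat_mult measurable_const) auto

lemma left_invariant:
  assumes "V \<in> unitary_group n" "f \<in> borel_measurable (unitary_borel n)"
  shows "(\<integral>\<^sup>+U. f (V * U) \<partial>H) = (\<integral>\<^sup>+U. f U \<partial>H)"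
proof -
  have "distr H H (\<lambda>U. V * U) = H" using haar assms(1) by (simp add: haar_unitary_def)
  then have "(\<integral>\<^sup>+U. f U \<partial>H) = (\<integral>\<^sup>+U. f U \<partial>distr H H (\<lambda>U. V * U))" by simp
  also have "\<dots> = (\<integral>\<^sup>+U. f (V * U) \<partial>H)"
    using assms by (intro nn_integral_distr) (auto simp: left_mult_measurable)
  finally show ?thesis ..
qed

lemma left_invariant_integral:
  fixes f :: "complex mat \<Rightarrow> real"
  assumes "V \<in> unitary_group n" "f \<in> borel_measurable (unitary_borel n)"
  shows "(\<integral>U. f (V * U) \<partial>H) = (\<integral>U. f U \<partial>H)"
proof -
  have "distr H H (\<lambda>U. V * U) = H" using haar assms(1) by (simp add: haar_unitary_def)
  then have "(\<integral>U. f U \<partial>H) = (\<integral>U. f U \<partial>distr H H (\<lambda>U. V * U))" by simp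
  also have "\<dots> = (\<integral>U. f (V * U) \<partial>H)"
    using assms by (intro integral_distr) (auto simp: left_mult_measurable)
  finally show ?thesis ..
qed

text \<open>Unimodularity by Fubini. Integrating f at \<open>mat_adjoint V * U\<close> first over U
  gives the integral of f, by left invariance. The same matrix is the adjoint of
  \<open>mat_adjoint U * V\<close>, so integrating first over V gives the integral of f at
  adjoints.\<close>

lemma adjoint_invariant:
  assumes f: "f \<in> borel_measurable (unitary_borel n)"
  shows "(\<integral>\<^sup>+U. f (mat_adjoint U) \<partial>H) = (\<integral>\<^sup>+U. f U \<partial>H)"
proof -
  interpret P: pair_sigma_finite H H ..
  have fst: "fst \<in> measurable (H \<Otimes>\<^sub>M H) (unitary_borel n)" and snd: "snd \<in> measurable (H \<Otimes>\<^sub>M H) (unitary_borel n)"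
    using measurable_fst[of H H] measurable_snd[of H H] by simp_all
  have m: "(\<lambda>(V, U). f (mat_adjoint V * U)) \<in> borel_measurable (H \<Otimes>\<^sub>M H)"
    unfolding case_prod_beta
    by (rule measurable_compose[OF _ f]) (intro measurable_mat_mult measurable_mat_adjoint fst snd)
  have fa: "(\<lambda>U. f (mat_adjoint U)) \<in> borel_measurable (unitary_borel n)"
    by (rule measurable_compose[OF _ f]) (intro measurable_mat_adjoint id_measurable)
  have "(\<integral>\<^sup>+U. f U \<partial>H) = (\<integral>\<^sup>+V. (\<integral>\<^sup>+U. f U \<partial>H) \<partial>H)"
    by (simp add: emeasure_space_1[simplified])
  also have "\<dots> = (\<integral>\<^sup>+V. \<integral>\<^sup>+U. f (mat_adjoint V * U) \<partial>H \<partial>H)"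
    by (intro nn_integral_cong left_invariant[symmetric] f) (auto intro: unitary_group_adjoint)
  also have "\<dots> = (\<integral>\<^sup>+U. \<integral>\<^sup>+V. f (mat_adjoint V * U) \<partial>H \<partial>H)"
    using P.Fubini'[OF m] by simp
  also have "\<dots> = (\<integral>\<^sup>+U. \<integral>\<^sup>+V. f (mat_adjoint (mat_adjoint U * V)) \<partial>H \<partial>H)"
    by (intro nn_integral_cong) (simp add: mat_adjoint_mult[of _ n n _ n] unitary_group_carrier)
  also have "\<dots> = (\<integral>\<^sup>+U. (\<integral>\<^sup>+V. f (mat_adjoint V) \<partial>H) \<partial>H)"
    by (intro nn_integral_cong left_invariant fa) (auto intro: unitary_group_adjoint)
  also have "\<dots> = (\<integral>\<^sup>+V. f (mat_adjoint V) \<partial>H)"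
    by (simp add: emeasure_space_1[simplified])
  finally show ?thesis ..
qed

lemma right_invariant:
  assumes V: "V \<in> unitary_group n" and f: "f \<in> borel_measurable (unitary_borel n)"
  shows "(\<integral>\<^sup>+U. f (U * V) \<partial>H) = (\<integral>\<^sup>+U. f U \<partial>H)"
proof -
  have fa: "(\<lambda>U. f (mat_adjoint U)) \<in> borel_measurable (unitary_borel n)"
    by (rule measurable_compose[OF _ f]) (intro measurable_mat_adjoint id_measurable)
  have fr: "(\<lambda>U. f (U * V)) \<in> borel_measurable (unitary_borel n)"
    by (rule measurable_compose[OF _ f]) (rule right_mult_measurable[OF V])
  have "(\<integral>\<^sup>+U. f (U * V) \<partial>H) = (\<integral>\<^sup>+U. f (mat_adjoint U * V) \<partial>H)"
    by (rule adjoint_invariant[OF fr, symmetric])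
  also have "\<dots> = (\<integral>\<^sup>+U. f (mat_adjoint (mat_adjoint V * U)) \<partial>H)"
    using V by (intro nn_integral_cong) (simp add: mat_adjoint_mult[of _ n n _ n] unitary_group_carrier)
  also have "\<dots> = (\<integral>\<^sup>+U. f (mat_adjoint U) \<partial>H)"
    by (rule left_invariant[OF unitary_group_adjoint[OF V] fa])
  also have "\<dots> = (\<integral>\<^sup>+U. f U \<partial>H)" by (rule adjoint_invariant[OF f])
  finally show ?thesis .
qed

end

section \<open>The law of one entry\<close>

text \<open>The coefficient of t^2 is the one that feeds the moment recursion. Truncated subtraction
  in the exponents is harmless, since the factors K and K(K-1) vanish where it occurs.\<close>

lemma coeff_quadratic_power:
  fixes x y z :: real
  shows "coeff ([:x, y, z:] ^ K) 0 = x ^ K"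
    and "coeff ([:x, y, z:] ^ K) 1 = real K * x ^ (K - 1) * y"
    and "coeff ([:x, y, z:] ^ K) 2 = real K * x ^ (K - 1) * z + real K * (real K - 1) / 2 * x ^ (K - 2) * y\<^sup>2"
proof -
  have "coeff ([:x, y, z:] ^ K) 0 = x ^ K \<and> coeff ([:x, y, z:] ^ K) 1 = real K * x ^ (K - 1) * y \<and>
    coeff ([:x, y, z:] ^ K) 2 = real K * x ^ (K - 1) * z + real K * (real K - 1) / 2 * x ^ (K - 2) * y\<^sup>2"
  proof (induction K)
    case (Suc K)
    have s: "coeff ([:x, y, z:] ^ Suc K) 0 = x * coeff ([:x, y, z:] ^ K) 0"
      "coeff ([:x, y, z:] ^ Suc K) 1 = x * coeff ([:x, y, z:] ^ K) 1 + y * coeff ([:x, y, z:] ^ K) 0"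
      "coeff ([:x, y, z:] ^ Suc K) 2 = x * coeff ([:x, y, z:] ^ K) 2 + y * coeff ([:x, y, z:] ^ K) 1 + z * coeff ([:x, y, z:] ^ K) 0"
      by (simp_all add: numeral_2_eq_2)
    show ?case
    proof (cases K)
      case 0
      then show ?thesis using s by simp
    next
      case (Suc K')
      then have a: "x * x ^ (K - 1) = x ^ K" by simp
      have b: "x * (real K * (real K - 1) / 2 * x ^ (K - 2) * y\<^sup>2) = real K * (real K - 1) / 2 * x ^ (K - 1) * y\<^sup>2"
        using Suc by (cases K') (auto simp: ac_simps)
      have "coeff ([:x, y, z:] ^ Suc K) 2 = x * (real K * x ^ (K - 1) * z + real K * (real K - 1) / 2 * x ^ (K - 2) * y\<^sup>2)
          + y * (real K * x ^ (K - 1) * y) + z * x ^ K"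
        using s(3) Suc.IH by presburger
      also have "\<dots> = real K * (x * x ^ (K - 1)) * z + x * (real K * (real K - 1) / 2 * x ^ (K - 2) * y\<^sup>2)
          + real K * x ^ (K - 1) * y\<^sup>2 + x ^ K * z"
        by (simp only: distrib_left power2_eq_square ac_simps)
      also have "\<dots> = real (Suc K) * x ^ K * z + real (Suc K) * (real (Suc K) - 1) / 2 * x ^ (K - 1) * y\<^sup>2"
        unfolding a b by (simp add: field_simps)
      finally have 2: "coeff ([:x, y, z:] ^ Suc K) 2 = real (Suc K) * x ^ K * z + real (Suc K) * (real (Suc K) - 1) / 2 * x ^ (K - 1) * y\<^sup>2" .
      have "coeff ([:x, y, z:] ^ Suc K) 1 = x * (real K * x ^ (K - 1) * y) + y * x ^ K"
        using s(2) Suc.IH by presburger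
      also have "\<dots> = real K * (x * x ^ (K - 1)) * y + y * x ^ K" by simp
      finally have 1: "coeff ([:x, y, z:] ^ Suc K) 1 = real (Suc K) * x ^ K * y" unfolding a by (simp add: algebra_simps)
      have "coeff ([:x, y, z:] ^ Suc K) 0 = x ^ Suc K" using s(1) Suc.IH by simp
      moreover have "Suc K - 1 = K" "Suc K - 2 = K - 1" by simp_all
      ultimately show ?thesis using 1 2 by presburger
    qed
  qed simp
  then show "coeff ([:x, y, z:] ^ K) 0 = x ^ K"
    "coeff ([:x, y, z:] ^ K) 1 = real K * x ^ (K - 1) * y"
    "coeff ([:x, y, z:] ^ K) 2 = real K * x ^ (K - 1) * z + real K * (real K - 1) / 2 * x ^ (K - 2) * y\<^sup>2" by auto
qed

lemma poly_eq_sum_upto: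
  fixes p :: "real poly"
  assumes "degree p \<le> m" shows "poly p t = (\<Sum>j\<le>m. coeff p j * t ^ j)"
  unfolding poly_altdef using assms
  by (intro sum.mono_neutral_left) (auto simp: coeff_eq_0)

context haar
begin

text \<open>An algebra of functions, so that integrability of every polynomial expression in the
  entries follows by closure rules.\<close>

definition bounded_rv :: "(complex mat \<Rightarrow> real) \<Rightarrow> bool" where
  "bounded_rv f \<longleftrightarrow> f \<in> borel_measurable (unitary_borel n) \<and> (\<exists>B. \<forall>U\<in>unitary_group n. \<bar>f U\<bar> \<le> B)"

lemma bounded_rv_integrable: "bounded_rv f \<Longrightarrow> integrable H f"
proof -
  assume "bounded_rv f"
  then obtain B where "f \<in> borel_measurable (unitary_borel n)" "\<forall>U\<in>unitary_group n. \<bar>f U\<bar> \<le> B"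
    by (auto simp: bounded_rv_def)
  then show ?thesis by (intro integrable_const_bound[of _ B]) auto
qed

lemma bounded_rv_const [intro]: "bounded_rv (\<lambda>_. c)"
  by (auto simp: bounded_rv_def)

lemma bounded_rv_add [intro]:
  assumes "bounded_rv f" "bounded_rv g" shows "bounded_rv (\<lambda>U. f U + g U)"
proof -
  obtain B C where "\<And>U. U \<in> unitary_group n \<Longrightarrow> \<bar>f U\<bar> \<le> B" "\<And>U. U \<in> unitary_group n \<Longrightarrow> \<bar>g U\<bar> \<le> C"
    using assms by (auto simp: bounded_rv_def)
  then have "\<bar>f U + g U\<bar> \<le> B + C" if "U \<in> unitary_group n" for U
    using that by (intro order_trans[OF abs_triangle_ineq] add_mono)
  then show ?thesis using assms by (auto simp: bounded_rv_def)
qed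

lemma bounded_rv_mult [intro]:
  assumes "bounded_rv f" "bounded_rv g" shows "bounded_rv (\<lambda>U. f U * g U)"
proof -
  obtain B C where "\<And>U. U \<in> unitary_group n \<Longrightarrow> \<bar>f U\<bar> \<le> B" "\<And>U. U \<in> unitary_group n \<Longrightarrow> \<bar>g U\<bar> \<le> C"
    using assms by (auto simp: bounded_rv_def)
  then have "\<bar>f U * g U\<bar> \<le> B * C" if "U \<in> unitary_group n" for U
    using that by (auto simp: abs_mult intro!: mult_mono order_trans[OF abs_ge_zero])
  then show ?thesis using assms by (auto simp: bounded_rv_def)
qed

lemma bounded_rv_power [intro]: "bounded_rv f \<Longrightarrow> bounded_rv (\<lambda>U. f U ^ k)"
  by (induction k) auto

lemma bounded_rv_cmult [intro]: "bounded_rv f \<Longrightarrow> bounded_rv (\<lambda>U. c * f U)"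
  by (intro bounded_rv_mult bounded_rv_const)

lemma col0_le_1: "U \<in> unitary_group n \<Longrightarrow> i < n \<Longrightarrow> cmod (U $$ (i, 0)) \<le> 1"
proof -
  assume U: "U \<in> unitary_group n" and i: "i < n"
  have "(cmod (U $$ (i, 0)))\<^sup>2 \<le> (\<Sum>k<n. (cmod (U $$ (k, 0)))\<^sup>2)"
    using i by (intro member_le_sum) auto
  then show ?thesis using unitary_col_norm[OF U, of 0] i by (simp add: abs_square_le_1[of "cmod (U $$ (i, 0))", simplified])
qed

lemma bounded_rv_norm: "i < n \<Longrightarrow> bounded_rv (\<lambda>U. (cmod (U $$ (i, 0)))\<^sup>2)"
  unfolding bounded_rv_def
proof (intro conjI exI[of _ 1] ballI)
  assume i: "i < n"
  show "(\<lambda>U. (cmod (U $$ (i, 0)))\<^sup>2) \<in> borel_measurable (unitary_borel n)"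
    using entry_measurable[OF i, of 0] i by auto
  show "\<bar>(cmod (U $$ (i, 0)))\<^sup>2\<bar> \<le> 1" if "U \<in> unitary_group n" for U
    using col0_le_1[OF that i] by (simp add: power_le_one)
qed

lemma entry_norm_measurable: "0 < n \<Longrightarrow> (\<lambda>U. (cmod (U $$ (0, 0)))\<^sup>2) \<in> borel_measurable H"
  using bounded_rv_norm unfolding bounded_rv_def measurable_H by blast

lemma bounded_rv_Re:
  assumes i: "i < n" and c: "cmod c = 1"
  shows "bounded_rv (\<lambda>U. Re (c * U $$ (i, 0) * cnj (U $$ (0, 0))))"
  unfolding bounded_rv_def
proof (intro conjI exI[of _ 1] ballI)
  show "(\<lambda>U. Re (c * U $$ (i, 0) * cnj (U $$ (0, 0)))) \<in> borel_measurable (unitary_borel n)"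
  proof -
    have n0: "0 < n" using i by simp
    note [measurable] = entry_measurable[OF i n0] entry_measurable[OF n0 n0]
    show ?thesis by measurable
  qed
  fix U assume U: "U \<in> unitary_group n"
  have "\<bar>Re (c * U $$ (i, 0) * cnj (U $$ (0, 0)))\<bar> \<le> cmod (c * U $$ (i, 0) * cnj (U $$ (0, 0)))"
    by (rule abs_Re_le_cmod)
  also have "\<dots> \<le> 1" using col0_le_1[OF U, of i] col0_le_1[OF U, of 0] i c by (simp add: norm_mult mult_le_one)
  finally show "\<bar>Re (c * U $$ (i, 0) * cnj (U $$ (0, 0)))\<bar> \<le> 1" .
qed

lemma bounded_rv_coeff_power:
  assumes "bounded_rv f" "bounded_rv g" "bounded_rv h"
  shows "bounded_rv (\<lambda>U. coeff ([:f U, g U, h U:] ^ K) j)"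
proof (induction K arbitrary: j)
  case 0
  then show ?case by auto
next
  case (Suc K)
  consider "j = 0" | "j = 1" | i where "j = Suc (Suc i)" by (metis One_nat_def old.nat.exhaust)
  then show ?case
  proof cases
    case 1
    then show ?thesis using bounded_rv_mult[OF assms(1) Suc[of 0]] by simp
  next
    case 2
    then show ?thesis
      using bounded_rv_add[OF bounded_rv_mult[OF assms(1) Suc[of 1]] bounded_rv_mult[OF assms(2) Suc[of 0]]] by simp
  next
    case 3
    then show ?thesis
      using bounded_rv_add[OF bounded_rv_mult[OF assms(1) Suc[of j]]
        bounded_rv_add[OF bounded_rv_mult[OF assms(2) Suc[of "Suc i"]] bounded_rv_mult[OF assms(3) Suc[of i]]]] by simp
  qed
qed

text \<open>A Givens matrix whose row 0 is (1, t c) divided by sqrt(1 + t^2), in the columns 0 and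
  l, replaces the corner entry by a normalized combination of two entries. Left invariance and
  clearing the denominator give an identity between polynomials in t.\<close>

lemma rotated_entry_moment:
  assumes l: "0 < l" "l < n" and c: "cmod c = 1"
  shows "(\<integral>U. ((cmod (U $$ (0, 0) + of_real t * (c * U $$ (l, 0))))\<^sup>2) ^ K \<partial>H)
    = (1 + t\<^sup>2) ^ K * (\<integral>U. ((cmod (U $$ (0, 0)))\<^sup>2) ^ K \<partial>H)"
proof -
  define r where "r = sqrt (1 + t\<^sup>2)"
  have r: "0 < r" "r\<^sup>2 = 1 + t\<^sup>2" by (auto simp: r_def real_sqrt_gt_zero add_pos_nonneg)
  have nz: "1 + t\<^sup>2 \<noteq> 0" using r by (metis zero_less_power less_irrefl)
  let ?a = "1 / of_real r :: complex" and ?b = "cnj c * of_real t / of_real r"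
  have ab: "(cmod ?a)\<^sup>2 + (cmod ?b)\<^sup>2 = 1"
    using r c nz by (simp add: norm_divide norm_mult power_divide power_mult_distrib add_divide_distrib[symmetric])
  have G: "givens n l ?a ?b \<in> unitary_group n" using givens_unitary[OF l ab] .
  have m: "(\<lambda>U. ((cmod (U $$ (0, 0)))\<^sup>2) ^ K) \<in> borel_measurable (unitary_borel n)"
    using bounded_rv_norm[of 0] l by (auto simp: bounded_rv_def)
  have "(\<integral>U. ((cmod (U $$ (0, 0)))\<^sup>2) ^ K \<partial>H) = (\<integral>U. ((cmod ((givens n l ?a ?b * U) $$ (0, 0)))\<^sup>2) ^ K \<partial>H)"
    by (rule left_invariant_integral[OF G m, symmetric])
  also have "\<dots> = (\<integral>U. 1 / (1 + t\<^sup>2) ^ K * ((cmod (U $$ (0, 0) + of_real t * (c * U $$ (l, 0))))\<^sup>2) ^ K \<partial>H)"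
  proof (rule Bochner_Integration.integral_cong[OF refl])
    fix U assume "U \<in> space H"
    then have U: "U \<in> carrier_mat n n" by (simp add: unitary_group_carrier)
    have "(givens n l ?a ?b * U) $$ (0, 0) = (U $$ (0, 0) + of_real t * (c * U $$ (l, 0))) / of_real r"
      unfolding givens_mult_00[OF l U] by (simp add: add_divide_distrib ac_simps)
    then show "((cmod ((givens n l ?a ?b * U) $$ (0, 0)))\<^sup>2) ^ K =
      1 / (1 + t\<^sup>2) ^ K * ((cmod (U $$ (0, 0) + of_real t * (c * U $$ (l, 0))))\<^sup>2) ^ K"
      using r nz by (simp add: norm_divide power_divide)
  qed
  finally show ?thesis using nz by simp
qed

text \<open>Comparing the coefficients of \<open>t\<^sup>2\<close> in \<open>E |x + t c y|\<^sup>2\<^sup>K = (1 + t\<^sup>2)\<^sup>K E |x|\<^sup>2\<^sup>K\<close>.\<close>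

lemma rotated_entry_coeff:
  assumes l: "0 < l" "l < n" and c: "cmod c = 1" and K: "1 \<le> K"
  shows "(\<integral>U. real K * ((cmod (U $$ (0, 0)))\<^sup>2) ^ (K - 1) * (cmod (U $$ (l, 0)))\<^sup>2 +
     real K * (real K - 1) / 2 * ((cmod (U $$ (0, 0)))\<^sup>2) ^ (K - 2) * (2 * Re (c * U $$ (l, 0) * cnj (U $$ (0, 0))))\<^sup>2 \<partial>H)
    = real K * (\<integral>U. ((cmod (U $$ (0, 0)))\<^sup>2) ^ K \<partial>H)"
proof -
  let ?s = "\<lambda>U. (cmod (U $$ (0, 0)))\<^sup>2" and ?y = "\<lambda>U. 2 * Re (c * U $$ (l, 0) * cnj (U $$ (0, 0)))"
    and ?z = "\<lambda>U. (cmod (U $$ (l, 0)))\<^sup>2"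
  let ?P = "\<lambda>U. [:?s U, ?y U, ?z U:]" and ?m = "\<integral>U. ?s U ^ K \<partial>H"
  have b: "bounded_rv ?s" "bounded_rv ?y" "bounded_rv ?z"
    using bounded_rv_norm[of 0] bounded_rv_norm[of l] bounded_rv_cmult[OF bounded_rv_Re[of l c], of 2] l c by simp_all
  have co: "bounded_rv (\<lambda>U. coeff (?P U ^ K) j)" for j
    by (rule bounded_rv_coeff_power[OF b])
  have deg: "degree (?P U ^ K) \<le> 2 * K" for U
  proof -
    have "degree (?P U) \<le> 2" by simp
    then show ?thesis using degree_power_le[of "?P U" K] by (meson mult_le_mono1 order_trans mult.commute)
  qed
  have deg1: "degree ([:1, 0, 1:] ^ K :: real poly) \<le> 2 * K"
    using degree_power_le[of "[:1, 0, 1:] :: real poly" K] by simp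
  have "(\<Sum>j\<le>2 * K. (\<integral>U. coeff (?P U ^ K) j \<partial>H) * t ^ j) = (\<Sum>j\<le>2 * K. (?m * coeff ([:1, 0, 1:] ^ K) j) * t ^ j)" for t
  proof -
    have "(\<Sum>j\<le>2 * K. (\<integral>U. coeff (?P U ^ K) j \<partial>H) * t ^ j) = (\<integral>U. (\<Sum>j\<le>2 * K. coeff (?P U ^ K) j * t ^ j) \<partial>H)"
      using bounded_rv_integrable[OF co] by (subst Bochner_Integration.integral_sum) auto
    also have "\<dots> = (\<integral>U. ((cmod (U $$ (0, 0) + of_real t * (c * U $$ (l, 0))))\<^sup>2) ^ K \<partial>H)"
    proof (rule Bochner_Integration.integral_cong[OF refl])
      fix U
      have "(cmod (U $$ (0, 0) + of_real t * (c * U $$ (l, 0))))\<^sup>2 =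
        ?s U + 2 * t * Re (c * U $$ (l, 0) * cnj (U $$ (0, 0))) + t\<^sup>2 * (cmod (c * U $$ (l, 0)))\<^sup>2"
        unfolding cmod_power2 by (simp add: power2_eq_square algebra_simps)
      also have "\<dots> = poly (?P U) t" using c by (simp add: norm_mult power2_eq_square algebra_simps)
      finally have P: "(cmod (U $$ (0, 0) + of_real t * (c * U $$ (l, 0))))\<^sup>2 = poly (?P U) t" .
      show "(\<Sum>j\<le>2 * K. coeff (?P U ^ K) j * t ^ j) = ((cmod (U $$ (0, 0) + of_real t * (c * U $$ (l, 0))))\<^sup>2) ^ K"
        unfolding P poly_eq_sum_upto[OF deg, symmetric] poly_power ..
    qed
    also have "\<dots> = ?m * poly ([:1, 0, 1:] ^ K) t"
      unfolding rotated_entry_moment[OF l c] by (simp add: poly_power power2_eq_square)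
    also have "\<dots> = (\<Sum>j\<le>2 * K. (?m * coeff ([:1, 0, 1:] ^ K) j) * t ^ j)"
      unfolding poly_eq_sum_upto[OF deg1] by (simp add: sum_distrib_left mult.assoc)
    finally show ?thesis .
  qed
  then have "(\<integral>U. coeff (?P U ^ K) 2 \<partial>H) = ?m * coeff ([:1, 0, 1:] ^ K) 2"
    using polyfun_eq_coeffs[where n = "2 * K" and c = "\<lambda>j. \<integral>U. coeff (?P U ^ K) j \<partial>H" and d = "\<lambda>j. ?m * coeff ([:1, 0, 1:] ^ K) j"] K by auto
  then show ?thesis unfolding coeff_quadratic_power by simp
qed

text \<open>Adding the coefficient identities for the phases c = 1 and c = \<i> turns the squared
  real part into a squared modulus, which leaves only moments of |x|^2 and |y|^2.\<close>

lemma mixed_moment: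
  assumes l: "0 < l" "l < n" and K: "1 \<le> K"
  shows "real K * (\<integral>U. ((cmod (U $$ (0, 0)))\<^sup>2) ^ (K - 1) * (cmod (U $$ (l, 0)))\<^sup>2 \<partial>H)
    = (\<integral>U. ((cmod (U $$ (0, 0)))\<^sup>2) ^ K \<partial>H)"
proof -
  let ?s = "\<lambda>U. (cmod (U $$ (0, 0)))\<^sup>2" and ?z = "\<lambda>U. (cmod (U $$ (l, 0)))\<^sup>2"
  let ?y = "\<lambda>c U. 2 * Re (c * U $$ (l, 0) * cnj (U $$ (0, 0)))"
  let ?f = "\<lambda>c U. real K * ?s U ^ (K - 1) * ?z U + real K * (real K - 1) / 2 * ?s U ^ (K - 2) * (?y c U)\<^sup>2"
  let ?m = "\<integral>U. ?s U ^ K \<partial>H"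
  have b: "bounded_rv ?s" "bounded_rv ?z" "\<And>c. cmod c = 1 \<Longrightarrow> bounded_rv (?y c)"
    using bounded_rv_norm[of 0] bounded_rv_norm[of l] bounded_rv_cmult[OF bounded_rv_Re[of l], of _ 2] l by simp_all
  have int: "integrable H (?f c)" if "cmod c = 1" for c
    by (intro bounded_rv_integrable bounded_rv_add bounded_rv_mult[OF bounded_rv_mult[OF bounded_rv_const bounded_rv_power[OF b(1)]]]
      b(2) bounded_rv_power[OF b(3)[OF that]])
  have "2 * (real K * ?m) = (\<integral>U. ?f 1 U \<partial>H) + (\<integral>U. ?f \<i> U \<partial>H)"
    using rotated_entry_coeff[OF l _ K, of 1] rotated_entry_coeff[OF l _ K, of \<i>] by simp
  also have "\<dots> = (\<integral>U. ?f 1 U + ?f \<i> U \<partial>H)"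
    using int[of 1] int[of \<i>] by (intro Bochner_Integration.integral_add[symmetric]) auto
  also have "\<dots> = (\<integral>U. 2 * (real K)\<^sup>2 * (?s U ^ (K - 1) * ?z U) \<partial>H)"
  proof (rule Bochner_Integration.integral_cong[OF refl])
    fix U
    have y: "(?y 1 U)\<^sup>2 + (?y \<i> U)\<^sup>2 = 4 * (?s U * ?z U)"
      unfolding cmod_power2 by (simp add: power2_eq_square algebra_simps)
    have "?f 1 U + ?f \<i> U = 2 * real K * ?s U ^ (K - 1) * ?z U + real K * (real K - 1) / 2 * ?s U ^ (K - 2) * ((?y 1 U)\<^sup>2 + (?y \<i> U)\<^sup>2)"
      by (simp only: distrib_left)
    also have "\<dots> = 2 * real K * ?s U ^ (K - 1) * ?z U + 2 * (real K * (real K - 1)) * (?s U ^ (K - 2) * ?s U) * ?z U"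
      unfolding y by simp
    also have "\<dots> = 2 * real K * ?s U ^ (K - 1) * ?z U + 2 * (real K * (real K - 1) * (?s U ^ (K - 2) * ?s U)) * ?z U"
      by (simp only: mult.assoc)
    also have "real K * (real K - 1) * (?s U ^ (K - 2) * ?s U) = real K * (real K - 1) * ?s U ^ (K - 1)"
    proof (cases "K = 1")
      case False
      then have "K - 1 = Suc (K - 2)" using K by simp
      then show ?thesis by (simp only: power_Suc mult.commute)
    qed simp
    also have "2 * real K * ?s U ^ (K - 1) * ?z U + 2 * (real K * (real K - 1) * ?s U ^ (K - 1)) * ?z U
       = 2 * (real K)\<^sup>2 * (?s U ^ (K - 1) * ?z U)"
      by (simp add: power2_eq_square algebra_simps)
    finally show "?f 1 U + ?f \<i> U = 2 * (real K)\<^sup>2 * (?s U ^ (K - 1) * ?z U)" .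
  qed
  also have "\<dots> = 2 * (real K)\<^sup>2 * (\<integral>U. ?s U ^ (K - 1) * ?z U \<partial>H)" by simp
  finally show ?thesis using K by (simp add: power2_eq_square)
qed

text \<open>The first column has norm 1. Multiplying this by |x|^(2K-2), with x the corner entry,
  and integrating, each of the n - 1 other entries contributes the same amount by
  \<open>mixed_moment\<close>.\<close>

lemma moment_recursion:
  assumes n: "0 < n" and K: "1 \<le> K"
  shows "real K * ((\<integral>U. ((cmod (U $$ (0, 0)))\<^sup>2) ^ (K - 1) \<partial>H) - (\<integral>U. ((cmod (U $$ (0, 0)))\<^sup>2) ^ K \<partial>H))
    = (real n - 1) * (\<integral>U. ((cmod (U $$ (0, 0)))\<^sup>2) ^ K \<partial>H)"
proof -
  let ?s = "\<lambda>U. (cmod (U $$ (0, 0)))\<^sup>2" and ?z = "\<lambda>l U. (cmod (U $$ (l, 0)))\<^sup>2"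
  let ?m = "\<integral>U. ?s U ^ K \<partial>H"
  have b: "\<And>l. l < n \<Longrightarrow> bounded_rv (?z l)" by (rule bounded_rv_norm)
  have split: "{..<n} = insert 0 {1..<n}" using n by auto
  have "(\<integral>U. ?s U ^ (K - 1) \<partial>H) = (\<integral>U. ?s U ^ K + (\<Sum>l\<in>{1..<n}. ?s U ^ (K - 1) * ?z l U) \<partial>H)"
  proof (rule Bochner_Integration.integral_cong[OF refl])
    fix U assume "U \<in> space H"
    then have "(\<Sum>k<n. ?z k U) = 1" using unitary_col_norm[of U n 0] n by simp
    then have 1: "?s U + (\<Sum>l\<in>{1..<n}. ?z l U) = 1" unfolding split by simp
    have "?s U ^ (K - 1) = ?s U ^ (K - 1) * (?s U + (\<Sum>l\<in>{1..<n}. ?z l U))" unfolding 1 by simp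
    also have "\<dots> = ?s U ^ (K - 1) * ?s U + (\<Sum>l\<in>{1..<n}. ?s U ^ (K - 1) * ?z l U)"
      by (simp only: distrib_left sum_distrib_left)
    also have "?s U ^ (K - 1) * ?s U = ?s U ^ K" using K by (simp add: power_eq_if mult.commute)
    finally show "?s U ^ (K - 1) = ?s U ^ K + (\<Sum>l\<in>{1..<n}. ?s U ^ (K - 1) * ?z l U)" .
  qed
  also have "\<dots> = ?m + (\<Sum>l\<in>{1..<n}. (\<integral>U. ?s U ^ (K - 1) * ?z l U \<partial>H))"
  proof -
    have i: "integrable H (\<lambda>U. ?s U ^ (K - 1) * ?z l U)" if "l \<in> {1..<n}" for l
      using that by (intro bounded_rv_integrable bounded_rv_mult[OF bounded_rv_power[OF b[OF n]] b]) auto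
    have "integrable H (\<lambda>U. ?s U ^ K)" by (rule bounded_rv_integrable[OF bounded_rv_power[OF b[OF n]]])
    then show ?thesis using i
      by (subst Bochner_Integration.integral_add) (auto simp: Bochner_Integration.integral_sum intro!: Bochner_Integration.integrable_sum)
  qed
  finally have e1: "(\<integral>U. ?s U ^ (K - 1) \<partial>H) = ?m + (\<Sum>l\<in>{1..<n}. (\<integral>U. ?s U ^ (K - 1) * ?z l U \<partial>H))" .
  have "real K * (\<Sum>l\<in>{1..<n}. (\<integral>U. ?s U ^ (K - 1) * ?z l U \<partial>H)) = (\<Sum>l\<in>{1..<n}. ?m)"
    unfolding sum_distrib_left
  proof (rule sum.cong[OF refl])
    fix l assume "l \<in> {1..<n}"
    then show "real K * (\<integral>U. ?s U ^ (K - 1) * ?z l U \<partial>H) = ?m" using mixed_moment[of l K] K by simp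
  qed
  also have "\<dots> = (real n - 1) * ?m" using n by (simp add: of_nat_diff)
  finally show ?thesis unfolding e1 by (simp add: algebra_simps)
qed

end

text \<open>The Beta(1, p+1) distribution; p = n - 2 for matrices of size n.\<close>

definition entry_law :: "nat \<Rightarrow> real measure" where
  "entry_law p = density lborel (\<lambda>t. ennreal (real (Suc p) * (1 - t) ^ p) * indicator {0..1} t)"

lemma sets_entry_law [simp]: "sets (entry_law p) = sets borel"
  by (simp add: entry_law_def)

lemma nn_integral_entry_law:
  "f \<in> borel_measurable borel \<Longrightarrow>
    (\<integral>\<^sup>+t. f t \<partial>entry_law p) = (\<integral>\<^sup>+t. ennreal (real (Suc p) * (1 - t) ^ p) * indicator {0..1} t * f t \<partial>lborel)"
  unfolding entry_law_def by (subst nn_integral_density) auto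

lemma one_minus_power_deriv:
  fixes t :: real
  shows "((\<lambda>t. (1 - t) ^ Suc p) has_real_derivative - (real (Suc p) * (1 - t) ^ p)) (at t)"
proof -
  have "((\<lambda>t::real. 1 - t) has_real_derivative - 1) (at t)" by (auto intro!: derivative_eq_intros)
  from DERIV_power[OF this, of "Suc p"] show ?thesis by simp
qed

lemma emeasure_entry_law:
  assumes "0 \<le> a" "a \<le> b" "b \<le> 1"
  shows "emeasure (entry_law p) {a..b} = ennreal ((1 - a) ^ Suc p - (1 - b) ^ Suc p)"
proof -
  have "emeasure (entry_law p) {a..b} = (\<integral>\<^sup>+t. ennreal (real (Suc p) * (1 - t) ^ p) * indicator {0..1} t * indicator {a..b} t \<partial>lborel)"
    unfolding entry_law_def by (subst emeasure_density) auto
  also have "\<dots> = (\<integral>\<^sup>+t. ennreal (real (Suc p) * (1 - t) ^ p) * indicator {a..b} t \<partial>lborel)"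
    using assms by (intro nn_integral_cong) (auto split: split_indicator)
  also have "\<dots> = ennreal (- ((1 - b) ^ Suc p) - (- ((1 - a) ^ Suc p)))"
    using assms
    by (intro nn_integral_FTC_Icc[where F = "\<lambda>t. - ((1 - t) ^ Suc p)"] DERIV_cong[OF DERIV_minus[OF one_minus_power_deriv]]) auto
  finally show ?thesis by simp
qed

lemma real_distribution_entry_law: "real_distribution (entry_law p)"
proof (intro real_distribution.intro real_distribution_axioms.intro prob_spaceI)
  have "emeasure (entry_law p) (space (entry_law p)) = (\<integral>\<^sup>+t. ennreal (real (Suc p) * (1 - t) ^ p) * indicator {0..1} t * indicator UNIV t \<partial>lborel)"
    unfolding entry_law_def by (subst emeasure_density) auto
  also have "\<dots> = emeasure (entry_law p) {0..1}"
    unfolding entry_law_def by (subst emeasure_density) (auto intro!: nn_integral_cong split: split_indicator)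
  finally show "emeasure (entry_law p) (space (entry_law p)) = 1" by (simp add: emeasure_entry_law)
qed simp

lemma entry_law_moment_bochner:
  "has_bochner_integral lborel (\<lambda>t. (real (Suc p) * (1 - t) ^ p * t ^ k) * indicator {0..1} t) (1 / real ((p + Suc k) choose k))"
proof (induction k)
  case 0
  have "has_bochner_integral lborel (\<lambda>t. (real (Suc p) * (1 - t) ^ p) * indicator {0..1} t) (- ((1 - 1) ^ Suc p) - (- ((1 - 0) ^ Suc p)))"
    by (intro has_bochner_integral_FTC_Icc_real[where F = "\<lambda>t. - ((1 - t) ^ Suc p)"] DERIV_cong[OF DERIV_minus[OF one_minus_power_deriv]])
      (auto intro!: continuous_intros)
  then show ?case by simp
next
  case (Suc k)
  let ?f = "\<lambda>k t. (real (Suc p) * (1 - t) ^ p * t ^ k) * indicator {0..1} (t::real)"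
  let ?M = "1 / real ((p + Suc k) choose k)"
  \<comment> \<open>The derivative of t^(k+1) (1-t)^(p+1), whose boundary values vanish. Subtracting
    a multiple of it from the k-th integrand produces a multiple of the next one.\<close>
  have "has_bochner_integral lborel (\<lambda>t. (real (Suc k) * t ^ k * (1 - t) ^ Suc p - real (Suc p) * (1 - t) ^ p * t ^ Suc k) * indicator {0..1} t)
     (1 ^ Suc k * (1 - 1) ^ Suc p - 0 ^ Suc k * (1 - 0) ^ Suc p)"
    by (intro has_bochner_integral_FTC_Icc_real[where F = "\<lambda>t. t ^ Suc k * (1 - t) ^ Suc p"]
      DERIV_cong[OF DERIV_mult[OF DERIV_pow[of "Suc k"] one_minus_power_deriv]])
      (auto intro!: continuous_intros simp: algebra_simps)
  then have d: "has_bochner_integral lborel (\<lambda>t. (real (Suc k) * t ^ k * (1 - t) ^ Suc p - real (Suc p) * (1 - t) ^ p * t ^ Suc k) * indicator {0..1} t) 0"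
    by simp
  have "has_bochner_integral lborel (\<lambda>t. (real (Suc k) * ?f k t - real (Suc p) * ((real (Suc k) * t ^ k * (1 - t) ^ Suc p - real (Suc p) * (1 - t) ^ p * t ^ Suc k) * indicator {0..1} t))
       / (real (Suc k) + real (Suc p))) ((real (Suc k) * ?M - real (Suc p) * 0) / (real (Suc k) + real (Suc p)))"
    by (intro has_bochner_integral_divide has_bochner_integral_diff has_bochner_integral_mult_right Suc d)
  moreover have "(real (Suc k) * ?f k t - real (Suc p) * ((real (Suc k) * t ^ k * (1 - t) ^ Suc p - real (Suc p) * (1 - t) ^ p * t ^ Suc k) * indicator {0..1} t))
       / (real (Suc k) + real (Suc p)) = ?f (Suc k) t" for t
    by (simp add: field_simps split: split_indicator)
  moreover have "(real (Suc k) * ?M - real (Suc p) * 0) / (real (Suc k) + real (Suc p)) = 1 / real ((p + Suc (Suc k)) choose Suc k)"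
  proof -
    have "Suc k * ((p + Suc (Suc k)) choose Suc k) = (p + Suc (Suc k)) * ((p + Suc k) choose k)"
      using Suc_times_binomial_eq[of "p + Suc k" k] by (simp add: mult.commute)
    then have "real (Suc k) * real ((p + Suc (Suc k)) choose Suc k) = (real (Suc k) + real (Suc p)) * real ((p + Suc k) choose k)"
      by (simp only: of_nat_mult[symmetric] of_nat_add[symmetric]) simp
    moreover have "0 < real ((p + Suc k) choose k)" "0 < real ((p + Suc (Suc k)) choose Suc k)" by (simp_all del: binomial_Suc_Suc)
    ultimately show ?thesis by (simp add: divide_simps del: binomial_Suc_Suc)
  qed
  ultimately show ?case by simp
qed

lemma entry_law_moment:
  "integrable (entry_law p) (\<lambda>t. t ^ k)" "(\<integral>t. t ^ k \<partial>entry_law p) = 1 / real ((p + Suc k) choose k)"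
proof -
  let ?g = "\<lambda>t. real (Suc p) * (1 - t) ^ p * indicator {0..1} (t::real)"
  have e: "entry_law p = density lborel (\<lambda>t. ennreal (?g t))"
    unfolding entry_law_def by (intro density_cong) (auto split: split_indicator)
  have eq: "?g t *\<^sub>R t ^ k = (real (Suc p) * (1 - t) ^ p * t ^ k) * indicator {0..1} t" for t by (simp add: ac_simps)
  have nn: "AE t in lborel. 0 \<le> ?g t" by (auto split: split_indicator)
  have mg: "?g \<in> borel_measurable lborel" and mf: "(\<lambda>t::real. t ^ k) \<in> borel_measurable lborel" by measurable
  show "integrable (entry_law p) (\<lambda>t. t ^ k)"
    unfolding e integrable_density[OF mf mg nn] eq
    using entry_law_moment_bochner[of p k] by (simp only: has_bochner_integral_iff)
  show "(\<integral>t. t ^ k \<partial>entry_law p) = 1 / real ((p + Suc k) choose k)"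
    unfolding e integral_density[OF mf mg nn] eq
    using entry_law_moment_bochner[of p k] by (simp only: has_bochner_integral_iff)
qed

text \<open>On the unit interval all absolute moments are at most 1, so the Taylor sums of the
  characteristic function, which involve only the moments, converge to it with error 2|t|^n /
  n!.\<close>

lemma moments_determine_law:
  assumes M: "real_distribution M" "real_distribution N"
    and AE: "AE x in M. x \<in> {0..1}" "AE x in N. x \<in> {0..1}"
    and moments: "\<And>k. (\<integral>x. x ^ k \<partial>M) = (\<integral>x. x ^ k \<partial>N)"
  shows "M = N"
proof (rule Levy_uniqueness[OF M], rule ext)
  fix t :: real
  let ?s = "\<lambda>L n. \<Sum>k\<le>n. ((\<i> * t) ^ k / fact k) * complex_of_real (\<integral>x. x ^ k \<partial>L)"
  have bound: "cmod (char L t - ?s L n) \<le> 2 * \<bar>t\<bar> ^ n / fact n"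
    if L: "real_distribution L" "AE x in L. x \<in> {0..1}" for L :: "real measure" and n
  proof -
    interpret L: real_distribution L by fact
    have le1: "AE x in L. norm (x ^ k) \<le> 1" for k
      using L(2) by eventually_elim (simp add: power_le_one)
    have int: "integrable L (\<lambda>x. x ^ k)" for k
      using le1[of k] by (intro L.integrable_const_bound[of _ 1]) auto
    have "(\<integral>x. \<bar>x\<bar> ^ n \<partial>L) \<le> (\<integral>x. 1 \<partial>L)"
      using le1[of n] int[of n] unfolding power_abs[symmetric] by (intro integral_mono_AE) auto
    then have "(\<integral>x. \<bar>x\<bar> ^ n \<partial>L) \<le> 1" by (simp add: L.prob_space[unfolded L.space_eq_univ])
    then have "(2 * \<bar>t\<bar> ^ n / fact n) * (\<integral>x. \<bar>x\<bar> ^ n \<partial>L) \<le> 2 * \<bar>t\<bar> ^ n / fact n"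
      by (intro mult_left_le) auto
    then show ?thesis using L.char_approx1[of n t, OF int] by (rule order_trans[rotated])
  qed
  have "(\<lambda>n. inverse (fact n) * \<bar>t\<bar> ^ n) \<longlonglongrightarrow> 0"
    by (rule summable_LIMSEQ_zero[OF summable_exp])
  then have "(\<lambda>n. 2 * (inverse (fact n) * \<bar>t\<bar> ^ n)) \<longlonglongrightarrow> 2 * 0" by (intro tendsto_mult tendsto_const)
  then have lim: "(\<lambda>n. 2 * \<bar>t\<bar> ^ n / fact n) \<longlonglongrightarrow> 0" by (simp add: divide_inverse ac_simps)
  have conv: "?s L \<longlonglongrightarrow> char L t" if "real_distribution L" "AE x in L. x \<in> {0..1}" for L
  proof -
    have "(\<lambda>n. char L t - ?s L n) \<longlonglongrightarrow> 0"
      using bound[OF that] by (intro Lim_null_comparison[OF _ lim] always_eventually) auto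
    then show ?thesis using tendsto_diff[OF tendsto_const[of "char L t"]] by fastforce
  qed
  have "?s M = ?s N" by (simp only: moments)
  then show "char M t = char N t"
    using conv[OF M(1) AE(1)] conv[OF M(2) AE(2)] LIMSEQ_unique by metis
qed

lemma AE_entry_law: "AE t in entry_law p. t \<in> {0..1}"
  unfolding entry_law_def by (subst AE_density) (auto split: split_indicator)

context haar
begin

text \<open>Both laws live on the unit interval and their moments obey the same recursion with
  factor (k+1)/(k+p+2). Size at least 2 matters: for n = 1 the entry is unimodular and its law has
  no density.\<close>

lemma entry_law:
  assumes n: "n = Suc (Suc p)"
  shows "distr H borel (\<lambda>U. (cmod (U $$ (0, 0)))\<^sup>2) = entry_law p"
proof (rule moments_determine_law[OF _ real_distribution_entry_law _ AE_entry_law])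
  let ?s = "\<lambda>U. (cmod (U $$ (0, 0)))\<^sup>2"
  have m: "?s \<in> borel_measurable H" using n by (intro entry_norm_measurable) simp
  show "real_distribution (distr H borel ?s)" by (rule real_distribution_distr[OF m])
  show "AE x in distr H borel ?s. x \<in> {0..1}"
    using col0_le_1[of _ 0] n by (subst AE_distr_iff[OF m]) (auto intro!: AE_I2 power_le_one)
  fix k
  have "(\<integral>x. x ^ k \<partial>distr H borel ?s) = (\<integral>U. ?s U ^ k \<partial>H)" by (rule integral_distr[OF m]) simp
  also have "\<dots> = 1 / real ((p + Suc k) choose k)"
  proof (induction k)
    case (Suc k)
    let ?m = "\<integral>U. ?s U ^ Suc k \<partial>H"
    have "real (Suc k) * (1 / real ((p + Suc k) choose k) - ?m) = real (Suc p) * ?m"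
      using moment_recursion[of "Suc k"] n unfolding diff_Suc_1 Suc by simp
    then have 1: "(real (Suc k) + real (Suc p)) * ?m = real (Suc k) / real ((p + Suc k) choose k)"
      by (simp add: algebra_simps)
    have "Suc k * ((p + Suc (Suc k)) choose Suc k) = (p + Suc (Suc k)) * ((p + Suc k) choose k)"
      using Suc_times_binomial_eq[of "p + Suc k" k] by (simp add: mult.commute)
    then have 2: "real (Suc k) * real ((p + Suc (Suc k)) choose Suc k) = (real (Suc k) + real (Suc p)) * real ((p + Suc k) choose k)"
      by (simp only: of_nat_mult[symmetric] of_nat_add[symmetric]) simp
    have pos: "real ((p + Suc k) choose k) \<noteq> 0" "real ((p + Suc (Suc k)) choose Suc k) \<noteq> 0"
      by (simp_all del: binomial_Suc_Suc)
    have "real (Suc k) * (real ((p + Suc (Suc k)) choose Suc k) * ?m) = real ((p + Suc k) choose k) * ((real (Suc k) + real (Suc p)) * ?m)"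
      unfolding mult.assoc[symmetric] 2 by (simp only: ac_simps)
    also have "\<dots> = real (Suc k)" unfolding 1 using pos(1) by simp
    finally have "real ((p + Suc (Suc k)) choose Suc k) * ?m = 1" by simp
    then show ?case using pos(2) by (simp add: eq_divide_eq mult.commute del: binomial_Suc_Suc power_Suc)
  qed (simp add: prob_space[simplified])
  finally show "(\<integral>x. x ^ k \<partial>distr H borel ?s) = (\<integral>x. x ^ k \<partial>entry_law p)"
    by (simp only: entry_law_moment(2))
qed

end

section \<open>Independence of the coefficients\<close>

text \<open>From U (1 \<oplus> K) = (1 \<oplus> K) G (1 \<oplus> Z), the product U (1 \<oplus> W) is
  conjugate under 1 \<oplus> K to G (1 \<oplus> A W K) with \<open>A = Z * mat_adjoint K\<close>.
  The Schur step strips off G. Both A and B = K depend on U but not on W, so Haar measure in W will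
  not notice them.\<close>

lemma krylov_alpha_corner_step:
  assumes U: "U \<in> unitary_group (Suc m)" and m: "0 < m" and a: "cmod (U $$ (0, 0)) < 1"
  shows "\<exists>A\<in>unitary_group m. \<exists>B\<in>unitary_group m. \<forall>W\<in>unitary_group m.
    krylov_alpha (U * mat_corner 1 W) 0 = cnj (U $$ (0, 0)) \<and>
    (\<forall>k. krylov_alpha (U * mat_corner 1 W) (Suc k) = krylov_alpha (A * W * B) k)"
proof -
  let ?N = "Suc m"
  obtain K Z r where K: "K \<in> unitary_group m" and Z: "Z \<in> unitary_group m" and r: "0 < r"
      "(cmod (U $$ (0, 0)))\<^sup>2 + r\<^sup>2 = 1"
    and fac: "U * mat_corner 1 K = mat_corner 1 K * (givens ?N (Suc 0) (U $$ (0, 0)) (of_real r) * mat_corner 1 Z)"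
    using unitary_corner_givens_factorization[OF U m a] by blast
  let ?G = "givens ?N (Suc 0) (U $$ (0, 0)) (of_real r)" and ?K = "mat_corner 1 K"
  have c: "U \<in> carrier_mat ?N ?N" "K \<in> carrier_mat m m" "Z \<in> carrier_mat m m"
    using U K Z by (auto intro: unitary_group_carrier)
  have "krylov_alpha (U * mat_corner 1 W) 0 = cnj (U $$ (0, 0)) \<and>
    (\<forall>k. krylov_alpha (U * mat_corner 1 W) (Suc k) = krylov_alpha ((Z * mat_adjoint K) * W * K) k)"
    if W: "W \<in> unitary_group m" for W
  proof -
    have Wc: "W \<in> carrier_mat m m" using W by (rule unitary_group_carrier)
    let ?X = "mat_adjoint K * W * K" and ?V = "U * mat_corner 1 W"
    have Xc: "?X \<in> carrier_mat m m" using c Wc by (simp add: mult_carrier_mat[of _ m m _ m])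
    have "K * ?X = (K * mat_adjoint K) * (W * K)"
      using c Wc by (simp add: assoc_mult_mat[of _ m m _ m _ m] mult_carrier_mat[of _ m m _ m])
    then have KX: "K * ?X = W * K"
      using c Wc by (simp add: unitary_group_adjoint_right[OF K] mult_carrier_mat[of _ m m _ m])
    have "?V * ?K = U * (mat_corner 1 W * ?K)"
      using c Wc by (intro assoc_mult_mat[of _ ?N ?N _ ?N _ ?N]) auto
    also have "mat_corner 1 W * ?K = ?K * mat_corner 1 ?X"
      using c Wc Xc by (simp add: mat_corner_mult[of _ m m _ m] KX)
    also have "U * (?K * mat_corner 1 ?X) = (U * ?K) * mat_corner 1 ?X"
      using c Xc by (intro assoc_mult_mat[symmetric, of _ ?N ?N _ ?N _ ?N]) auto
    also have "\<dots> = ?K * (?G * mat_corner 1 Z) * mat_corner 1 ?X" by (simp only: fac)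
    also have "\<dots> = ?K * (?G * (mat_corner 1 Z * mat_corner 1 ?X))"
      using c Xc by (simp add: assoc_mult_mat[of _ ?N ?N _ ?N _ ?N] mult_carrier_mat[of _ ?N ?N _ ?N])
    also have "mat_corner 1 Z * mat_corner 1 ?X = mat_corner 1 (Z * ?X)"
      using c Xc by (simp add: mat_corner_mult[of _ m m _ m])
    finally have VK: "?V * ?K = ?K * (?G * mat_corner 1 (Z * ?X))" .
    have ZX: "Z * ?X \<in> unitary_group m"
      using K Z W by (intro unitary_group_mult unitary_group_adjoint)
    have ZXc: "Z * ?X \<in> carrier_mat m m" using ZX by (rule unitary_group_carrier)
    have K': "?K \<in> unitary_group ?N" using K by (intro mat_corner_unitary) auto
    have e0: "unit_vec ?N 0 = vCons 1 (0\<^sub>v m)"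
      by (rule eq_vecI) (auto simp: vec_index_vCons)
    have Ke: "?K *\<^sub>v unit_vec ?N 0 = unit_vec ?N 0"
      unfolding e0 using c by (simp add: mat_corner_mult_vec[of _ m m])
    have eq: "krylov_alpha ?V k = krylov_alpha (?G * mat_corner 1 (Z * ?X)) k" for k
      by (rule krylov_alpha_intertwine[OF K' Ke _ _ VK])
        (use c Wc ZXc in \<open>auto intro!: mult_carrier_mat[of _ ?N ?N _ ?N]\<close>)
    have "Z * ?X = (Z * mat_adjoint K) * W * K"
      using c Wc by (simp add: assoc_mult_mat[of _ m m _ m _ m] mult_carrier_mat[of _ m m _ m])
    then show ?thesis
      unfolding eq using krylov_schur_step[OF m ZX r krylov_orthogonal[OF m ZX]] by simp
  qed
  moreover have "Z * mat_adjoint K \<in> unitary_group m" using K Z by (intro unitary_group_mult unitary_group_adjoint)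
  ultimately show ?thesis using K by blast
qed

lemma borel_measurable_If_unitary:
  "{U \<in> unitary_group n. Q U} \<in> sets (unitary_borel n) \<Longrightarrow>
    (\<lambda>U. if Q U then 1 else 0 :: ennreal) \<in> borel_measurable (unitary_borel n)"
  by (rule measurable_If) simp_all

context haar
begin

lemma nn_integral_entry:
  assumes n: "n = Suc (Suc p)" and f: "f \<in> borel_measurable borel"
  shows "(\<integral>\<^sup>+U. f ((cmod (U $$ (0, 0)))\<^sup>2) \<partial>H) = (\<integral>\<^sup>+t. f t \<partial>entry_law p)"
proof -
  have n0: "0 < n" using n by simp
  note m = entry_norm_measurable[OF n0]
  show ?thesis unfolding entry_law[OF n, symmetric] using m f by (subst nn_integral_distr) auto
qed

lemma emeasure_entry:
  assumes n: "n = Suc (Suc p)" and "0 \<le> a" "a \<le> b" "b \<le> 1"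
  shows "emeasure H {U \<in> unitary_group n. (cmod (U $$ (0, 0)))\<^sup>2 \<in> {a..b}} = ennreal ((1 - a) ^ Suc p - (1 - b) ^ Suc p)"
proof -
  have n0: "0 < n" using n by simp
  note m = entry_norm_measurable[OF n0]
  have "emeasure (distr H borel (\<lambda>U. (cmod (U $$ (0, 0)))\<^sup>2)) {a..b} =
      emeasure H ((\<lambda>U. (cmod (U $$ (0, 0)))\<^sup>2) -` {a..b} \<inter> space H)"
    by (rule emeasure_distr[OF m]) simp
  also have "(\<lambda>U. (cmod (U $$ (0, 0)))\<^sup>2) -` {a..b} \<inter> space H = {U \<in> unitary_group n. (cmod (U $$ (0, 0)))\<^sup>2 \<in> {a..b}}"
    by auto
  finally show ?thesis unfolding entry_law[OF n] emeasure_entry_law[OF assms(2-4)] ..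
qed

lemma AE_entry_less_1:
  assumes n: "n = Suc (Suc p)"
  shows "AE U in H. cmod (U $$ (0, 0)) < 1"
proof -
  have n0: "0 < n" using n by simp
  have "emeasure H {U \<in> unitary_group n. (cmod (U $$ (0, 0)))\<^sup>2 \<in> {1..1}} = 0"
    unfolding emeasure_entry[OF n zero_le_one order_refl order_refl] by simp
  moreover have "{U \<in> space H. \<not> cmod (U $$ (0, 0)) < 1} \<subseteq> {U \<in> unitary_group n. (cmod (U $$ (0, 0)))\<^sup>2 \<in> {1..1}}"
  proof
    fix U assume "U \<in> {U \<in> space H. \<not> cmod (U $$ (0, 0)) < 1}"
    then have U: "U \<in> unitary_group n" "1 \<le> cmod (U $$ (0, 0))" by auto
    then have "cmod (U $$ (0, 0)) = 1" using col0_le_1[OF U(1) n0] by simp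
    then show "U \<in> {U \<in> unitary_group n. (cmod (U $$ (0, 0)))\<^sup>2 \<in> {1..1}}" using U by simp
  qed
  moreover have "{U \<in> unitary_group n. (cmod (U $$ (0, 0)))\<^sup>2 \<in> {1..1}} \<in> sets H"
  proof -
    note m = entry_norm_measurable[OF n0]
    have "(\<lambda>U. (cmod (U $$ (0, 0)))\<^sup>2) -` {1..1} \<inter> space H \<in> sets H"
      by (rule measurable_sets[OF m]) simp
    also have "(\<lambda>U. (cmod (U $$ (0, 0)))\<^sup>2) -` {1..1} \<inter> space H = {U \<in> unitary_group n. (cmod (U $$ (0, 0)))\<^sup>2 \<in> {1..1}}"
      by auto
    finally show ?thesis .
  qed
  ultimately show ?thesis by (intro AE_I[of _ _ "{U \<in> unitary_group n. (cmod (U $$ (0, 0)))\<^sup>2 \<in> {1..1}}"]) auto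
qed

text \<open>Independence is phrased through integrals of a test function g, with measurability
  demanded only of the two composites with \<open>krylov_alpha\<close>; no \<sigma>-algebra on the
  space of sequences enters.\<close>

lemma nn_integral_krylov_alpha_split:
  assumes H': "haar m H'" and n: "n = Suc m" and m: "0 < m"
    and meas: "(\<lambda>U. g (krylov_alpha U 0) (\<lambda>k. krylov_alpha U (Suc k))) \<in> borel_measurable (unitary_borel n)"
    and meas': "\<And>c. (\<lambda>W. g c (krylov_alpha W)) \<in> borel_measurable (unitary_borel m)"
  shows "(\<integral>\<^sup>+U. g (krylov_alpha U 0) (\<lambda>k. krylov_alpha U (Suc k)) \<partial>H) =
    (\<integral>\<^sup>+U. \<integral>\<^sup>+W. g (cnj (U $$ (0, 0))) (krylov_alpha W) \<partial>H' \<partial>H)"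
proof -
  interpret W: haar m H' by fact
  interpret P: pair_sigma_finite H' H ..
  let ?F = "\<lambda>U. g (krylov_alpha U 0) (\<lambda>k. krylov_alpha U (Suc k))"
  have fst: "fst \<in> measurable (H' \<Otimes>\<^sub>M H) (unitary_borel m)" and snd: "snd \<in> measurable (H' \<Otimes>\<^sub>M H) (unitary_borel n)"
    using measurable_fst[of H' H] measurable_snd[of H' H] by simp_all
  have mm: "(\<lambda>(W, U). ?F (U * mat_corner 1 W)) \<in> borel_measurable (H' \<Otimes>\<^sub>M H)"
    unfolding case_prod_beta n
    by (rule measurable_compose[OF _ meas[unfolded n]])
      (intro measurable_mat_mult measurable_mat_corner fst snd[unfolded n])
  obtain p where p: "m = Suc p" using m by (cases m) auto
  have "(\<integral>\<^sup>+U. ?F U \<partial>H) = (\<integral>\<^sup>+W. (\<integral>\<^sup>+U. ?F U \<partial>H) \<partial>H')"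
    by (simp add: W.emeasure_space_1[simplified])
  also have "\<dots> = (\<integral>\<^sup>+W. \<integral>\<^sup>+U. ?F (U * mat_corner 1 W) \<partial>H \<partial>H')"
    by (intro nn_integral_cong right_invariant[symmetric] meas) (auto simp: n intro: mat_corner_unitary)
  also have "\<dots> = (\<integral>\<^sup>+U. \<integral>\<^sup>+W. ?F (U * mat_corner 1 W) \<partial>H' \<partial>H)"
    using P.Fubini'[OF mm] by simp
  also have "\<dots> = (\<integral>\<^sup>+U. \<integral>\<^sup>+W. g (cnj (U $$ (0, 0))) (krylov_alpha W) \<partial>H' \<partial>H)"
  \<comment> \<open>The corner entry of U has modulus below 1 almost surely. For such U the matrices
    A and B are fixed, and two-sided invariance of the law of W removes them.\<close>
  proof (rule nn_integral_cong_AE)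
    show "AE U in H. (\<integral>\<^sup>+W. ?F (U * mat_corner 1 W) \<partial>H') = (\<integral>\<^sup>+W. g (cnj (U $$ (0, 0))) (krylov_alpha W) \<partial>H')"
      using AE_entry_less_1[OF n[unfolded p]] AE_space
    proof eventually_elim
      case (elim U)
      then have U: "U \<in> unitary_group (Suc m)" using n by simp
      obtain A B where AB: "A \<in> unitary_group m" "B \<in> unitary_group m" and
        step: "\<And>W. W \<in> unitary_group m \<Longrightarrow> krylov_alpha (U * mat_corner 1 W) 0 = cnj (U $$ (0, 0)) \<and>
          (\<forall>k. krylov_alpha (U * mat_corner 1 W) (Suc k) = krylov_alpha (A * W * B) k)"
        using krylov_alpha_corner_step[OF U m elim(1)] by blast
      let ?g = "\<lambda>W. g (cnj (U $$ (0, 0))) (krylov_alpha W)"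
      have "(\<integral>\<^sup>+W. ?F (U * mat_corner 1 W) \<partial>H') = (\<integral>\<^sup>+W. ?g (A * W * B) \<partial>H')"
        using step by (intro nn_integral_cong) simp
      also have "\<dots> = (\<integral>\<^sup>+W. ?g (W * B) \<partial>H')"
        by (rule W.left_invariant[OF AB(1)], rule measurable_compose[OF W.right_mult_measurable[OF AB(2)] meas'])
      also have "\<dots> = (\<integral>\<^sup>+W. ?g W \<partial>H')"
        by (rule W.right_invariant[OF AB(2) meas'])
      finally show ?case .
    qed
  qed
  finally show ?thesis .
qed

lemma emeasure_eq_nn_integral:
  assumes "{U \<in> unitary_group n. Q U} \<in> sets (unitary_borel n)"
  shows "emeasure H {U \<in> unitary_group n. Q U} = (\<integral>\<^sup>+U. (if Q U then 1 else 0) \<partial>H)"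
proof -
  have "(\<integral>\<^sup>+U. (if Q U then 1 else 0) \<partial>H) = (\<integral>\<^sup>+U. indicator {U \<in> unitary_group n. Q U} U \<partial>H)"
    by (intro nn_integral_cong) (auto split: split_indicator)
  then show ?thesis using assms by simp
qed

end

section \<open>Upper bound for the probability of a small product\<close>

lemma vprod_krylov_measurable:
  "0 < n \<Longrightarrow> (\<lambda>U. vprod (krylov_alpha U) k) \<in> borel_measurable (unitary_borel n)"
  unfolding vprod_def using krylov_alpha_measurable[of n] by measurable

lemma vprod_less_sets:
  "0 < n \<Longrightarrow> {U \<in> unitary_group n. vprod (krylov_alpha U) k < \<delta>} \<in> sets (unitary_borel n)"
  using measurable_sets[OF vprod_krylov_measurable[of n k], of "{..<\<delta>}"]
  by (auto simp: vimage_def Int_def conj_commute)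

lemma emeasure_vprod_less:
  assumes H: "\<And>n. 1 \<le> n \<Longrightarrow> haar n (H n)"
  shows "k < n \<Longrightarrow> 0 < \<delta> \<Longrightarrow> emeasure (H n) {U \<in> unitary_group n. vprod (krylov_alpha U) k < \<delta>}
    \<le> ennreal (real n ^ k * \<delta> ^ (n - Suc k))"
proof (induction k arbitrary: n \<delta>)
  case 0
  interpret haar n "H n" using H 0 by simp
  show ?case
  \<comment> \<open>For \<delta> at most 1 the event is empty, because the empty product is
    1.\<close>
  proof (cases "1 < \<delta>")
    case True
    have "emeasure (H n) {U \<in> unitary_group n. vprod (krylov_alpha U) 0 < \<delta>} \<le> 1"
      by (rule emeasure_le_1)
    also have "1 \<le> ennreal (real n ^ 0 * \<delta> ^ (n - Suc 0))"
      using True by (simp add: one_le_power)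
    finally show ?thesis .
  qed simp
next
  case (Suc k)
  define m where "m = n - 1"
  have m: "n = Suc m" "k < m" "0 < m" using Suc.prems by (auto simp: m_def)
  obtain p where p: "m = Suc p" using m by (cases m) auto
  interpret haar n "H n" using H m by simp
  interpret W: haar m "H m" using H m by simp
  define e where "e = p - k"
  have e: "m - Suc k = e" "n - Suc (Suc k) = e" "e \<le> p" using m p by (auto simp: e_def)
  let ?g = "\<lambda>c a. if (1 - (cmod c)\<^sup>2) * vprod a k < \<delta> then 1 else 0 :: ennreal"
  have sets: "{U \<in> unitary_group n. vprod (krylov_alpha U) (Suc k) < \<delta>} \<in> sets (unitary_borel n)"
    using m by (intro vprod_less_sets) simp
  have "emeasure (H n) {U \<in> unitary_group n. vprod (krylov_alpha U) (Suc k) < \<delta>} =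
     (\<integral>\<^sup>+U. ?g (krylov_alpha U 0) (\<lambda>j. krylov_alpha U (Suc j)) \<partial>H n)"
    unfolding emeasure_eq_nn_integral[where Q = "\<lambda>U. vprod (krylov_alpha U) (Suc k) < \<delta>", OF sets] unfolding vprod_Suc_shift ..
  also have "\<dots> = (\<integral>\<^sup>+U. \<integral>\<^sup>+W. ?g (cnj (U $$ (0, 0))) (krylov_alpha W) \<partial>H m \<partial>H n)"
  proof (rule nn_integral_krylov_alpha_split[OF W.haar_axioms m(1,3)])
    have n0: "0 < n" using m by simp
    note [measurable] = vprod_krylov_measurable[OF n0] vprod_krylov_measurable[OF m(3)]
    show "(\<lambda>U. ?g (krylov_alpha U 0) (\<lambda>j. krylov_alpha U (Suc j))) \<in> borel_measurable (unitary_borel n)"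
      unfolding vprod_Suc_shift[symmetric] by measurable
    show "(\<lambda>W. ?g c (krylov_alpha W)) \<in> borel_measurable (unitary_borel m)" for c by measurable
  qed
  also have "\<dots> \<le> (\<integral>\<^sup>+U. ennreal (real m ^ k * (\<delta> / (1 - (cmod (U $$ (0, 0)))\<^sup>2)) ^ e) \<partial>H n)"
  proof (rule nn_integral_mono_AE)
    show "AE U in H n. (\<integral>\<^sup>+W. ?g (cnj (U $$ (0, 0))) (krylov_alpha W) \<partial>H m) \<le> ennreal (real m ^ k * (\<delta> / (1 - (cmod (U $$ (0, 0)))\<^sup>2)) ^ e)"
      using AE_entry_less_1[OF m(1)[unfolded p]]
    proof eventually_elim
      case (elim U)
      then have s: "0 < 1 - (cmod (U $$ (0, 0)))\<^sup>2" by (simp add: abs_square_less_1)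
      have "(\<integral>\<^sup>+W. ?g (cnj (U $$ (0, 0))) (krylov_alpha W) \<partial>H m) =
        emeasure (H m) {W \<in> unitary_group m. vprod (krylov_alpha W) k < \<delta> / (1 - (cmod (U $$ (0, 0)))\<^sup>2)}"
        unfolding W.emeasure_eq_nn_integral[where Q = "\<lambda>W. vprod (krylov_alpha W) k < \<delta> / (1 - (cmod (U $$ (0, 0)))\<^sup>2)", OF vprod_less_sets[OF m(3)]]
        using s by (intro nn_integral_cong) (simp add: pos_less_divide_eq mult.commute)
      also have "\<dots> \<le> ennreal (real m ^ k * (\<delta> / (1 - (cmod (U $$ (0, 0)))\<^sup>2)) ^ e)"
        using Suc.IH[OF m(2), of "\<delta> / (1 - (cmod (U $$ (0, 0)))\<^sup>2)"] s Suc.prems by (simp add: e)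
      finally show ?case .
    qed
  qed
  also have "\<dots> = (\<integral>\<^sup>+t. ennreal (real m ^ k * (\<delta> / (1 - t)) ^ e) \<partial>entry_law p)"
    by (rule nn_integral_entry[OF m(1)[unfolded p]]) measurable
  also have "\<dots> = (\<integral>\<^sup>+t. ennreal (real (Suc p) * (1 - t) ^ p) * indicator {0..1} t * ennreal (real m ^ k * (\<delta> / (1 - t)) ^ e) \<partial>lborel)"
    by (rule nn_integral_entry_law) measurable
  also have "\<dots> \<le> (\<integral>\<^sup>+t. ennreal (real (Suc p) * real m ^ k * \<delta> ^ e) * indicator {0..1::real} t \<partial>lborel)"
  proof (rule nn_integral_mono)
    fix t :: real
    show "ennreal (real (Suc p) * (1 - t) ^ p) * indicator {0..1} t * ennreal (real m ^ k * (\<delta> / (1 - t)) ^ e)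
      \<le> ennreal (real (Suc p) * real m ^ k * \<delta> ^ e) * indicator {0..1} t"
    proof (cases "t \<in> {0..1}")
      case True
      have "(1 - t) ^ p * (1 / (1 - t)) ^ e \<le> 1"
      \<comment> \<open>At t = 1 the quotient is 0 by convention, and a product of powers of 0 is at
        most 1.\<close>
      proof (cases "t = 1")
        case False
        then have "(1 - t) ^ p * (1 / (1 - t)) ^ e = (1 - t) ^ (p - e)"
          using e(3) by (simp add: power_diff power_one_over)
        also have "\<dots> \<le> 1" using True by (intro power_le_one) auto
        finally show ?thesis .
      qed (simp add: power_0_left)
      then have "(real (Suc p) * real m ^ k * \<delta> ^ e) * ((1 - t) ^ p * (1 / (1 - t)) ^ e) \<le> real (Suc p) * real m ^ k * \<delta> ^ e"
        using Suc.prems by (intro mult_left_le) auto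
      then have "real (Suc p) * (1 - t) ^ p * (real m ^ k * (\<delta> / (1 - t)) ^ e) \<le> real (Suc p) * real m ^ k * \<delta> ^ e"
        by (simp add: power_divide ac_simps del: of_nat_Suc)
      then have "ennreal (real (Suc p) * (1 - t) ^ p * (real m ^ k * (\<delta> / (1 - t)) ^ e)) \<le> ennreal (real (Suc p) * real m ^ k * \<delta> ^ e)"
        by (rule ennreal_leI)
      then show ?thesis using True Suc.prems by (simp add: ennreal_mult[symmetric] del: of_nat_Suc)
    qed simp
  qed
  also have "\<dots> = ennreal (real (Suc p) * real m ^ k * \<delta> ^ e)" by (simp add: nn_integral_cmult)
  also have "\<dots> \<le> ennreal (real n ^ Suc k * \<delta> ^ e)"
  proof (rule ennreal_leI)
    have "real (Suc p) * real m ^ k \<le> real n * real n ^ k"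
      using m p by (intro mult_mono power_mono) auto
    then show "real (Suc p) * real m ^ k * \<delta> ^ e \<le> real n ^ Suc k * \<delta> ^ e"
      using Suc.prems by (intro mult_right_mono) auto
  qed
  finally show ?case unfolding e(2) .
qed

section \<open>Lower bounds for the probability of boxes\<close>

lemma finite_circle_net:
  assumes "0 < (\<eta>::real)"
  shows "\<exists>C. finite C \<and> C \<subseteq> sphere 0 1 \<and> (\<forall>v\<in>sphere 0 1. \<exists>c\<in>C. cmod (cnj c * v - 1) < \<eta>)"
proof -
  have "seq_compact (sphere (0::complex) 1)" by (simp add: compact_imp_seq_compact)
  then obtain C where C: "finite C" "C \<subseteq> sphere (0::complex) 1" "sphere 0 1 \<subseteq> (\<Union>c\<in>C. ball c \<eta>)"
    using seq_compact_imp_totally_bounded[rule_format, OF _ assms] by metis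
  have "\<exists>c\<in>C. cmod (cnj c * v - 1) < \<eta>" if v: "v \<in> sphere 0 1" for v
  proof -
    obtain c where c: "c \<in> C" "dist c v < \<eta>" using C(3) v by auto
    then have c1: "cmod c = 1" using C(2) by auto
    then have "cnj c * c = 1" by (simp add: complex_norm_square[symmetric] mult.commute)
    then have "cnj c * v - 1 = cnj c * (v - c)" by (simp add: algebra_simps)
    then have "cmod (cnj c * v - 1) = dist c v" using c1 by (simp add: norm_mult dist_norm norm_minus_commute)
    then show ?thesis using c by metis
  qed
  then show ?thesis using C by blast
qed

text \<open>The annulus of corner entries with modulus between |z| and q has mass a^(n-1) - b^(n-1),
  where a = 1 - |z|^2 and b = 1 - q^2 is smaller. Finitely many rotations of the target disc cover
  it, all equally likely by invariance under scalar matrices, so the disc carries at least the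
  fraction 1/card C. The annulus starts at |z| itself, which keeps the exponential rate
  exact.\<close>

lemma entry_ball_lower_bound:
  assumes H: "\<And>n. 1 \<le> n \<Longrightarrow> haar n (H n)" and z: "cmod z < 1" and \<epsilon>: "0 < \<epsilon>"
  shows "\<exists>C>0. \<exists>N. \<forall>n\<ge>N. ennreal (C * (1 - (cmod z)\<^sup>2) ^ (n - 1)) \<le>
    emeasure (H n) {U \<in> unitary_group n. cmod (cnj (U $$ (0, 0))) < 1 \<and> dist (cnj (U $$ (0, 0))) z < \<epsilon>}"
proof -
  define q where "q = cmod z + min (\<epsilon> / 2) ((1 - cmod z) / 2)"
  have q: "cmod z < q" "q < 1" "q \<le> cmod z + \<epsilon> / 2" using z \<epsilon> by (auto simp: q_def min_def field_simps)
  then have q0: "0 < q" by (meson le_less_trans norm_ge_zero)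
  have zq: "(cmod z)\<^sup>2 < q\<^sup>2" using q by (intro power_strict_mono) auto
  have q1: "q\<^sup>2 < 1" using q q0 by (simp add: abs_square_less_1)
  obtain C where C: "finite C" "C \<subseteq> sphere 0 1" "\<And>v. v \<in> sphere 0 1 \<Longrightarrow> \<exists>c\<in>C. cmod (cnj c * v - 1) < \<epsilon> / 2"
    using finite_circle_net[of "\<epsilon> / 2"] \<epsilon> by auto
  have "C \<noteq> {}" using C(3)[of 1] by auto
  then have card: "0 < card C" using C(1) by (simp add: card_gt_0_iff)
  define a where "a = 1 - (cmod z)\<^sup>2"
  define b where "b = 1 - q\<^sup>2"
  have ab: "0 < b" "b < a" using zq q1 by (auto simp: a_def b_def)
  have "(\<lambda>k. (b / a) ^ k) \<longlonglongrightarrow> 0" using ab by (intro LIMSEQ_power_zero) auto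
  then have "\<forall>\<^sub>F k in sequentially. (b / a) ^ k < 1 / 2" by (rule order_tendstoD) simp
  then obtain N where N: "\<And>k. N \<le> k \<Longrightarrow> (b / a) ^ k < 1 / 2" by (auto simp: eventually_sequentially)
  have main: "ennreal (1 / (2 * real (card C)) * a ^ (n - 1)) \<le>
    emeasure (H n) {U \<in> unitary_group n. cmod (cnj (U $$ (0, 0))) < 1 \<and> dist (cnj (U $$ (0, 0))) z < \<epsilon>}"
    (is "_ \<le> emeasure _ ?B")
    if n: "N + 2 \<le> n" for n
  proof -
    obtain p where p: "n = Suc (Suc p)" "N \<le> Suc p" using n by (metis add_2_eq_Suc' le_Suc_ex add_Suc le_add1 le_SucI)
    interpret haar n "H n" using H p by simp
    have n0: "0 < n" using p by simp
    note [measurable] = entry_measurable[OF n0 n0]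
    define D where "D c = {U \<in> unitary_group n. cmod (cnj (c * U $$ (0, 0))) < 1 \<and> dist (cnj (c * U $$ (0, 0))) z < \<epsilon>}" for c
    have Dm: "D c \<in> sets (H n)" for c
    proof -
      have "{U \<in> space (unitary_borel n). cmod (cnj (c * U $$ (0, 0))) < 1 \<and> dist (cnj (c * U $$ (0, 0))) z < \<epsilon>} \<in> sets (unitary_borel n)"
        by measurable
      then show ?thesis unfolding D_def sets_H space_unitary_borel .
    qed
    have D1: "D 1 = ?B" by (simp add: D_def)
    have rot: "emeasure (H n) (D c) = emeasure (H n) (D 1)" if c: "c \<in> C" for c
    proof -
      have c1: "cmod c = 1" using c C(2) by auto
      then have cc: "cnj c * c = 1" by (simp add: complex_norm_square[symmetric] mult.commute)
      have V: "c \<cdot>\<^sub>m 1\<^sub>m n \<in> unitary_group n"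
        by (rule unitary_groupI) (auto simp: cc if_distrib cong: if_cong)
      have Vm: "((c \<cdot>\<^sub>m 1\<^sub>m n) * U) $$ (0, 0) = c * U $$ (0, 0)" if "U \<in> unitary_group n" for U
      proof -
        have "U \<in> carrier_mat n n" using that by (rule unitary_group_carrier)
        then have "(c \<cdot>\<^sub>m 1\<^sub>m n) * U = c \<cdot>\<^sub>m U" by (simp add: mult_smult_assoc_mat[of _ n n _ n])
        then show ?thesis using n0 \<open>U \<in> carrier_mat n n\<close> by simp
      qed
      have "emeasure (H n) (D 1) = (\<integral>\<^sup>+U. indicator (D 1) U \<partial>H n)" using Dm by simp
      also have "\<dots> = (\<integral>\<^sup>+U. indicator (D 1) ((c \<cdot>\<^sub>m 1\<^sub>m n) * U) \<partial>H n)"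
        using Dm[of 1] by (intro left_invariant[OF V, symmetric]) auto
      also have "\<dots> = (\<integral>\<^sup>+U. indicator (D c) U \<partial>H n)"
      proof (rule nn_integral_cong)
        fix U assume "U \<in> space (H n)"
        then have U: "U \<in> unitary_group n" by simp
        show "indicator (D 1) ((c \<cdot>\<^sub>m 1\<^sub>m n) * U) = (indicator (D c) U :: ennreal)"
          using U unitary_group_mult[OF V U] by (simp add: D_def Vm norm_mult split: split_indicator)
      qed
      finally show ?thesis using Dm by simp
    qed
    have "{U \<in> unitary_group n. (cmod (U $$ (0, 0)))\<^sup>2 \<in> {(cmod z)\<^sup>2..q\<^sup>2}} \<subseteq> (\<Union>c\<in>C. D c)"
    \<comment> \<open>The distance to z splits into a radial part, at most \<epsilon>/2 by the
      choice of q, and an angular part, below \<epsilon>/2 by the choice of c in the net.\<close>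
    proof (clarify)
      fix U assume U: "U \<in> unitary_group n" and s: "(cmod (U $$ (0, 0)))\<^sup>2 \<in> {(cmod z)\<^sup>2..q\<^sup>2}"
      let ?r = "cmod (U $$ (0, 0))"
      have r: "cmod z \<le> ?r" "?r \<le> q" using s q0 by (auto intro: power2_le_imp_le)
      have polar: "\<exists>u. cmod u = 1 \<and> w = of_real (cmod w) * u" for w :: complex
      proof (cases "w = 0")
        case False
        then show ?thesis by (intro exI[of _ "w / of_real (cmod w)"]) (auto simp: norm_divide)
      qed (auto intro: exI[of _ 1])
      obtain u where u: "cmod u = 1" "cnj (U $$ (0, 0)) = of_real ?r * u" using polar[of "cnj (U $$ (0, 0))"] by auto
      obtain u0 where u0: "cmod u0 = 1" "z = of_real (cmod z) * u0" using polar by blast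
      have "u * cnj u0 \<in> sphere 0 1" using u u0 by (simp add: norm_mult)
      then obtain c where c: "c \<in> C" "cmod (cnj c * (u * cnj u0) - 1) < \<epsilon> / 2" using C(3) by blast
      have c1: "cmod c = 1" using c(1) C(2) by auto
      have "u0 * cnj u0 = 1" using u0(1) by (simp add: complex_norm_square[symmetric])
      then have "cnj c * u - u0 = (cnj c * (u * cnj u0) - 1) * u0" by (simp add: algebra_simps)
      then have near: "cmod (cnj c * u - u0) < \<epsilon> / 2" using c(2) u0(1) by (simp add: norm_mult)
      have "cnj (c * U $$ (0, 0)) - z = cnj c * (of_real ?r * u) - of_real (cmod z) * u0"
        by (simp only: complex_cnj_mult u(2) u0(2)[symmetric])
      also have "\<dots> = of_real (?r - cmod z) * (cnj c * u) + of_real (cmod z) * (cnj c * u - u0)"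
        by (simp add: algebra_simps)
      finally have "cnj (c * U $$ (0, 0)) - z = of_real (?r - cmod z) * (cnj c * u) + of_real (cmod z) * (cnj c * u - u0)" .
      then have "dist (cnj (c * U $$ (0, 0))) z \<le> cmod (of_real (?r - cmod z) * (cnj c * u)) + cmod (of_real (cmod z) * (cnj c * u - u0))"
        unfolding dist_norm by (simp only: norm_triangle_ineq)
      also have "\<dots> = (?r - cmod z) + cmod z * cmod (cnj c * u - u0)"
        using r c1 u(1) by (simp add: norm_mult del: of_real_diff)
      also have "cmod z * cmod (cnj c * u - u0) \<le> cmod (cnj c * u - u0)"
        using z by (intro mult_left_le_one_le) auto
      finally have "dist (cnj (c * U $$ (0, 0))) z < \<epsilon>" using near r q(3) by linarith
      moreover have "cmod (cnj (c * U $$ (0, 0))) < 1" using c1 r q(2) by (simp add: norm_mult)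
      ultimately show "U \<in> (\<Union>c\<in>C. D c)" using c(1) U by (auto simp: D_def)
    qed
    then have "emeasure (H n) {U \<in> unitary_group n. (cmod (U $$ (0, 0)))\<^sup>2 \<in> {(cmod z)\<^sup>2..q\<^sup>2}} \<le> emeasure (H n) (\<Union>c\<in>C. D c)"
      using Dm C(1) by (intro emeasure_mono) auto
    also have "\<dots> \<le> (\<Sum>c\<in>C. emeasure (H n) (D c))"
      using Dm C(1) by (intro emeasure_subadditive_finite) auto
    also have "\<dots> = of_nat (card C) * emeasure (H n) ?B"
      unfolding D1[symmetric] by (subst sum.cong[OF refl rot]) auto
    finally have le: "ennreal (a ^ Suc p - b ^ Suc p) \<le> of_nat (card C) * emeasure (H n) ?B"
      unfolding a_def b_def using emeasure_entry[OF p(1), of "(cmod z)\<^sup>2" "q\<^sup>2"] zq q1 by simp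
    \<comment> \<open>For large n the subtracted power is at most half of the main one; this is the
      origin of the 2 in the constant.\<close>
    have "(b / a) ^ Suc p < 1 / 2" using N p(2) by blast
    then have "b ^ Suc p < a ^ Suc p / 2"
      using ab by (simp add: power_divide divide_less_eq zero_less_power del: power_Suc)
    then have "1 / (2 * real (card C)) * a ^ Suc p \<le> (a ^ Suc p - b ^ Suc p) / real (card C)"
      using card by (simp add: field_simps del: power_Suc)
    also have "ennreal \<dots> \<le> emeasure (H n) ?B"
    proof -
      have "a ^ Suc p - b ^ Suc p \<le> real (card C) * measure (H n) ?B"
      proof -
        have "ennreal (a ^ Suc p - b ^ Suc p) \<le> ennreal (real (card C) * measure (H n) ?B)"
          using le by (simp add: emeasure_eq_measure ennreal_mult'' ennreal_of_nat_eq_real_of_nat)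
        then show ?thesis by (subst (asm) ennreal_le_iff) auto
      qed
      then show ?thesis unfolding emeasure_eq_measure using card
        by (intro ennreal_leI) (simp add: divide_le_eq mult.commute del: power_Suc)
    qed
    finally show ?thesis using p(1) by (simp add: ennreal_leI del: power_Suc)
  qed
  show ?thesis
    using main card by (intro exI[of _ "1 / (2 * real (card C))"] conjI exI[of _ "N + 2"]) (auto simp: a_def)
qed

lemma krylov_box_sets:
  assumes "0 < n"
  shows "{U \<in> unitary_group n. \<forall>j<k. cmod (krylov_alpha U j) < 1 \<and> dist (krylov_alpha U j) (z j) < \<epsilon>} \<in> sets (unitary_borel n)"
proof -
  note [measurable] = krylov_alpha_measurable[OF assms]
  have "{U \<in> space (unitary_borel n). \<forall>j\<in>{..<k}. cmod (krylov_alpha U j) < 1 \<and> dist (krylov_alpha U j) (z j) < \<epsilon>} \<in> sets (unitary_borel n)"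
    by measurable
  then show ?thesis unfolding space_unitary_borel Ball_def lessThan_iff .
qed

text \<open>The integrand factors over the first coefficient and the shifted rest, so the
  probability of a box of length k + 1 at size n is exactly the product of a disc probability at
  size n and a box probability at size n - 1.\<close>

lemma krylov_box_lower_bound:
  assumes H: "\<And>n. 1 \<le> n \<Longrightarrow> haar n (H n)" and z: "\<And>j. cmod (z j) < 1" and \<epsilon>: "0 < \<epsilon>"
  shows "\<exists>C>0. \<exists>N. \<forall>n\<ge>N. ennreal (C * vprod z k ^ n) \<le>
    emeasure (H n) {U \<in> unitary_group n. \<forall>j<k. cmod (krylov_alpha U j) < 1 \<and> dist (krylov_alpha U j) (z j) < \<epsilon>}"
  using z
proof (induction k arbitrary: z)
  case 0
  have "ennreal (1 * vprod z 0 ^ n) \<le> emeasure (H n) {U \<in> unitary_group n. \<forall>j<0. cmod (krylov_alpha U j) < 1 \<and> dist (krylov_alpha U j) (z j) < \<epsilon>}"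
    if n: "1 \<le> n" for n
  proof -
    interpret haar n "H n" using H n by simp
    show ?thesis using emeasure_space_1 by simp
  qed
  then show ?case by (intro exI[of _ 1] conjI exI[of _ 1]) auto
next
  case (Suc k)
  obtain C N where C: "0 < C" and N: "\<And>n. N \<le> n \<Longrightarrow> ennreal (C * vprod (\<lambda>j. z (Suc j)) k ^ n) \<le>
    emeasure (H n) {U \<in> unitary_group n. \<forall>j<k. cmod (krylov_alpha U j) < 1 \<and> dist (krylov_alpha U j) (z (Suc j)) < \<epsilon>}"
    using Suc.IH[of "\<lambda>j. z (Suc j)"] Suc.prems by blast
  obtain C' N' where C': "0 < C'" and N': "\<And>n. N' \<le> n \<Longrightarrow> ennreal (C' * (1 - (cmod (z 0))\<^sup>2) ^ (n - 1)) \<le>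
    emeasure (H n) {U \<in> unitary_group n. cmod (cnj (U $$ (0, 0))) < 1 \<and> dist (cnj (U $$ (0, 0))) (z 0) < \<epsilon>}"
    using entry_ball_lower_bound[of H "z 0", OF H Suc.prems \<epsilon>] by blast
  have "ennreal (C' * C * vprod z (Suc k) ^ n) \<le>
    emeasure (H n) {U \<in> unitary_group n. \<forall>j<Suc k. cmod (krylov_alpha U j) < 1 \<and> dist (krylov_alpha U j) (z j) < \<epsilon>}"
    if n: "N + N' + 2 \<le> n" for n
  proof -
    define m where "m = n - 1"
    have m: "n = Suc m" "0 < m" "N \<le> m" "N' \<le> n" using n by (auto simp: m_def)
    interpret haar n "H n" using H m by simp
    interpret W: haar m "H m" using H m by simp
    have n0: "0 < n" using m by simp
    let ?Q = "\<lambda>c j. cmod c < 1 \<and> dist c (z j) < \<epsilon>"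
    let ?g = "\<lambda>c a. if ?Q c 0 \<and> (\<forall>j<k. ?Q (a j) (Suc j)) then 1 else 0 :: ennreal"
    let ?E = "emeasure (H m) {W \<in> unitary_group m. \<forall>j<k. ?Q (krylov_alpha W j) (Suc j)}"
    have all: "(\<forall>j<Suc k. ?Q (a j) j) \<longleftrightarrow> ?Q (a 0) 0 \<and> (\<forall>j<k. ?Q (a (Suc j)) (Suc j))" for a
      by (auto simp: less_Suc_eq_0_disj)
    have g: "?g c a = (if ?Q c 0 then 1 else 0) * (if \<forall>j<k. ?Q (a j) (Suc j) then 1 else 0)" for c a by simp
    have sets: "{W \<in> unitary_group m. \<forall>j<k. ?Q (krylov_alpha W j) (Suc j)} \<in> sets (unitary_borel m)"
      using krylov_box_sets[OF m(2), of k "\<lambda>j. z (Suc j)"] .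
    have setsn: "{U \<in> unitary_group n. \<forall>j<Suc k. ?Q (krylov_alpha U j) j} \<in> sets (unitary_borel n)"
      by (rule krylov_box_sets[OF n0])
    have ind: "(\<lambda>W. if \<forall>j<k. ?Q (krylov_alpha W j) (Suc j) then 1 else 0 :: ennreal) \<in> borel_measurable (unitary_borel m)"
      by (rule borel_measurable_If_unitary[OF sets])
    note [measurable] = entry_measurable[OF n0 n0]
    have B: "{U \<in> unitary_group n. ?Q (cnj (U $$ (0, 0))) 0} \<in> sets (unitary_borel n)"
    proof -
      have "{U \<in> space (unitary_borel n). ?Q (cnj (U $$ (0, 0))) 0} \<in> sets (unitary_borel n)" by measurable
      then show ?thesis unfolding space_unitary_borel .
    qed
    have "emeasure (H n) {U \<in> unitary_group n. \<forall>j<Suc k. ?Q (krylov_alpha U j) j} =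
      (\<integral>\<^sup>+U. ?g (krylov_alpha U 0) (\<lambda>j. krylov_alpha U (Suc j)) \<partial>H n)"
      unfolding emeasure_eq_nn_integral[where Q = "\<lambda>U. \<forall>j<Suc k. ?Q (krylov_alpha U j) j", OF setsn] unfolding all ..
    also have "\<dots> = (\<integral>\<^sup>+U. \<integral>\<^sup>+W. ?g (cnj (U $$ (0, 0))) (krylov_alpha W) \<partial>H m \<partial>H n)"
    proof (rule nn_integral_krylov_alpha_split[OF W.haar_axioms m(1,2)])
      show "(\<lambda>U. ?g (krylov_alpha U 0) (\<lambda>j. krylov_alpha U (Suc j))) \<in> borel_measurable (unitary_borel n)"
        unfolding all[symmetric] by (rule borel_measurable_If_unitary[OF setsn])
      show "(\<lambda>W. ?g c (krylov_alpha W)) \<in> borel_measurable (unitary_borel m)" for c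
        unfolding g by (rule borel_measurable_times_ennreal[OF borel_measurable_const ind])
    qed
    also have "\<dots> = (\<integral>\<^sup>+U. (if ?Q (cnj (U $$ (0, 0))) 0 then 1 else 0) * ?E \<partial>H n)"
      unfolding g W.emeasure_eq_nn_integral[where Q = "\<lambda>W. \<forall>j<k. ?Q (krylov_alpha W j) (Suc j)", OF sets]
      by (rule nn_integral_cong, rule nn_integral_cmult) (simp only: W.measurable_H, rule ind)
    also have "\<dots> = (\<integral>\<^sup>+U. (if ?Q (cnj (U $$ (0, 0))) 0 then 1 else 0) \<partial>H n) * ?E"
      by (rule nn_integral_multc) (simp only: measurable_H, rule borel_measurable_If_unitary[OF B])
    also have "\<dots> = emeasure (H n) {U \<in> unitary_group n. ?Q (cnj (U $$ (0, 0))) 0} * ?E"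
      unfolding emeasure_eq_nn_integral[where Q = "\<lambda>U. ?Q (cnj (U $$ (0, 0))) 0", OF B] ..
    finally have eq: "emeasure (H n) {U \<in> unitary_group n. \<forall>j<Suc k. ?Q (krylov_alpha U j) j} =
      emeasure (H n) {U \<in> unitary_group n. ?Q (cnj (U $$ (0, 0))) 0} * ?E" .
    have v: "0 \<le> vprod z (Suc k)" "vprod z (Suc k) \<le> 1" "0 \<le> vprod (\<lambda>j. z (Suc j)) k"
      using less_imp_le[OF Suc.prems] by (simp_all add: vprod_nonneg vprod_le_1)
    have z0: "0 \<le> 1 - (cmod (z 0))\<^sup>2" using Suc.prems[of 0] by (simp add: power_le_one)
    \<comment> \<open>Both factors come with exponent m = n - 1. Passing to exponent n only weakens
      the bound, since the product is at most 1, and gives the induction a uniform shape.\<close>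
    have "C' * C * vprod z (Suc k) ^ n \<le> C' * C * vprod z (Suc k) ^ m"
      using C C' v m by (intro mult_left_mono power_decreasing) auto
    also have "\<dots> = (C' * (1 - (cmod (z 0))\<^sup>2) ^ (n - 1)) * (C * vprod (\<lambda>j. z (Suc j)) k ^ m)"
      using m(1) by (simp add: vprod_Suc_shift power_mult_distrib)
    finally have "ennreal (C' * C * vprod z (Suc k) ^ n) \<le>
      ennreal (C' * (1 - (cmod (z 0))\<^sup>2) ^ (n - 1)) * ennreal (C * vprod (\<lambda>j. z (Suc j)) k ^ m)"
      using C C' v z0 by (subst ennreal_mult[symmetric]) (auto intro!: ennreal_leI)
    also have "\<dots> \<le> emeasure (H n) {U \<in> unitary_group n. ?Q (cnj (U $$ (0, 0))) 0} * ?E"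
      using N[OF m(3)] N'[OF m(4)] by (intro mult_mono) auto
    finally show ?thesis unfolding eq .
  qed
  then show ?case using C C' by (intro exI[of _ "C' * C"] conjI exI[of _ "N + N' + 2"]) auto
qed

text \<open>The strict bounds keep the product of the first k factors away from 0, so more than k
  entries exist at every point of the box, and existing entries converge.\<close>

lemma openin_Y_box_set:
  "openin Y_top {\<alpha> \<in> Y. \<forall>j<k. cmod (ventry \<alpha> j) < 1 \<and> dist (ventry \<alpha> j) (z j) < \<epsilon>}"
  unfolding openin_Y_top
proof (intro conjI allI impI)
  fix f \<alpha> assume a: "range f \<subseteq> Y \<and> \<alpha> \<in> {\<alpha> \<in> Y. \<forall>j<k. cmod (ventry \<alpha> j) < 1 \<and> dist (ventry \<alpha> j) (z j) < \<epsilon>} \<and> Y_conv f \<alpha>"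
  then have \<alpha>: "\<alpha> \<in> Y" "\<And>j. j < k \<Longrightarrow> cmod (ventry \<alpha> j) < 1" "\<And>j. j < k \<Longrightarrow> dist (ventry \<alpha> j) (z j) < \<epsilon>" by auto
  have "vprod (ventry \<alpha>) k \<noteq> 0"
  proof -
    have "(cmod (ventry \<alpha> j))\<^sup>2 < 1" if "j < k" for j using \<alpha>(2)[OF that] by (simp add: abs_square_less_1)
    then show ?thesis unfolding vprod_def by (subst prod_zero_iff) (simp, force)
  qed
  then have len: "enat k < vlen \<alpha>" using Y_vprod_eq_0_iff[OF \<alpha>(1), of k] by simp
  have "\<forall>\<^sub>F i in sequentially. cmod (ventry (f i) j) < 1 \<and> dist (ventry (f i) j) (z j) < \<epsilon>" if j: "j < k" for j
  proof -
    have lim: "(\<lambda>i. ventry (f i) j) \<longlonglongrightarrow> ventry \<alpha> j"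
      using Y_conv_entryD(2)[of f \<alpha> j] a len j by (meson enat_ord_simps(2) less_trans)
    have "\<forall>\<^sub>F i in sequentially. cmod (ventry (f i) j) < 1"
      by (rule order_tendstoD(2)[OF tendsto_norm[OF lim] \<alpha>(2)[OF j]])
    moreover have "\<forall>\<^sub>F i in sequentially. dist (ventry (f i) j) (z j) < \<epsilon>"
      by (rule order_tendstoD(2)[OF tendsto_dist[OF lim tendsto_const] \<alpha>(3)[OF j]])
    ultimately show ?thesis by eventually_elim simp
  qed
  then have "\<forall>\<^sub>F i in sequentially. \<forall>j\<in>{..<k}. cmod (ventry (f i) j) < 1 \<and> dist (ventry (f i) j) (z j) < \<epsilon>"
    by (intro eventually_ball_finite) auto
  then show "\<forall>\<^sub>F i in sequentially. f i \<in> {\<alpha> \<in> Y. \<forall>j<k. cmod (ventry \<alpha> j) < 1 \<and> dist (ventry \<alpha> j) (z j) < \<epsilon>}"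
    by eventually_elim (use a in auto)
qed auto

theorem theorem4p1:
  fixes H :: "nat \<Rightarrow> complex mat measure"
  assumes haar: "\<And>n. n \<ge> 1 \<Longrightarrow> haar_unitary n (H n)"
  shows "LDP Y_top
           (\<lambda>n. distr (H n) (borel_of Y_top) (\<lambda>U. verblunsky (spectral_measure U)))
           verblunsky_rate (\<lambda>n. real n)
       \<and> good_rate_function Y_top verblunsky_rate"
proof
  let ?f = "\<lambda>U. verblunsky (spectral_measure U)"
  let ?P = "\<lambda>n. distr (H n) (borel_of Y_top) ?f"
  have H: "haar n (H n)" if "1 \<le> n" for n using haar[OF that] by unfold_locales
  have f: "?f \<in> measurable (H n) (borel_of Y_top)" if n: "1 \<le> n" for n
  proof -
    interpret haar n "H n" by (rule H[OF n])
    show ?thesis using verblunsky_measurable[of n] n by simp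
  qed
  \<comment> \<open>Both bounds concern the entries alone, and these are
    \<open>krylov_alpha\<close>; openness makes the sets measurable for the law on
    \<open>Y\<close>.\<close>
  have em: "emeasure (?P n) {\<alpha> \<in> Y. Q (ventry \<alpha>)} = emeasure (H n) {U \<in> unitary_group n. Q (krylov_alpha U)}"
    if n: "1 \<le> n" and Q: "openin Y_top {\<alpha> \<in> Y. Q (ventry \<alpha>)}" for n :: nat and Q :: "(nat \<Rightarrow> complex) \<Rightarrow> bool"
  proof -
    interpret haar n "H n" by (rule H[OF n])
    have "?f -` {\<alpha> \<in> Y. Q (ventry \<alpha>)} \<inter> space (H n) = {U \<in> unitary_group n. Q (krylov_alpha U)}"
      using verblunsky_spectral_measure[of n] n by auto
    then show ?thesis using emeasure_distr[OF f[OF n] openin_borel_of[OF Q]] by simp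
  qed
  have P: "prob_space (?P n)" if n: "1 \<le> n" for n
  proof -
    interpret haar n "H n" by (rule H[OF n])
    show ?thesis by (rule prob_space_distr[OF f[OF n]])
  qed
  show "LDP Y_top ?P verblunsky_rate (\<lambda>n. real n)"
  proof (rule verblunsky_LDP_criterion[OF P])
    show "sets (?P n) = sets (borel_of Y_top)" for n by simp
    fix n k :: nat and \<delta> :: real assume k: "k < n" and \<delta>: "0 < \<delta>" "\<delta> \<le> 1"
    then have n: "1 \<le> n" by simp
    interpret P: prob_space "?P n" by (rule P[OF n])
    have "ennreal (measure (?P n) {\<alpha> \<in> Y. vprod (ventry \<alpha>) k < \<delta>}) \<le> ennreal (real n ^ k * \<delta> ^ (n - Suc k))"
      unfolding P.emeasure_eq_measure[symmetric] em[OF n openin_vprod_less]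
      by (rule emeasure_vprod_less[OF H k \<delta>(1)])
    then show "measure (?P n) {\<alpha> \<in> Y. vprod (ventry \<alpha>) k < \<delta>} \<le> real n ^ k * \<delta> ^ (n - Suc k)"
      using \<delta> by (subst (asm) ennreal_le_iff) auto
  next
    fix z :: "nat \<Rightarrow> complex" and k and \<epsilon> :: real assume z: "\<And>j. cmod (z j) < 1" and \<epsilon>: "0 < \<epsilon>"
    obtain C N where C: "0 < C" and N: "\<And>n. N \<le> n \<Longrightarrow> ennreal (C * vprod z k ^ n) \<le>
      emeasure (H n) {U \<in> unitary_group n. \<forall>j<k. cmod (krylov_alpha U j) < 1 \<and> dist (krylov_alpha U j) (z j) < \<epsilon>}"
      using krylov_box_lower_bound[of H z, OF H z \<epsilon>] by blast
    have "C * vprod z k ^ n \<le> measure (?P n) {\<alpha> \<in> Y. \<forall>j<k. cmod (ventry \<alpha> j) < 1 \<and> dist (ventry \<alpha> j) (z j) < \<epsilon>}"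
      if n: "N + 1 \<le> n" for n
    proof -
      have n1: "1 \<le> n" "N \<le> n" using n by auto
      interpret P: prob_space "?P n" by (rule P[OF n1(1)])
      have "ennreal (C * vprod z k ^ n) \<le> ennreal (measure (?P n) {\<alpha> \<in> Y. \<forall>j<k. cmod (ventry \<alpha> j) < 1 \<and> dist (ventry \<alpha> j) (z j) < \<epsilon>})"
        unfolding P.emeasure_eq_measure[symmetric] em[OF n1(1) openin_Y_box_set] by (rule N[OF n1(2)])
      then show ?thesis by (subst (asm) ennreal_le_iff) auto
    qed
    then show "\<exists>C>0. \<forall>\<^sub>F n in sequentially. C * vprod z k ^ n \<le>
        measure (?P n) {\<alpha> \<in> Y. \<forall>j<k. cmod (ventry \<alpha> j) < 1 \<and> dist (ventry \<alpha> j) (z j) < \<epsilon>}"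
      using C by (intro exI[of _ C] conjI eventually_sequentiallyI[of "N + 1"]) auto
  qed
  show "good_rate_function Y_top verblunsky_rate" by (rule good_verblunsky_rate)
qed

end
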